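(* Every scattered linear ordering $L$ (countable, with universe $\omega$) has a $\Sigma_2$-generically c.e. copy and a $\Sigma_2$-coarsely c.e. copy.
   Context: A linear ordering is scattered if the order of the rationals does not embed in it. Structures are countable with universe $\omega$ (substructures have universe a subset of $\omega$). A copy of a structure is a structure with universe $\omega$ isomorphic to it. Formulas are infinitary formulas of $\mathcal{L}_{\omega_1,\omega}$: $\Sigma_0=\Pi_0$ are the finitary quantifier-free formulas, and for $\alpha\ge 1$ a $\Sigma_\alpha$ formula is a countable disjunction of formulas $\exists \bar x\,\psi$ with $\psi\in\Pi_\beta$, $\beta<\alpha$ (dually for $\Pi_\alpha$). A substructure $\mathcal{B}$ of $\mathcal{A}$ is a $\Sigma_\alpha$ elementary substructure if for every $\Sigma_\alpha$ formula $\phi$ and every tuple $\bar b$ from $\mathcal{B}$, $\mathcal{B}\models\phi(\bar b)\iff\mathcal{A}\models\phi(\bar b)$. A set $D\subseteq\omega$ is dense if $\lim_{n\to\infty}|D\cap\{0,\dots,n\}|/(n+1)=1$. A c.e. substructure is one whose universe is c.e., each of whose relations (restricted to that universe) is c.e., and each of whose functions has c.e. graph. $\mathcal{A}$ is $\Sigma_\alpha$-generically c.e. if there is a dense c.e. set $D$ such that the substructure of $\mathcal{A}$ with universe $D$ is a c.e. substructure and a $\Sigma_\alpha$ elementary substructure of $\mathcal{A}$. $\mathcal{A}$ is $\Sigma_\alpha$-coarsely c.e. if there are a dense set $D$ and a c.e. structure $\mathcal{E}$ (universe $\omega$, relations c.e., graphs of functions c.e.) such that a structure $\mathcal{D}$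 with universe $D$ is a $\Sigma_\alpha$ elementary substructure of both $\mathcal{A}$ and $\mathcal{E}$. *)

theory Defs
  imports Complex_Main "HOL-Library.Countable_Set_Type"
begin

section \<open>Structures in the language of linear orderings\<close>

text \<open>
  The language has one binary relation symbol, read as the reflexive order, and no function
  symbols; so clauses about functions of a structure are vacuous and do not appear below.
\<close>

record struct =
  univ :: "nat set"
  rel :: "nat rel"

definition omega_struct :: "nat rel \<Rightarrow> struct" where
  "omega_struct r = \<lparr>univ = UNIV, rel = r\<rparr>"

definition induced :: "struct \<Rightarrow> nat set \<Rightarrow> struct" where
  "induced A D = \<lparr>univ = D, rel = Restr (rel A) D\<rparr>"

definition substructure :: "struct \<Rightarrow> struct \<Rightarrow> bool" where
  "substructure B A \<longleftrightarrow> univ B \<subseteq> univ A \<and> B = induced A (univ B)"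

definition copy_of :: "nat rel \<Rightarrow> nat rel \<Rightarrow> bool" where
  "copy_of M L \<longleftrightarrow> (\<exists>f. bij f \<and> (\<forall>x y. (x, y) \<in> L \<longleftrightarrow> (f x, f y) \<in> M))"

text \<open>
  For an antisymmetric relation the function below is automatically injective, so for a
  linear order it is an embedding of the order of the rationals.
\<close>

definition scattered :: "nat rel \<Rightarrow> bool" where
  "scattered L \<longleftrightarrow> \<not> (\<exists>f :: rat \<Rightarrow> nat. \<forall>p q. p \<le> q \<longleftrightarrow> (f p, f q) \<in> L)"


section \<open>Infinitary formulas\<close>

text \<open>
  Variables are natural numbers. Conjunctions and disjunctions range over countable sets of
  formulas; the finite ones, the empty one included, serve as the finitary connectives.
\<close>

datatype fm =
    Eq nat nat
  | Le nat nat
  | Neg fm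
  | Conj "fm cset"
  | Disj "fm cset"
  | Ex nat fm
  | All nat fm

primrec fv :: "fm \<Rightarrow> nat set" where
  "fv (Eq i j) = {i, j}"
| "fv (Le i j) = {i, j}"
| "fv (Neg \<phi>) = fv \<phi>"
| "fv (Conj F) = \<Union> (rcset (cimage fv F))"
| "fv (Disj F) = \<Union> (rcset (cimage fv F))"
| "fv (Ex i \<phi>) = fv \<phi> - {i}"
| "fv (All i \<phi>) = fv \<phi> - {i}"

primrec sat :: "struct \<Rightarrow> fm \<Rightarrow> (nat \<Rightarrow> nat) \<Rightarrow> bool" where
  "sat A (Eq i j) = (\<lambda>v. v i = v j)"
| "sat A (Le i j) = (\<lambda>v. (v i, v j) \<in> rel A)"
| "sat A (Neg \<phi>) = (\<lambda>v. \<not> sat A \<phi> v)"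
| "sat A (Conj F) = (\<lambda>v. \<forall>P \<in> rcset (cimage (sat A) F). P v)"
| "sat A (Disj F) = (\<lambda>v. \<exists>P \<in> rcset (cimage (sat A) F). P v)"
| "sat A (Ex i \<phi>) = (\<lambda>v. \<exists>a \<in> univ A. sat A \<phi> (v(i := a)))"
| "sat A (All i \<phi>) = (\<lambda>v. \<forall>a \<in> univ A. sat A \<phi> (v(i := a)))"

lemma fv_Conj: "fv (Conj F) = (\<Union>\<phi> \<in> rcset F. fv \<phi>)"
  and fv_Disj: "fv (Disj F) = (\<Union>\<phi> \<in> rcset F. fv \<phi>)"
  by (simp_all add: cimage.rep_eq)

lemma sat_Conj: "sat A (Conj F) v \<longleftrightarrow> (\<forall>\<phi> \<in> rcset F. sat A \<phi> v)"
  and sat_Disj: "sat A (Disj F) v \<longleftrightarrow> (\<exists>\<phi> \<in> rcset F. sat A \<phi> v)"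
  by (simp_all add: cimage.rep_eq)

inductive qf :: "fm \<Rightarrow> bool" where
  "qf (Eq i j)"
| "qf (Le i j)"
| "qf \<phi> \<Longrightarrow> qf (Neg \<phi>)"
| "finite (rcset F) \<Longrightarrow> (\<And>\<phi>. \<phi> \<in> rcset F \<Longrightarrow> qf \<phi>) \<Longrightarrow> qf (Conj F)"
| "finite (rcset F) \<Longrightarrow> (\<And>\<phi>. \<phi> \<in> rcset F \<Longrightarrow> qf \<phi>) \<Longrightarrow> qf (Disj F)"

abbreviation exs :: "nat list \<Rightarrow> fm \<Rightarrow> fm" where
  "exs xs \<phi> \<equiv> foldr Ex xs \<phi>"

abbreviation alls :: "nat list \<Rightarrow> fm \<Rightarrow> fm" where
  "alls xs \<phi> \<equiv> foldr All xs \<phi>"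

text \<open>The levels of the hierarchy with a finite index.\<close>

inductive is_Sigma :: "nat \<Rightarrow> fm \<Rightarrow> bool" and is_Pi :: "nat \<Rightarrow> fm \<Rightarrow> bool" where
  Sigma_0: "qf \<phi> \<Longrightarrow> is_Sigma 0 \<phi>"
| Pi_0: "qf \<phi> \<Longrightarrow> is_Pi 0 \<phi>"
| Sigma_pos: "n > 0 \<Longrightarrow>
    (\<And>\<phi>. \<phi> \<in> rcset F \<Longrightarrow> \<exists>xs m \<psi>. \<phi> = exs xs \<psi> \<and> m < n \<and> is_Pi m \<psi>) \<Longrightarrow>
    is_Sigma n (Disj F)"
| Pi_pos: "n > 0 \<Longrightarrow>
    (\<And>\<phi>. \<phi> \<in> rcset F \<Longrightarrow> \<exists>xs m \<psi>. \<phi> = alls xs \<psi> \<and> m < n \<and> is_Sigma m \<psi>) \<Longrightarrow>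
    is_Pi n (Conj F)"

text \<open>
  Only formulas with finitely many free variables count as formulas of the infinitary
  language. The tuple from the substructure is given by the values of the assignment on the
  free variables.
\<close>

definition Sigma_elementary :: "nat \<Rightarrow> struct \<Rightarrow> struct \<Rightarrow> bool" where
  "Sigma_elementary n B A \<longleftrightarrow> substructure B A \<and>
     (\<forall>\<phi> v. is_Sigma n \<phi> \<and> finite (fv \<phi>) \<and> v ` fv \<phi> \<subseteq> univ B \<longrightarrow>
        (sat B \<phi> v \<longleftrightarrow> sat A \<phi> v))"


section \<open>Computably enumerable sets and relations\<close>

text \<open>Programs for the partial recursive functions and their evaluation on argument lists.\<close>

datatype recf =
    Zero
  | Succ
  | Proj nat
  | Comp recf "recf list"
  | PrimRec recf recf
  | Mu recf

inductive eval :: "recf \<Rightarrow> nat list \<Rightarrow> nat \<Rightarrow> bool" where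
  "eval Zero xs 0"
| "eval Succ [x] (Suc x)"
| "i < length xs \<Longrightarrow> eval (Proj i) xs (xs ! i)"
| "list_all2 (\<lambda>g y. eval g xs y) gs ys \<Longrightarrow> eval f ys z \<Longrightarrow> eval (Comp f gs) xs z"
| "eval f xs z \<Longrightarrow> eval (PrimRec f g) (0 # xs) z"
| "eval (PrimRec f g) (n # xs) y \<Longrightarrow> eval g (n # y # xs) z \<Longrightarrow>
     eval (PrimRec f g) (Suc n # xs) z"
| "eval f (n # xs) 0 \<Longrightarrow> (\<And>m. m < n \<Longrightarrow> \<exists>y. eval f (m # xs) (Suc y)) \<Longrightarrow>
     eval (Mu f) xs n"

definition ce_set :: "nat set \<Rightarrow> bool" where
  "ce_set D \<longleftrightarrow> (\<exists>e. \<forall>x. x \<in> D \<longleftrightarrow> (\<exists>z. eval e [x] z))"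

definition ce_rel :: "nat rel \<Rightarrow> bool" where
  "ce_rel r \<longleftrightarrow> (\<exists>e. \<forall>x y. (x, y) \<in> r \<longleftrightarrow> (\<exists>z. eval e [x, y] z))"

definition ce_struct :: "struct \<Rightarrow> bool" where
  "ce_struct A \<longleftrightarrow> ce_set (univ A) \<and> ce_rel (rel A)"


section \<open>Generically and coarsely c.e. structures\<close>

definition dense :: "nat set \<Rightarrow> bool" where
  "dense D \<longleftrightarrow> (\<lambda>n. real (card (D \<inter> {0..n})) / real (n + 1)) \<longlonglongrightarrow> 1"

definition Sigma_generically_ce :: "nat \<Rightarrow> nat rel \<Rightarrow> bool" where
  "Sigma_generically_ce n r \<longleftrightarrow> (\<exists>D. dense D \<and> ce_set D \<and>
     ce_struct (induced (omega_struct r) D) \<and>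
     Sigma_elementary n (induced (omega_struct r) D) (omega_struct r))"

definition Sigma_coarsely_ce :: "nat \<Rightarrow> nat rel \<Rightarrow> bool" where
  "Sigma_coarsely_ce n r \<longleftrightarrow> (\<exists>D s B. dense D \<and> ce_struct (omega_struct s) \<and> univ B = D \<and>
     Sigma_elementary n B (omega_struct r) \<and> Sigma_elementary n B (omega_struct s))"

end

theory Submission
  imports Defs "HOL-Library.Discrete_Functions"
begin

text \<open>Call two points of a linear order equivalent if only finitely many points lie between them; the
classes are the blocks of the order. The idea is to find in \<open>L\<close> a suborder \<open>B\<close> that is simple enough
to have a decidable copy and that is nevertheless \<open>\<Sigma>\<^sub>2\<close> elementary in \<open>L\<close>; the rest of \<open>L\<close>, which may be
as complicated as it likes, is then pushed into a sparse set.

What makes \<open>\<Sigma>\<^sub>2\<close> elementarity cheap in scattered orders is a combinatorial criterion, called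
\<open>faithful\<close> below: a suborder \<open>D\<close> should be a union of blocks, contain the endpoints of the whole order,
and have no adjacent pair and no endpoint of its own that is not one of the whole order. A \<open>\<Pi>\<^sub>1\<close> formula
about a tuple can only bound from above the sizes of the intervals into which the tuple cuts the order.
So a tuple \<open>a\<close> outside \<open>D\<close>, lying in a gap between points of \<open>D\<close>, may be replaced by a run of consecutive
points of \<open>D\<close> in the same gap: the intervals between them are empty, and the two outer ones have an
infinite counterpart, since \<open>a\<close> is not at finite distance from \<open>D\<close>
(\<open>faithful_no_least_outside\<close>). Long runs exist because an infinite scattered order contains finite
convex sets of every size; otherwise every infinite interval could be cut into two infinite ones and
the rationals would embed (\<open>scattered_ex_finite_convex\<close>). This gives
\<open>back_and_forth_if_faithful\<close>, and \<open>Sigma_elementary_2_if_back_and_forth\<close> translates it into formulas.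

A faithful suborder of a very simple kind always exists (\<open>realizable_if_scattered\<close>). Going up from the
least element, if there is one, either a block of type \<open>\<omega>\<close> starts the order or one stops after finitely
many steps; likewise at the upper end. If one of the two end blocks is infinite, the two together are
faithful. If the order has only finite end pieces \<open>F\<close> and \<open>G\<close>, then the part between them has no
endpoints. Being scattered it contains an infinite block; so it contains a block of type \<open>\<zeta>\<close>, the order
of the integers, or a descending sequence of blocks of type \<open>\<omega>\<close>, or, if both fail, an ascending sequence
of blocks of type \<open>\<omega>*\<close>. In each of the three cases these blocks, placed between \<open>F\<close> and \<open>G\<close>, are
faithful. All the resulting order types, sums of finite orders, \<open>\<omega>\<close>, \<open>\<omega>*\<close>, \<open>\<omega>\<cdot>\<omega>*\<close> and \<open>\<omega>*\<cdot>\<omega>\<close>, have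
decidable copies. The choice can be made such that the complement of \<open>B\<close> in \<open>L\<close> is infinite or empty.

If it is empty, then \<open>L\<close> itself has a decidable copy, and there is nothing else to do. Suppose that it is
infinite. Let \<open>D\<close> be the set of the numbers \<open>x\<close> that exceed the largest square \<open>m\<^sup>2 \<le> x\<close> by at
least 2; it is decidable and dense with an infinite complement. Put on \<open>D\<close> a decidable order of
type \<open>B\<close>. A bijection of \<open>L\<close> onto \<open>\<omega>\<close> that carries \<open>B\<close> to \<open>D\<close> gives the generically c.e. copy of \<open>L\<close>. The same
copy is coarsely c.e.: the complement of \<open>D\<close> can be made into one more block of type \<open>\<zeta>\<close>, inserted into
\<open>D\<close> just above a part without greatest element, up to reversal of the order, and this yields a decidable order on all of \<open>\<omega>\<close> in
which \<open>D\<close> is again faithful (\<open>realizable_if_faithful\<close>).\<close>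

section \<open>Computable functions and decidable relations\<close>

text \<open>The values of \<open>f\<close> matter on lists of length \<open>k\<close> only, so that a function of \<open>k\<close> arguments can be written
as a function of their list.\<close>

definition computable :: "nat \<Rightarrow> (nat list \<Rightarrow> nat) \<Rightarrow> bool" where
  "computable k f \<longleftrightarrow> (\<exists>e. \<forall>xs. length xs = k \<longrightarrow> (\<forall>z. eval e xs z \<longleftrightarrow> z = f xs))"

inductive_cases eval_ZeroE: "eval Zero xs z"
inductive_cases eval_SuccE: "eval Succ xs z"
inductive_cases eval_ProjE: "eval (Proj i) xs z"
inductive_cases eval_CompE: "eval (Comp f gs) xs z"
inductive_cases eval_PrimRec_0E: "eval (PrimRec f g) (0 # xs) z"
inductive_cases eval_PrimRec_SucE: "eval (PrimRec f g) (Suc n # xs) z"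
inductive_cases eval_MuE: "eval (Mu f) xs n"

lemma computable_cong:
  assumes "computable k f" "\<And>xs. length xs = k \<Longrightarrow> f xs = g xs"
  shows "computable k g"
  using assms unfolding computable_def by metis

lemma computable_zero: "computable k (\<lambda>xs. 0)"
  unfolding computable_def by (rule exI[of _ Zero]) (auto elim: eval_ZeroE intro: eval.intros)

lemma computable_Suc_hd: "computable 1 (\<lambda>xs. Suc (xs ! 0))"
  unfolding computable_def
  by (rule exI[of _ Succ]) (auto simp: length_Suc_conv elim: eval_SuccE intro: eval.intros)

lemma computable_nth: "i < k \<Longrightarrow> computable k (\<lambda>xs. xs ! i)"
  unfolding computable_def
  by (rule exI[of _ "Proj i"]) (auto elim: eval_ProjE intro: eval.intros)

lemma computable_comp:
  assumes f: "computable (length gs) f" and gs: "\<And>g. g \<in> set gs \<Longrightarrow> computable k g"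
  shows "computable k (\<lambda>xs. f (map (\<lambda>g. g xs) gs))"
proof -
  obtain ef where ef: "\<And>ys z. length ys = length gs \<Longrightarrow> eval ef ys z \<longleftrightarrow> z = f ys"
    using f unfolding computable_def by blast
  obtain eg where eg: "\<And>g xs z. g \<in> set gs \<Longrightarrow> length xs = k \<Longrightarrow> eval (eg g) xs z \<longleftrightarrow> z = g xs"
    using gs unfolding computable_def by metis
  have all2: "list_all2 (\<lambda>g y. eval g xs y) (map eg gs) ys \<longleftrightarrow> ys = map (\<lambda>g. g xs) gs"
    if "length xs = k" for xs ys
    using eg that by (auto simp: list_all2_conv_all_nth intro!: nth_equalityI)
  have "eval (Comp ef (map eg gs)) xs z \<longleftrightarrow> z = f (map (\<lambda>g. g xs) gs)" if "length xs = k" for xs z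
  proof
    assume "eval (Comp ef (map eg gs)) xs z"
    then show "z = f (map (\<lambda>g. g xs) gs)"
      by (rule eval_CompE) (use all2[OF that] ef in auto)
  next
    assume "z = f (map (\<lambda>g. g xs) gs)"
    then show "eval (Comp ef (map eg gs)) xs z"
      using all2[OF that] ef by (intro eval.intros(4)[of _ _ "map (\<lambda>g. g xs) gs"]) auto
  qed
  then show ?thesis unfolding computable_def by blast
qed

lemma computable_primrec:
  assumes "computable k f" "computable (Suc (Suc k)) g"
  shows "computable (Suc k) (\<lambda>xs. rec_nat (f (tl xs)) (\<lambda>n y. g (n # y # tl xs)) (hd xs))"
proof -
  obtain ef where ef: "\<And>ys z. length ys = k \<Longrightarrow> eval ef ys z \<longleftrightarrow> z = f ys"
    using assms unfolding computable_def by blast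
  obtain eg where eg: "\<And>ys z. length ys = Suc (Suc k) \<Longrightarrow> eval eg ys z \<longleftrightarrow> z = g ys"
    using assms unfolding computable_def by blast
  have "eval (PrimRec ef eg) (n # xs) z \<longleftrightarrow> z = rec_nat (f xs) (\<lambda>n y. g (n # y # xs)) n"
    if l: "length xs = k" for xs n z
  proof (induction n arbitrary: z)
    case 0
    show ?case using ef[OF l] by (auto intro: eval.intros(5) elim: eval_PrimRec_0E)
  next
    case (Suc n)
    have "eval (PrimRec ef eg) (Suc n # xs) z \<longleftrightarrow>
      (\<exists>y. eval (PrimRec ef eg) (n # xs) y \<and> eval eg (n # y # xs) z)"
      by (blast intro: eval.intros(6) elim: eval_PrimRec_SucE)
    then show ?case using Suc eg l by auto
  qed
  then show ?thesis unfolding computable_def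
    by (intro exI[of _ "PrimRec ef eg"]) (auto simp: length_Suc_conv)
qed

lemma computable_Least:
  assumes f: "computable (Suc k) f" and ex: "\<And>xs. length xs = k \<Longrightarrow> \<exists>n. f (n # xs) = 0"
  shows "computable k (\<lambda>xs. LEAST n. f (n # xs) = 0)"
proof -
  obtain ef where ef: "\<And>ys z. length ys = Suc k \<Longrightarrow> eval ef ys z \<longleftrightarrow> z = f ys"
    using assms unfolding computable_def by blast
  have "eval (Mu ef) xs n \<longleftrightarrow> n = (LEAST n. f (n # xs) = 0)" if l: "length xs = k" for xs n
  proof -
    have "eval (Mu ef) xs n \<longleftrightarrow> f (n # xs) = 0 \<and> (\<forall>m<n. f (m # xs) \<noteq> 0)"
      using ef l by (auto elim!: eval_MuE intro!: eval.intros(7) dest: not0_implies_Suc)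
        (metis Suc_pred)
    also have "\<dots> \<longleftrightarrow> n = (LEAST n. f (n # xs) = 0)"
    proof
      assume "f (n # xs) = 0 \<and> (\<forall>m<n. f (m # xs) \<noteq> 0)"
      then show "n = (LEAST n. f (n # xs) = 0)"
        by (intro Least_equality[symmetric]) (auto simp: not_less[symmetric])
    next
      assume "n = (LEAST n. f (n # xs) = 0)"
      then show "f (n # xs) = 0 \<and> (\<forall>m<n. f (m # xs) \<noteq> 0)"
        using LeastI_ex[OF ex[OF l]] not_less_Least by blast
    qed
    finally show ?thesis .
  qed
  then show ?thesis unfolding computable_def by blast
qed

lemma computable_comp1:
  assumes "computable 1 (\<lambda>xs. f (xs ! 0))" "computable k g"
  shows "computable k (\<lambda>xs. f (g xs))"
  using computable_comp[of "[g]" "\<lambda>xs. f (xs ! 0)" k] assms by simp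

lemma computable_comp2:
  assumes "computable 2 (\<lambda>xs. f (xs ! 0) (xs ! 1))" "computable k g" "computable k h"
  shows "computable k (\<lambda>xs. f (g xs) (h xs))"
  using computable_comp[of "[g, h]" "\<lambda>xs. f (xs ! 0) (xs ! 1)" k] assms
  by (simp add: numeral_2_eq_2) (metis insert_iff empty_iff)

lemma computable_Suc: "computable k g \<Longrightarrow> computable k (\<lambda>xs. Suc (g xs))"
  by (rule computable_comp1[OF computable_Suc_hd])

lemma computable_const: "computable k (\<lambda>xs. c)"
  by (induction c) (auto intro: computable_zero computable_Suc)

text \<open>Recursion runs over the first argument; the predecessor function fits the scheme with a dummy second
argument.\<close>

lemma computable_rec2:
  assumes g: "computable 3 (\<lambda>xs. g (xs ! 0) (xs ! 1) (xs ! 2))"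
    and f: "computable 1 (\<lambda>xs. f (xs ! 0))"
    and "\<And>b. h 0 b = f b" "\<And>n b. h (Suc n) b = g n (h n b) b"
    and "computable k p" "computable k q"
  shows "computable k (\<lambda>xs. h (p xs) (q xs))"
proof -
  have *: "rec_nat (f b) (\<lambda>n y. g n y b) n = h n b" for n b
    by (induction n) (auto simp: assms)
  have "computable 2 (\<lambda>xs. h (xs ! 0) (xs ! 1))"
    using computable_primrec[OF f, of "\<lambda>xs. g (xs ! 0) (xs ! 1) (xs ! 2)"] g
    by (simp add: numeral_2_eq_2 numeral_3_eq_3)
      (erule computable_cong, auto simp: length_Suc_conv *[symmetric])
  then show ?thesis using assms computable_comp2 by blast
qed

lemma computable_add: "computable k p \<Longrightarrow> computable k q \<Longrightarrow> computable k (\<lambda>xs. p xs + q xs)"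
  by (rule computable_rec2[where h = "(+)" and f = "\<lambda>b. b" and g = "\<lambda>n y b. Suc y"])
    (auto intro!: computable_nth computable_Suc)

lemma computable_mult: "computable k p \<Longrightarrow> computable k q \<Longrightarrow> computable k (\<lambda>xs. p xs * q xs)"
  by (rule computable_rec2[where h = "(*)" and f = "\<lambda>b. 0" and g = "\<lambda>n y b. b + y"])
    (auto intro!: computable_nth computable_add computable_const)

lemma computable_pred: "computable k p \<Longrightarrow> computable k (\<lambda>xs. p xs - 1)"
  by (rule computable_rec2[where h = "\<lambda>n b. n - 1" and f = "\<lambda>b. 0" and g = "\<lambda>n y b. n"])
    (rule computable_nth computable_const | assumption | simp)+

lemma computable_diff: "computable k p \<Longrightarrow> computable k q \<Longrightarrow> computable k (\<lambda>xs. p xs - q xs)"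
  by (rule computable_rec2[where h = "\<lambda>a b. b - a" and f = "\<lambda>b. b" and g = "\<lambda>n y b. y - 1"])
    (rule computable_pred computable_nth | assumption | simp)+

text \<open>The square root is the least \<open>n\<close> with \<open>m < (n + 1)\<^sup>2\<close>, and this inequality is expressed by the vanishing of
a truncated difference, which is what the search operator needs.\<close>

lemma computable_floor_sqrt:
  assumes "computable k p"
  shows "computable k (\<lambda>xs. floor_sqrt (p xs))"
proof (rule computable_comp1[OF _ assms])
  have "computable (Suc 1) (\<lambda>xs. Suc (xs ! 1) - (Suc (xs ! 0)) * (Suc (xs ! 0)))"
    by (intro computable_diff computable_mult computable_Suc computable_nth) auto
  then have "computable 1 (\<lambda>xs. LEAST n. Suc ((n # xs) ! 1) - (Suc ((n # xs) ! 0)) * (Suc ((n # xs) ! 0)) = 0)"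
    by (rule computable_Least) (auto intro: trans_le_add1)
  then have "computable 1 (\<lambda>xs. LEAST n. Suc (xs ! 0) - (Suc n) * (Suc n) = 0)"
    by (simp del: mult_Suc mult_Suc_right)
  moreover have "(LEAST n. Suc m - (Suc n) * (Suc n) = 0) = floor_sqrt m" for m
  proof (rule Least_equality)
    show "Suc m - Suc (floor_sqrt m) * Suc (floor_sqrt m) = 0"
      using Suc_floor_sqrt_power2_gt[of m] by (simp add: power2_eq_square)
    show "floor_sqrt m \<le> n" if "Suc m - Suc n * Suc n = 0" for n
    proof -
      have "m < (Suc n)\<^sup>2" using that by (simp add: power2_eq_square)
      then have "\<not> Suc n \<le> floor_sqrt m" by (metis le_floor_sqrt_iff not_le)
      then show ?thesis by simp
    qed
  qed
  ultimately show "computable 1 (\<lambda>xs. floor_sqrt (xs ! 0))" by simp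
qed

definition decidable :: "nat \<Rightarrow> (nat list \<Rightarrow> bool) \<Rightarrow> bool" where
  "decidable k P \<longleftrightarrow> computable k (\<lambda>xs. if P xs then 0 else 1)"

lemma decidable_le:
  assumes "computable k f" "computable k g"
  shows "decidable k (\<lambda>xs. f xs \<le> g xs)"
  unfolding decidable_def
  by (rule computable_cong[of k "\<lambda>xs. 1 - (1 - (f xs - g xs))"])
    (auto intro!: computable_diff computable_const assms)

lemma decidable_not:
  assumes "decidable k P"
  shows "decidable k (\<lambda>xs. \<not> P xs)"
  unfolding decidable_def
  by (rule computable_cong[of k "\<lambda>xs. 1 - (if P xs then 0 else 1)"])
    (use assms in \<open>auto intro!: computable_diff computable_const simp: decidable_def\<close>)

lemma decidable_conj:
  assumes "decidable k P" "decidable k Q"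
  shows "decidable k (\<lambda>xs. P xs \<and> Q xs)"
  unfolding decidable_def
  by (rule computable_cong[of k "\<lambda>xs. 1 - (1 - ((if P xs then 0 else 1) + (if Q xs then 0 else 1)))"])
    (use assms in \<open>auto intro!: computable_diff computable_add computable_const simp: decidable_def\<close>)

lemma decidable_disj:
  assumes "decidable k P" "decidable k Q"
  shows "decidable k (\<lambda>xs. P xs \<or> Q xs)"
  using decidable_not[OF decidable_conj[OF decidable_not decidable_not, OF assms]] by simp

lemma decidable_less:
  assumes "computable k f" "computable k g"
  shows "decidable k (\<lambda>xs. f xs < g xs)"
  using decidable_not[OF decidable_le[OF assms(2,1)]] by (simp add: not_le)

lemma decidable_eq:
  assumes "computable k f" "computable k g"
  shows "decidable k (\<lambda>xs. f xs = g xs)"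
  using decidable_conj[OF decidable_le[OF assms] decidable_le[OF assms(2,1)]]
  by (simp add: eq_iff)

definition decidable_set :: "nat set \<Rightarrow> bool" where
  "decidable_set X \<longleftrightarrow> decidable 1 (\<lambda>xs. xs ! 0 \<in> X)"

definition decidable_rel :: "(nat \<Rightarrow> nat \<Rightarrow> bool) \<Rightarrow> bool" where
  "decidable_rel R \<longleftrightarrow> decidable 2 (\<lambda>xs. R (xs ! 0) (xs ! 1))"

lemma decidable_member:
  assumes "decidable_set X" "computable k f"
  shows "decidable k (\<lambda>xs. f xs \<in> X)"
  using computable_comp1[OF _ assms(2), of "\<lambda>x. if x \<in> X then 0 else 1"] assms(1)
  by (simp add: decidable_def decidable_set_def)

lemma decidable_related:
  assumes "decidable_rel R" "computable k f" "computable k g"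
  shows "decidable k (\<lambda>xs. R (f xs) (g xs))"
  using computable_comp2[OF _ assms(2,3), of "\<lambda>x y. if R x y then 0 else 1"] assms(1)
  by (simp add: decidable_def decidable_rel_def)

lemma decidable_set_Int: "decidable_set X \<Longrightarrow> decidable_set Y \<Longrightarrow> decidable_set (X \<inter> Y)"
  and decidable_set_Un: "decidable_set X \<Longrightarrow> decidable_set Y \<Longrightarrow> decidable_set (X \<union> Y)"
  and decidable_set_Diff: "decidable_set X \<Longrightarrow> decidable_set Y \<Longrightarrow> decidable_set (X - Y)"
  unfolding decidable_set_def by (auto intro: decidable_conj decidable_disj decidable_not)

lemma decidable_set_finite: "finite X \<Longrightarrow> decidable_set X"
proof (induction rule: finite_induct)
  case empty
  show ?case
    unfolding decidable_set_def using decidable_less[OF computable_const computable_const, of 1 0 0]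
    by simp
next
  case (insert x X)
  have "decidable_set {x}"
    unfolding decidable_set_def
    using decidable_eq[OF computable_nth computable_const, of 0 1 x] by simp
  then show ?case using decidable_set_Un[OF _ insert.IH, of "{x}"] by simp
qed

lemma decidable_set_UNIV: "decidable_set UNIV"
  using decidable_set_Diff[OF decidable_set_finite decidable_set_finite, of "{}" "{}"]
  unfolding decidable_set_def by (simp add: decidable_def computable_const)

lemma decidable_rel_conv: "decidable_rel R \<Longrightarrow> decidable_rel (\<lambda>x y. R y x)"
  unfolding decidable_rel_def
  by (rule decidable_related[where R = R]) (auto simp: decidable_rel_def intro!: computable_nth)

text \<open>A decidable set is the domain of the program that searches for a zero of its characteristic function
and ignores the bound of the search: it stops at once or never. The same works for relations.\<close>

lemma ce_set_decidable:
  assumes "decidable_set X"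
  shows "ce_set X"
proof -
  have "decidable 2 (\<lambda>xs. xs ! 1 \<in> X)"
    by (rule decidable_member[OF assms computable_nth]) simp
  then obtain e where "\<And>xs z. length xs = 2 \<Longrightarrow> eval e xs z \<longleftrightarrow> z = (if xs ! 1 \<in> X then 0 else 1)"
    unfolding decidable_def computable_def by blast
  from this[of "[_, _]"] have e: "eval e [a, b] z \<longleftrightarrow> z = (if b \<in> X then 0 else 1)" for a b z by simp
  have "x \<in> X \<longleftrightarrow> (\<exists>z. eval (Mu e) [x] z)" for x
  proof
    assume "x \<in> X"
    then have "eval (Mu e) [x] 0" by (intro eval.intros(7)) (simp_all add: e)
    then show "\<exists>z. eval (Mu e) [x] z" ..
  next
    assume "\<exists>z. eval (Mu e) [x] z"
    then obtain z where "eval e (z # [x]) 0" by (auto elim: eval_MuE)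
    then show "x \<in> X" by (simp add: e split: if_splits)
  qed
  then show ?thesis unfolding ce_set_def by blast
qed

lemma ce_rel_decidable:
  assumes "decidable_rel R"
  shows "ce_rel {(x, y). R x y}"
proof -
  have "decidable 3 (\<lambda>xs. R (xs ! 1) (xs ! 2))"
    by (rule decidable_related[OF assms computable_nth computable_nth]) auto
  then obtain e where "\<And>xs z. length xs = 3 \<Longrightarrow> eval e xs z \<longleftrightarrow> z = (if R (xs ! 1) (xs ! 2) then 0 else 1)"
    unfolding decidable_def computable_def by blast
  from this[of "[_, _, _]"]
  have e: "eval e [a, b, c] z \<longleftrightarrow> z = (if R b c then 0 else 1)" for a b c z by (simp add: numeral_2_eq_2)
  have "R x y \<longleftrightarrow> (\<exists>z. eval (Mu e) [x, y] z)" for x y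
  proof
    assume "R x y"
    then have "eval (Mu e) [x, y] 0" by (intro eval.intros(7)) (simp_all add: e)
    then show "\<exists>z. eval (Mu e) [x, y] z" ..
  next
    assume "\<exists>z. eval (Mu e) [x, y] z"
    then obtain z where "eval e (z # [x, y]) 0" by (auto elim: eval_MuE)
    then show "R x y" by (simp add: e split: if_splits)
  qed
  then show ?thesis unfolding ce_rel_def by auto
qed

section \<open>Remainders of square roots\<close>

text \<open>The dense set \<open>D\<close> leaves out the numbers with a small remainder, and the remainders index the infinitely
many infinite pieces into which a decidable set is divided when an order is to be put on it.\<close>

definition sqrt_remainder :: "nat \<Rightarrow> nat" where
  "sqrt_remainder x = x - (floor_sqrt x)\<^sup>2"

lemma computable_sqrt_remainder: "computable k f \<Longrightarrow> computable k (\<lambda>xs. sqrt_remainder (f xs))"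
  unfolding sqrt_remainder_def power2_eq_square
  by (intro computable_diff computable_mult computable_floor_sqrt)

text \<open>Every \<open>m\<^sup>2 + c\<close> with \<open>c \<le> m\<close> has remainder \<open>c\<close>, since it stays below \<open>(m + 1)\<^sup>2\<close>.\<close>

lemma infinite_sqrt_remainder: "infinite {x. sqrt_remainder x = c}"
proof -
  have *: "sqrt_remainder (m\<^sup>2 + c) = c" if "c \<le> m" for m
  proof -
    have "floor_sqrt (m\<^sup>2 + c) = m"
      using that by (intro floor_sqrt_unique) (auto simp: power2_eq_square)
    then show ?thesis by (simp add: sqrt_remainder_def)
  qed
  have "inj_on (\<lambda>m. m\<^sup>2 + c) {c..}" by (auto intro!: inj_onI)
  then have "infinite ((\<lambda>m. m\<^sup>2 + c) ` {c..})"
    using finite_imageD infinite_Ici by blast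
  moreover have "(\<lambda>m. m\<^sup>2 + c) ` {c..} \<subseteq> {x. sqrt_remainder x = c}" using * by auto
  ultimately show ?thesis using finite_subset by blast
qed

text \<open>The numbers left out are the squares and their successors; up to \<open>n\<close> there are at most \<open>2 (\<surd>n + 1)\<close> of
them.\<close>

lemma dense_sqrt_remainder: "dense {x. 2 \<le> sqrt_remainder x}"
proof -
  let ?D = "{x. 2 \<le> sqrt_remainder x}"
  have lower: "1 - 2 * (sqrt (real n) + 1) / (real n + 1) \<le> real (card (?D \<inter> {0..n})) / real (n + 1)" for n
  proof -
    have "{0..n} - ?D \<subseteq> (\<lambda>m. m\<^sup>2) ` {0..floor_sqrt n} \<union> (\<lambda>m. m\<^sup>2 + 1) ` {0..floor_sqrt n}"
    proof
      fix x assume x: "x \<in> {0..n} - ?D"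
      then have "floor_sqrt x \<in> {0..floor_sqrt n}" by (auto intro: mono_floor_sqrt')
      moreover have "x = (floor_sqrt x)\<^sup>2 \<or> x = (floor_sqrt x)\<^sup>2 + 1"
        using x floor_sqrt_power2_le[of x] unfolding sqrt_remainder_def by (simp del: floor_sqrt_power2_le) linarith
      ultimately show "x \<in> (\<lambda>m. m\<^sup>2) ` {0..floor_sqrt n} \<union> (\<lambda>m. m\<^sup>2 + 1) ` {0..floor_sqrt n}"
        by blast
    qed
    then have "card ({0..n} - ?D) \<le>
        card ((\<lambda>m. m\<^sup>2) ` {0..floor_sqrt n} \<union> (\<lambda>m. m\<^sup>2 + 1) ` {0..floor_sqrt n})"
      by (intro card_mono) auto
    also have "\<dots> \<le> card ((\<lambda>m. m\<^sup>2) ` {0..floor_sqrt n}) + card ((\<lambda>m. m\<^sup>2 + 1) ` {0..floor_sqrt n})"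
      by (rule card_Un_le)
    also have "\<dots> \<le> (floor_sqrt n + 1) + (floor_sqrt n + 1)"
      by (intro add_mono order.trans[OF card_image_le]) auto
    finally have "card ({0..n} - ?D) \<le> 2 * (floor_sqrt n + 1)" by simp
    moreover have "card {0..n} = card ({0..n} - ?D) + card (?D \<inter> {0..n})"
      by (metis Int_commute add.commute card_Int_Diff finite_atLeastAtMost)
    ultimately have "real (n + 1) \<le> 2 * (real (floor_sqrt n) + 1) + real (card (?D \<inter> {0..n}))"
      by simp
    moreover have "real (floor_sqrt n) \<le> sqrt (real n)"
      by (intro real_le_rsqrt) (simp flip: of_nat_power)
    ultimately have "(real n + 1 - 2 * (sqrt (real n) + 1)) / (real n + 1) \<le>
        real (card (?D \<inter> {0..n})) / (real n + 1)"
      by (intro divide_right_mono) auto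
    moreover have "(real n + 1 - 2 * (sqrt (real n) + 1)) / (real n + 1) =
        1 - 2 * (sqrt (real n) + 1) / (real n + 1)"
      by (subst diff_divide_distrib) simp
    ultimately show ?thesis by (simp add: add.commute)
  qed
  have "(\<lambda>n. (sqrt (real n) + 1) / (real n + 1)) \<longlonglongrightarrow> 0"
  proof (rule tendsto_sandwich[of "\<lambda>_. 0"])
    have "(sqrt (real n) + 1) / (real n + 1) \<le> 2 * inverse (sqrt (real n))" if "n \<ge> 1" for n
    proof -
      have s: "1 \<le> sqrt (real n)" using that by simp
      have sq: "sqrt (real n) * sqrt (real n) = real n" by simp
      then have "sqrt (real n) \<le> real n" using mult_left_mono[OF s, of "sqrt (real n)"] by simp
      then have "(sqrt (real n) + 1) * sqrt (real n) \<le> 2 * (real n + 1)"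
        unfolding distrib_right sq by simp
      then show ?thesis using s by (simp add: field_simps)
    qed
    then show "\<forall>\<^sub>F n in sequentially. (sqrt (real n) + 1) / (real n + 1) \<le> 2 * inverse (sqrt (real n))"
      using eventually_sequentially by blast
    have "filterlim (\<lambda>n. sqrt (real n)) at_top sequentially"
      by (rule filterlim_compose[OF sqrt_at_top filterlim_real_sequentially])
    then show "(\<lambda>n. 2 * inverse (sqrt (real n))) \<longlonglongrightarrow> 0"
      by (intro tendsto_mult_right_zero tendsto_inverse_0_at_top)
  qed auto
  then have "(\<lambda>n. 1 - 2 * ((sqrt (real n) + 1) / (real n + 1))) \<longlonglongrightarrow> 1 - 2 * 0"
    by (intro tendsto_intros)
  then have *: "(\<lambda>n. 1 - 2 * (sqrt (real n) + 1) / (real n + 1)) \<longlonglongrightarrow> 1" by simp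
  have upper: "real (card (?D \<inter> {0..n})) / real (n + 1) \<le> 1" for n
    using card_mono[of "{0..n}" "?D \<inter> {0..n}"] by (simp add: divide_le_eq)
  show ?thesis unfolding dense_def
    by (rule tendsto_sandwich[OF _ _ * tendsto_const[of 1]]) (use lower upper in auto)
qed

lemma dense_UNIV: "dense UNIV"
  unfolding dense_def by simp

section \<open>A combinatorial criterion for elementarity at level two\<close>

text \<open>Orders are handled through their strict part, as a predicate. It determines the reflexive relation of
the language, and monotonicity for it includes injectivity.\<close>

definition strict_linear :: "('a \<Rightarrow> 'a \<Rightarrow> bool) \<Rightarrow> bool" where
  "strict_linear lt \<longleftrightarrow> (\<forall>x. \<not> lt x x) \<and> (\<forall>x y z. lt x y \<longrightarrow> lt y z \<longrightarrow> lt x z) \<and>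
     (\<forall>x y. x \<noteq> y \<longrightarrow> lt x y \<or> lt y x)"

definition weak_rel :: "('a \<Rightarrow> 'a \<Rightarrow> bool) \<Rightarrow> 'a rel" where
  "weak_rel lt = {(x, y). x = y \<or> lt x y}"

text \<open>The semantic content of \<open>\<Sigma>\<^sub>2\<close> elementarity of \<open>D\<close>. Over parameters \<open>W\<close> from \<open>D\<close>, witnesses \<open>S\<close> for the
existential quantifier are replaced by their images under \<open>g\<close> in \<open>D\<close>. Each counterexample \<open>T\<close> in \<open>D\<close> to the
\<open>\<Pi>\<^sub>1\<close> part about these images is carried back by \<open>e\<close> to a counterexample about the original witnesses.\<close>

definition back_and_forth :: "('a \<Rightarrow> 'a \<Rightarrow> bool) \<Rightarrow> 'a set \<Rightarrow> bool" where
  "back_and_forth lt D \<longleftrightarrow> (\<forall>W S. finite W \<and> W \<subseteq> D \<and> finite S \<longrightarrow>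
     (\<exists>g. g ` (W \<union> S) \<subseteq> D \<and> (\<forall>x\<in>W. g x = x) \<and> monotone_on (W \<union> S) lt lt g \<and>
        (\<forall>T. finite T \<and> T \<subseteq> D \<longrightarrow>
          (\<exists>e. monotone_on (T \<union> g ` (W \<union> S)) lt lt e \<and> (\<forall>x\<in>W \<union> S. e (g x) = x)))))"

text \<open>Equality is listed apart from the order, because the lemma on quantifier-free formulas is about
arbitrary structures.\<close>

definition same_qf_type :: "struct \<Rightarrow> (nat \<Rightarrow> nat) \<Rightarrow> struct \<Rightarrow> (nat \<Rightarrow> nat) \<Rightarrow> nat set \<Rightarrow> bool" where
  "same_qf_type A v B w V \<longleftrightarrow> (\<forall>i\<in>V. \<forall>j\<in>V. (v i = v j \<longleftrightarrow> w i = w j) \<and>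
     ((v i, v j) \<in> rel A \<longleftrightarrow> (w i, w j) \<in> rel B))"

lemma sat_qf_cong:
  assumes "qf \<phi>" "same_qf_type A v B w (fv \<phi>)"
  shows "sat A \<phi> v \<longleftrightarrow> sat B \<phi> w"
  using assms
proof (induction rule: qf.induct)
  case (4 F)
  have "same_qf_type A v B w (fv \<phi>)" if "\<phi> \<in> rcset F" for \<phi>
    using "4.prems" that unfolding fv_Conj same_qf_type_def by blast
  then have "sat A \<phi> v \<longleftrightarrow> sat B \<phi> w" if "\<phi> \<in> rcset F" for \<phi>
    using "4.IH" that by blast
  then show ?case by (simp add: sat_Conj del: sat.simps)
next
  case (5 F)
  have "same_qf_type A v B w (fv \<phi>)" if "\<phi> \<in> rcset F" for \<phi>
    using "5.prems" that unfolding fv_Disj same_qf_type_def by blast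
  then have "sat A \<phi> v \<longleftrightarrow> sat B \<phi> w" if "\<phi> \<in> rcset F" for \<phi>
    using "5.IH" that by blast
  then show ?case by (simp add: sat_Disj del: sat.simps)
qed (auto simp: same_qf_type_def)

lemma fv_exs [simp]: "fv (exs xs \<phi>) = fv \<phi> - set xs"
  and fv_alls [simp]: "fv (alls xs \<phi>) = fv \<phi> - set xs"
  by (induction xs) auto

text \<open>The blocks of quantifiers are turned into quantifiers over assignments. A variable that is repeated in
the list does no harm: its innermost value can be chosen as the value of its outer occurrences too.\<close>

lemma sat_exs:
  "sat A (exs xs \<phi>) v \<longleftrightarrow>
    (\<exists>w. (\<forall>i\<in>set xs. w i \<in> univ A) \<and> (\<forall>i. i \<notin> set xs \<longrightarrow> w i = v i) \<and> sat A \<phi> w)"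
proof (induction xs arbitrary: v)
  case Nil
  have "w = v" if "\<forall>i. w i = v i" for w :: "nat \<Rightarrow> nat" using that by auto
  then show ?case by auto
next
  case (Cons x xs)
  show ?case
  proof
    assume "sat A (exs (x # xs) \<phi>) v"
    then obtain a w where "a \<in> univ A" "\<forall>i\<in>set xs. w i \<in> univ A"
      "\<forall>i. i \<notin> set xs \<longrightarrow> w i = (v(x := a)) i" "sat A \<phi> w"
      using Cons by auto
    then show "\<exists>w. (\<forall>i\<in>set (x # xs). w i \<in> univ A) \<and> (\<forall>i. i \<notin> set (x # xs) \<longrightarrow> w i = v i) \<and> sat A \<phi> w"
      by (intro exI[of _ w]) (cases "x \<in> set xs"; auto)
  next
    assume "\<exists>w. (\<forall>i\<in>set (x # xs). w i \<in> univ A) \<and> (\<forall>i. i \<notin> set (x # xs) \<longrightarrow> w i = v i) \<and> sat A \<phi> w"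
    then obtain w where "\<forall>i\<in>set (x # xs). w i \<in> univ A" "\<forall>i. i \<notin> set (x # xs) \<longrightarrow> w i = v i" "sat A \<phi> w"
      by blast
    then have "w x \<in> univ A" "sat A (exs xs \<phi>) (v(x := w x))"
      unfolding Cons by auto
    then show "sat A (exs (x # xs) \<phi>) v" by auto
  qed
qed

lemma sat_alls:
  "sat A (alls xs \<phi>) v \<longleftrightarrow>
    (\<forall>w. (\<forall>i\<in>set xs. w i \<in> univ A) \<and> (\<forall>i. i \<notin> set xs \<longrightarrow> w i = v i) \<longrightarrow> sat A \<phi> w)"
proof -
  have "sat A (alls xs \<phi>) v \<longleftrightarrow> \<not> sat A (exs xs (Neg \<phi>)) v"
    by (induction xs arbitrary: v) auto
  then show ?thesis unfolding sat_exs by auto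
qed

lemma is_Pi_cases:
  assumes "is_Pi m \<psi>" "m < 2"
  obtains "qf \<psi>"
  | G where "\<psi> = Conj G" "\<And>\<theta>. \<theta> \<in> rcset G \<Longrightarrow> \<exists>ys \<chi>. \<theta> = alls ys \<chi> \<and> qf \<chi>"
  using assms(1)
proof cases
  case Pi_0
  then show ?thesis using that by blast
next
  case (Pi_pos F)
  have "\<exists>ys \<chi>. \<theta> = alls ys \<chi> \<and> qf \<chi>" if "\<theta> \<in> rcset F" for \<theta>
  proof -
    obtain ys k \<chi> where *: "\<theta> = alls ys \<chi>" "k < m" "is_Sigma k \<chi>" using Pi_pos(3)[OF \<open>\<theta> \<in> rcset F\<close>] by blast
    then have "is_Sigma 0 \<chi>" using assms(2) by (cases k) auto
    then have "qf \<chi>" by cases auto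
    then show ?thesis using * by blast
  qed
  then show ?thesis using that Pi_pos by blast
qed

lemma is_Sigma_2_cases:
  assumes "is_Sigma 2 \<phi>"
  obtains F where "\<phi> = Disj F"
    "\<And>\<theta>. \<theta> \<in> rcset F \<Longrightarrow> \<exists>xs m \<psi>. \<theta> = exs xs \<psi> \<and> m < 2 \<and> is_Pi m \<psi>"
  using assms by cases auto

lemma monotone_on_strict_linear_iff:
  assumes "strict_linear lt" "monotone_on X lt lt g" "x \<in> X" "y \<in> X"
  shows "lt (g x) (g y) \<longleftrightarrow> lt x y" "g x = g y \<longleftrightarrow> x = y"
  using assms unfolding strict_linear_def monotone_on_def by metis+

lemma same_qf_type_monotone:
  assumes "strict_linear lt" "monotone_on (v ` V) lt lt g"
    "\<And>i. i \<in> V \<Longrightarrow> w i = g (v i)"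
    "\<And>i j. i \<in> V \<Longrightarrow> j \<in> V \<Longrightarrow> (v i, v j) \<in> rel A \<longleftrightarrow> (v i, v j) \<in> weak_rel lt"
    "\<And>i j. i \<in> V \<Longrightarrow> j \<in> V \<Longrightarrow> (w i, w j) \<in> rel B \<longleftrightarrow> (w i, w j) \<in> weak_rel lt"
  shows "same_qf_type A v B w V"
  using monotone_on_strict_linear_iff[OF assms(1,2)] assms(3-5)
  unfolding same_qf_type_def weak_rel_def by simp

text \<open>If the formula holds in the small structure, the same witnesses work in the large one: a counterexample
to the \<open>\<Pi>\<^sub>1\<close> part would be moved into \<open>D\<close> by the first map of the criterion, with the witnesses among the
fixed parameters. If it holds in the large structure, the first map moves the witnesses into \<open>D\<close>, and
the second one refutes counterexamples.\<close>

theorem Sigma_elementary_2_if_back_and_forth: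
  assumes lin: "strict_linear lt" and bf: "back_and_forth lt D"
  shows "Sigma_elementary 2 (induced (omega_struct (weak_rel lt)) D) (omega_struct (weak_rel lt))"
    (is "Sigma_elementary 2 ?B ?A")
proof -
  have [simp]: "univ ?A = UNIV" "univ ?B = D" "rel ?A = weak_rel lt"
    and relB: "(x, y) \<in> rel ?B \<longleftrightarrow> x \<in> D \<and> y \<in> D \<and> (x, y) \<in> weak_rel lt" for x y
    by (auto simp: omega_struct_def induced_def)
  have "sat ?B \<phi> v \<longleftrightarrow> sat ?A \<phi> v"
    if \<phi>: "is_Sigma 2 \<phi>" and fin: "finite (fv \<phi>)" and vD: "v ` fv \<phi> \<subseteq> D" for \<phi> v
  proof -
    obtain F where F: "\<phi> = Disj F"
      and memF: "\<And>\<theta>. \<theta> \<in> rcset F \<Longrightarrow> \<exists>xs m \<psi>. \<theta> = exs xs \<psi> \<and> m < 2 \<and> is_Pi m \<psi>"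
      using is_Sigma_2_cases[OF \<phi>] by metis
    show ?thesis
    proof
      assume "sat ?B \<phi> v"
      then obtain \<theta> where \<theta>: "\<theta> \<in> rcset F" "sat ?B \<theta> v" unfolding F sat_Disj by blast
      then obtain xs m \<psi> where \<psi>: "\<theta> = exs xs \<psi>" "m < 2" "is_Pi m \<psi>" using memF by blast
      obtain w where w: "\<forall>i\<in>set xs. w i \<in> D" "\<forall>i. i \<notin> set xs \<longrightarrow> w i = v i" "sat ?B \<psi> w"
        using \<theta>(2) unfolding \<psi> sat_exs by auto
      have "fv \<psi> \<subseteq> fv \<phi> \<union> set xs" using \<theta> unfolding F fv_Disj \<psi> by auto
      then have fin\<psi>: "finite (fv \<psi>)" and wD: "w ` fv \<psi> \<subseteq> D"
        using fin w vD by (auto intro: finite_subset) (metis UnE image_subset_iff subsetD)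
      have "sat ?A \<psi> w"
        using \<psi>(3,2)
      proof (cases rule: is_Pi_cases)
        case 1
        have "same_qf_type ?B w ?A w (fv \<psi>)"
          using wD by (intro same_qf_type_monotone[OF lin, where g = "\<lambda>x. x"])
            (auto simp: relB monotone_on_def)
        then show ?thesis using sat_qf_cong 1 w(3) by blast
      next
        case (2 G)
        have "sat ?A \<eta> w" if "\<eta> \<in> rcset G" for \<eta>
        proof -
          obtain ys \<chi> where \<chi>: "\<eta> = alls ys \<chi>" "qf \<chi>" using 2 \<open>\<eta> \<in> rcset G\<close> by blast
          have sub: "fv \<chi> \<subseteq> fv \<psi> \<union> set ys" using that unfolding 2 fv_Conj \<chi> by auto
          have satB: "sat ?B (alls ys \<chi>) w" using w(3) that unfolding 2 sat_Conj \<chi> by blast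
          show ?thesis unfolding \<chi> sat_alls
          proof (intro allI impI, elim conjE)
            fix u assume u: "\<forall>i. i \<notin> set ys \<longrightarrow> u i = w i"
            let ?S = "u ` (fv \<psi> \<union> set ys)"
            have "finite (w ` fv \<psi>)" "w ` fv \<psi> \<subseteq> D" "finite ?S" using fin\<psi> wD by auto
            then obtain g where g: "g ` (w ` fv \<psi> \<union> ?S) \<subseteq> D" "\<forall>x\<in>w ` fv \<psi>. g x = x"
              "monotone_on (w ` fv \<psi> \<union> ?S) lt lt g"
              using bf unfolding back_and_forth_def by meson
            define u' where "u' i = (if i \<in> set ys then g (u i) else w i)" for i
            have u'g: "u' i = g (u i)" if "i \<in> fv \<chi>" for i
              using that sub u g(2) unfolding u'_def by auto
            have "sat ?B \<chi> u'"
              using satB g(1) unfolding sat_alls by (auto simp: u'_def image_subset_iff)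
            moreover have "same_qf_type ?A u ?B u' (fv \<chi>)"
            proof (rule same_qf_type_monotone[OF lin, where g = g])
              show "monotone_on (u ` fv \<chi>) lt lt g"
                by (rule monotone_on_subset[OF g(3)]) (use sub in auto)
              have "u' i \<in> D" if "i \<in> fv \<chi>" for i
                using that sub u'g g(1) by (auto simp: image_subset_iff)
              then show "(u' i, u' j) \<in> rel ?B \<longleftrightarrow> (u' i, u' j) \<in> weak_rel lt"
                if "i \<in> fv \<chi>" "j \<in> fv \<chi>" for i j using that by (simp add: relB)
            qed (auto simp: u'g)
            ultimately show "sat ?A \<chi> u" using sat_qf_cong \<chi>(2) by blast
          qed
        qed
        then show ?thesis unfolding 2 sat_Conj by blast
      qed
      then have "sat ?A \<theta> v" unfolding \<psi> sat_exs using w by auto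
      then show "sat ?A \<phi> v" unfolding F sat_Disj using \<theta> by blast
    next
      assume "sat ?A \<phi> v"
      then obtain \<theta> where \<theta>: "\<theta> \<in> rcset F" "sat ?A \<theta> v" unfolding F sat_Disj by blast
      then obtain xs m \<psi> where \<psi>: "\<theta> = exs xs \<psi>" "m < 2" "is_Pi m \<psi>" using memF by blast
      obtain w where w: "\<forall>i. i \<notin> set xs \<longrightarrow> w i = v i" "sat ?A \<psi> w"
        using \<theta>(2) unfolding \<psi> sat_exs by auto
      have sub\<psi>: "fv \<psi> \<subseteq> fv \<phi> \<union> set xs" using \<theta> unfolding F fv_Disj \<psi> by auto
      let ?S = "w ` (fv \<phi> \<union> set xs)"
      have "finite (v ` fv \<phi>)" "v ` fv \<phi> \<subseteq> D" "finite ?S" using fin vD by auto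
      then have "\<exists>g. g ` (v ` fv \<phi> \<union> ?S) \<subseteq> D \<and> (\<forall>x\<in>v ` fv \<phi>. g x = x) \<and>
          monotone_on (v ` fv \<phi> \<union> ?S) lt lt g \<and> (\<forall>T. finite T \<and> T \<subseteq> D \<longrightarrow>
          (\<exists>e. monotone_on (T \<union> g ` (v ` fv \<phi> \<union> ?S)) lt lt e \<and> (\<forall>x\<in>v ` fv \<phi> \<union> ?S. e (g x) = x)))"
        using bf unfolding back_and_forth_def by blast
      then obtain g where g: "g ` (v ` fv \<phi> \<union> ?S) \<subseteq> D" "\<forall>x\<in>v ` fv \<phi>. g x = x"
          "monotone_on (v ` fv \<phi> \<union> ?S) lt lt g"
        and ge: "\<forall>T. finite T \<and> T \<subseteq> D \<longrightarrow>
          (\<exists>e. monotone_on (T \<union> g ` (v ` fv \<phi> \<union> ?S)) lt lt e \<and> (\<forall>x\<in>v ` fv \<phi> \<union> ?S. e (g x) = x))"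
        by (elim exE conjE)
      define c where "c i = (if i \<in> set xs then g (w i) else v i)" for i
      have cg: "c i = g (w i)" if "i \<in> fv \<psi>" for i
        using that sub\<psi> w(1) g(2) unfolding c_def by auto
      have cD: "c i \<in> D" if "i \<in> fv \<psi>" for i
        using that sub\<psi> cg g(1) by (auto simp: image_subset_iff)
      have "sat ?B \<psi> c"
        using \<psi>(3,2)
      proof (cases rule: is_Pi_cases)
        case 1
        have "same_qf_type ?A w ?B c (fv \<psi>)"
        proof (rule same_qf_type_monotone[OF lin, where g = g])
          show "monotone_on (w ` fv \<psi>) lt lt g"
            by (rule monotone_on_subset[OF g(3)]) (use sub\<psi> in auto)
        qed (auto simp: relB cD, simp_all add: cg)
        then show ?thesis using sat_qf_cong 1 w(2) by blast
      next
        case (2 G)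
        have "sat ?B \<eta> c" if "\<eta> \<in> rcset G" for \<eta>
        proof -
          obtain ys \<chi> where \<chi>: "\<eta> = alls ys \<chi>" "qf \<chi>" using 2 \<open>\<eta> \<in> rcset G\<close> by blast
          have sub: "fv \<chi> \<subseteq> fv \<psi> \<union> set ys" using that unfolding 2 fv_Conj \<chi> by auto
          have satA: "sat ?A (alls ys \<chi>) w" using w(2) that unfolding 2 sat_Conj \<chi> by blast
          show ?thesis unfolding \<chi> sat_alls
          proof (intro allI impI, elim conjE)
            fix u assume uD: "\<forall>i\<in>set ys. u i \<in> univ ?B" and u: "\<forall>i. i \<notin> set ys \<longrightarrow> u i = c i"
            have "finite (u ` set ys)" "u ` set ys \<subseteq> D" using uD by auto
            then obtain e where e: "monotone_on (u ` set ys \<union> g ` (v ` fv \<phi> \<union> ?S)) lt lt e"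
              "\<forall>x\<in>v ` fv \<phi> \<union> ?S. e (g x) = x"
              using ge[rule_format, of "u ` set ys"] by blast
            define u' where "u' i = (if i \<in> set ys then e (u i) else w i)" for i
            have u'e: "u' i = e (u i)" if "i \<in> fv \<chi>" for i
            proof (cases "i \<in> set ys")
              case False
              then have "i \<in> fv \<psi>" using that sub by auto
              then have "w i \<in> v ` fv \<phi> \<union> ?S" "u i = g (w i)" using False u cg sub\<psi> by auto
              then show ?thesis using False e(2) by (simp add: u'_def)
            qed (simp add: u'_def)
            have "sat ?A \<chi> u'" using satA unfolding sat_alls by (auto simp: u'_def)
            moreover have "same_qf_type ?B u ?A u' (fv \<chi>)"
            proof (rule same_qf_type_monotone[OF lin, where g = e])
              have img: "u i \<in> u ` set ys \<union> g ` (v ` fv \<phi> \<union> ?S)" if "i \<in> fv \<chi>" for i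
              proof (cases "i \<in> set ys")
                case False
                then have "i \<in> fv \<psi>" "u i = c i" using that sub u by auto
                then have "w i \<in> ?S" "u i = g (w i)" using cg sub\<psi> by auto
                then show ?thesis by blast
              qed simp
              then show "monotone_on (u ` fv \<chi>) lt lt e"
                by (intro monotone_on_subset[OF e(1)] image_subsetI) blast
              have "u i \<in> D" if "i \<in> fv \<chi>" for i
                using that sub u uD cD by (cases "i \<in> set ys") auto
              then show "(u i, u j) \<in> rel ?B \<longleftrightarrow> (u i, u j) \<in> weak_rel lt"
                if "i \<in> fv \<chi>" "j \<in> fv \<chi>" for i j using that by (simp add: relB)
            qed (auto simp: u'e)
            ultimately show "sat ?B \<chi> u" using sat_qf_cong \<chi>(2) by blast
          qed
        qed
        then show ?thesis unfolding 2 sat_Conj by blast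
      qed
      moreover have "\<forall>i\<in>set xs. c i \<in> D" using g(1) by (auto simp: c_def image_subset_iff)
      ultimately have "sat ?B \<theta> v" unfolding \<psi> sat_exs by (intro exI[of _ c]) (auto simp: c_def)
      then show "sat ?B \<phi> v" unfolding F sat_Disj using \<theta> by blast
    qed
  qed
  moreover have "substructure ?B ?A" by (simp add: substructure_def induced_def)
  ultimately show ?thesis unfolding Sigma_elementary_def by auto
qed

section \<open>Faithful suborders of scattered orders\<close>

text \<open>The first four conditions on a point \<open>a\<close> outside \<open>D\<close> say that \<open>a\<close> is no endpoint of the whole order and has
no immediate neighbour in \<open>D\<close>; hence \<open>D\<close> is a union of blocks. By the last one \<open>a\<close> is in a cut of \<open>D\<close> whose
lower part is nonempty without greatest element or whose upper part is nonempty without least element;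
hence \<open>a\<close> neither separates two points that are adjacent in \<open>D\<close> nor lies beyond an endpoint of \<open>D\<close>. The
order is a parameter and the definition is symmetric, so that each argument has its mirror image for free.\<close>

definition faithful :: "('a \<Rightarrow> 'a \<Rightarrow> bool) \<Rightarrow> 'a set \<Rightarrow> bool" where
  "faithful lt D \<longleftrightarrow> (\<forall>a. a \<notin> D \<longrightarrow>
     (\<exists>x. lt x a) \<and> (\<exists>x. lt a x) \<and>
     (\<forall>d\<in>D. lt d a \<longrightarrow> (\<exists>x. lt d x \<and> lt x a)) \<and>
     (\<forall>d\<in>D. lt a d \<longrightarrow> (\<exists>x. lt a x \<and> lt x d)) \<and>
     ((\<exists>d\<in>D. lt d a) \<and> (\<forall>d\<in>D. lt d a \<longrightarrow> (\<exists>d'\<in>D. lt d d' \<and> lt d' a)) \<or>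
      (\<exists>d\<in>D. lt a d) \<and> (\<forall>d\<in>D. lt a d \<longrightarrow> (\<exists>d'\<in>D. lt a d' \<and> lt d' d))))"

text \<open>Relative to a set, because the orders into which \<open>D\<close> is put are built by hand and are known to be
scattered on \<open>D\<close> only.\<close>

definition scattered_on :: "('a \<Rightarrow> 'a \<Rightarrow> bool) \<Rightarrow> 'a set \<Rightarrow> bool" where
  "scattered_on lt D \<longleftrightarrow> \<not> (\<exists>f :: rat \<Rightarrow> 'a. range f \<subseteq> D \<and> (\<forall>p q. p < q \<longrightarrow> lt (f p) (f q)))"

lemma faithful_dual: "faithful (\<lambda>x y. lt y x) D \<longleftrightarrow> faithful lt D"
  unfolding faithful_def by (intro all_cong1) blast

lemma scattered_on_subset: "scattered_on lt D \<Longrightarrow> E \<subseteq> D \<Longrightarrow> scattered_on lt E"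
  unfolding scattered_on_def by blast

text \<open>Cantor's argument. The images of the rationals are chosen one by one along their enumeration; at each
stage the finitely many images chosen before leave a pair, the nearest one below and the nearest one
above, between which density provides the next image. The points \<open>a\<close> and \<open>b\<close> serve as neighbours when
there is no earlier one on that side.\<close>

lemma rat_embedding:
  fixes R :: "'a \<Rightarrow> 'a \<Rightarrow> bool"
  assumes trans: "\<And>x y z. R x y \<Longrightarrow> R y z \<Longrightarrow> R x z"
    and dense: "\<And>x y. R x y \<Longrightarrow> \<exists>z. R x z \<and> R z y"
    and ab: "R a b"
  shows "\<exists>f :: rat \<Rightarrow> 'a. \<forall>p q. p < q \<longrightarrow> R (f p) (f q)"
proof -
  define P where "P f x r \<longleftrightarrow> R a r \<and> R r b \<and>
    (\<forall>z. to_nat z < to_nat x \<longrightarrow> (z < x \<longrightarrow> R (f z) r) \<and> (x < z \<longrightarrow> R r (f z)))"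
    for f :: "rat \<Rightarrow> 'a" and x r
  have "\<exists>f. \<forall>x. P f x (f x)"
  proof (rule dependent_wf_choice[of "measure to_nat"])
    show "P f x r = P g x r" if "\<And>z. (z, x) \<in> measure to_nat \<Longrightarrow> f z = g z" for f g x r
      using that by (simp add: P_def)
    fix x :: rat and f
    assume IH: "\<And>y. (y, x) \<in> measure to_nat \<Longrightarrow> P f y (f y)"
    define L where "L = {z. to_nat z < to_nat x \<and> z < x}"
    define H where "H = {z. to_nat z < to_nat x \<and> x < z}"
    have "finite {z :: rat. to_nat z < to_nat x}"
      by (rule finite_imageD[of to_nat]) (auto intro: inj_on_subset[OF inj_to_nat] finite_subset[of _ "{..<to_nat x}"])
    then have fin: "finite L" "finite H" by (auto simp: L_def H_def elim: rev_finite_subset)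
    define lo where "lo = (if L = {} then a else f (Max L))"
    define hi where "hi = (if H = {} then b else f (Min H))"
    have earlier: "R a (f y)" "R (f y) b" "to_nat y < to_nat x" if "y \<in> L \<union> H" for y
      using IH[of y] that by (auto simp: P_def L_def H_def)
    have pair: "R (f y) (f z)" if "y \<in> L \<union> H" "z \<in> L \<union> H" "y < z" for y z
    proof (cases "to_nat y < to_nat z")
      case True
      then show ?thesis using IH[of z] earlier(3)[of z] that by (auto simp: P_def)
    next
      case False
      then have "to_nat z < to_nat y" using that(3) by (metis less_irrefl not_less_iff_gr_or_eq to_nat_split)
      then show ?thesis using IH[of y] earlier(3)[of y] that by (auto simp: P_def)
    qed
    have maxmin: "L \<noteq> {} \<Longrightarrow> Max L \<in> L" "H \<noteq> {} \<Longrightarrow> Min H \<in> H"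
      using fin by auto
    have LH: "y < z" if "y \<in> L" "z \<in> H" for y z using that by (auto simp: L_def H_def)
    have "R lo hi"
      using ab earlier pair LH maxmin unfolding lo_def hi_def by auto
    then obtain r where r: "R lo r" "R r hi" using dense by blast
    have "R (f z) r" if "z \<in> L" for z
    proof -
      have "z \<le> Max L" "L \<noteq> {}" using that fin by auto
      then have "z = Max L \<or> R (f z) (f (Max L))" using that pair maxmin(1) by auto
      then show ?thesis using r(1) trans \<open>L \<noteq> {}\<close> by (auto simp: lo_def)
    qed
    moreover have "R r (f z)" if "z \<in> H" for z
    proof -
      have "Min H \<le> z" "H \<noteq> {}" using that fin by auto
      then have "z = Min H \<or> R (f (Min H)) (f z)" using that pair maxmin(2) by auto
      then show ?thesis using r(2) trans \<open>H \<noteq> {}\<close> by (auto simp: hi_def)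
    qed
    moreover have "R a r"
      using r(1) trans[OF earlier(1)[of "Max L"], of r] maxmin by (cases "L = {}") (auto simp: lo_def)
    moreover have "R r b"
      using r(2) trans[OF _ earlier(2)[of "Min H"], of r] maxmin by (cases "H = {}") (auto simp: hi_def)
    ultimately show "\<exists>r. P f x r" unfolding P_def L_def H_def by blast
  qed simp
  then obtain f where f: "\<And>x. P f x (f x)" by blast
  have "R (f p) (f q)" if "p < q" for p q
  proof (cases "to_nat p < to_nat q")
    case True
    then show ?thesis using f[of q] that by (auto simp: P_def)
  next
    case False
    then have "to_nat q < to_nat p" using that by (metis less_irrefl not_less_iff_gr_or_eq to_nat_split)
    then show ?thesis using f[of p] that by (auto simp: P_def)
  qed
  then show ?thesis by blast
qed

context linorder
begin

lemma ex_rank: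
  assumes "finite F" "k < card F"
  shows "\<exists>z\<in>F. card {f\<in>F. f < z} = k"
  using assms
proof (induction arbitrary: k rule: finite_linorder_max_induct)
  case (insert b F)
  show ?case
  proof (cases "k < card F")
    case True
    then obtain z where z: "z \<in> F" "card {f\<in>F. f < z} = k" using insert by blast
    then have "{f\<in>insert b F. f < z} = {f\<in>F. f < z}" using insert by (auto dest: less_asym)
    then have "z \<in> insert b F" "card {f\<in>insert b F. f < z} = k" using z by simp_all
    then show ?thesis by blast
  next
    case False
    then have "k = card F" using insert by (auto simp: less_Suc_eq card_insert_if split: if_splits)
    moreover have "{f\<in>insert b F. f < b} = F" using insert by auto
    ultimately show ?thesis by auto
  qed
qed simp

lemma ex_monotone_into:
  assumes "finite X" "finite Y \<longrightarrow> card X \<le> card Y"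
  shows "\<exists>h. h ` X \<subseteq> Y \<and> monotone_on X (<) (<) h"
proof -
  obtain Y' where "Y' \<subseteq> Y" "finite Y'" "card X \<le> card Y'"
    using assms infinite_arbitrarily_large[of Y "card X"] by (cases "finite Y") auto
  moreover have "\<exists>h. h ` X \<subseteq> Y \<and> monotone_on X (<) (<) h" if "finite Y" "card X \<le> card Y" for Y
    using assms(1) that
  proof (induction arbitrary: Y rule: finite_linorder_max_induct)
    case empty
    then show ?case by (auto simp: monotone_on_def)
  next
    case (insert b X)
    have bX: "b \<notin> X" using insert by auto
    then have "Y \<noteq> {}" using insert by auto
    then have M: "Max Y \<in> Y" using insert by auto
    have "card X \<le> card (Y - {Max Y})" using insert M bX by (simp add: card_Diff_singleton)
    then obtain h where h: "h ` X \<subseteq> Y - {Max Y}" "monotone_on X (<) (<) h"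
      using insert.IH[of "Y - {Max Y}"] insert.prems by auto
    have "h x < Max Y" if "x \<in> X" for x
    proof -
      have "h x \<in> Y" "h x \<noteq> Max Y" using h(1) that by auto
      then show ?thesis using Max_ge[OF \<open>finite Y\<close>] by (auto simp: le_less)
    qed
    then have "monotone_on (insert b X) (<) (<) (h(b := Max Y))"
      using h(2) insert(2) bX unfolding monotone_on_def by (auto dest: less_asym)
    moreover have "(h(b := Max Y)) ` insert b X \<subseteq> Y" using h(1) M bX by auto
    ultimately show ?case by blast
  qed
  ultimately show ?thesis by (meson subset_trans)
qed

lemma ex_convex_subset_card:
  assumes "finite C" "n \<le> card C" "\<forall>x\<in>C. \<forall>y\<in>C. \<forall>z\<in>E. x < z \<longrightarrow> z < y \<longrightarrow> z \<in> C"
  shows "\<exists>C'\<subseteq>C. card C' = n \<and> (\<forall>x\<in>C'. \<forall>y\<in>C'. \<forall>z\<in>E. x < z \<longrightarrow> z < y \<longrightarrow> z \<in> C')"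
  using assms
proof (induction rule: finite_linorder_max_induct)
  case (insert b C)
  show ?case
  proof (cases "n = card (insert b C)")
    case False
    have "b \<notin> C" using insert by auto
    then have "n \<le> card C" using False insert by auto
    moreover have "\<forall>x\<in>C. \<forall>y\<in>C. \<forall>z\<in>E. x < z \<longrightarrow> z < y \<longrightarrow> z \<in> C"
    proof (intro ballI impI)
      fix x y z assume "x \<in> C" "y \<in> C" "z \<in> E" "x < z" "z < y"
      moreover from this have "z \<in> insert b C" using insert.prems(2) by blast
      moreover have "y < b" using insert(2) \<open>y \<in> C\<close> by blast
      ultimately show "z \<in> C" by (auto dest: less_asym)
    qed
    ultimately show ?thesis using insert.IH by (meson subset_insertI2)
  qed (use insert.prems(2) in blast)
qed auto

text \<open>Suppose that no convex subset of \<open>E\<close> has exactly \<open>n\<close> elements. Then an interval of \<open>E\<close> with at least \<open>n\<close>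
elements is infinite, because a finite one could be cut down to \<open>n\<close> elements. So the point number \<open>n\<close> out
of \<open>2 n + 1\<close> points of an infinite interval splits it into two infinite intervals: the relation of
having infinitely many points in between is dense, and the rationals embed.\<close>

lemma scattered_ex_finite_convex:
  assumes inf: "infinite E" and sc: "scattered_on (<) E"
  shows "\<exists>C\<subseteq>E. finite C \<and> card C = n \<and> (\<forall>x\<in>C. \<forall>y\<in>C. \<forall>z\<in>E. x < z \<longrightarrow> z < y \<longrightarrow> z \<in> C)"
proof (rule ccontr)
  assume none: "\<not> ?thesis"
  have big: "infinite (E \<inter> {x<..<y})" if "F \<subseteq> E \<inter> {x<..<y}" "n \<le> card F" "finite F" for x y F
  proof
    assume fin: "finite (E \<inter> {x<..<y})"
    then have "n \<le> card (E \<inter> {x<..<y})" using that(2) card_mono[OF fin that(1)] by simp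
    moreover have "\<forall>u\<in>E \<inter> {x<..<y}. \<forall>v\<in>E \<inter> {x<..<y}. \<forall>z\<in>E. u < z \<longrightarrow> z < v \<longrightarrow> z \<in> E \<inter> {x<..<y}"
    proof (intro ballI impI)
      fix u v z assume "u \<in> E \<inter> {x<..<y}" "v \<in> E \<inter> {x<..<y}" "z \<in> E" "u < z" "z < v"
      then show "z \<in> E \<inter> {x<..<y}" using less_trans[of x u z] less_trans[of z v y] by simp
    qed
    ultimately obtain C' where "C' \<subseteq> E \<inter> {x<..<y}" "card C' = n"
      "\<forall>x\<in>C'. \<forall>y\<in>C'. \<forall>z\<in>E. x < z \<longrightarrow> z < y \<longrightarrow> z \<in> C'"
      using ex_convex_subset_card[OF fin, of n E] by blast
    moreover from this have "C' \<subseteq> E" "finite C'" using finite_subset[OF _ fin] by auto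
    ultimately show False using none by blast
  qed
  define R where "R x y \<longleftrightarrow> x \<in> E \<and> y \<in> E \<and> x < y \<and> infinite (E \<inter> {x<..<y})" for x y
  have "R x z" if "R x y" "R y z" for x y z
  proof -
    have "E \<inter> {x<..<y} \<subseteq> E \<inter> {x<..<z}" using that unfolding R_def by auto
    then have "infinite (E \<inter> {x<..<z})" using that finite_subset unfolding R_def by blast
    then show ?thesis using that less_trans[of x y z] unfolding R_def by blast
  qed
  moreover have "\<exists>z. R x z \<and> R z y" if "R x y" for x y
  proof -
    obtain F where F: "F \<subseteq> E \<inter> {x<..<y}" "finite F" "card F = 2 * n + 1"
      using \<open>R x y\<close> infinite_arbitrarily_large[of "E \<inter> {x<..<y}" "2 * n + 1"] unfolding R_def by blast
    then obtain z where z: "z \<in> F" "card {f\<in>F. f < z} = n" using ex_rank[of F n] by auto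
    have split: "F = insert z ({f\<in>F. f < z} \<union> {f\<in>F. z < f})" using z(1) by auto
    have "card F = card (insert z ({f\<in>F. f < z} \<union> {f\<in>F. z < f}))" using split by simp
    also have "\<dots> = Suc (card {f\<in>F. f < z} + card {f\<in>F. z < f})"
      using F(2) by (subst card_insert_disjoint) (auto intro!: card_Un_disjoint)
    finally have "card {f\<in>F. z < f} = n" using z F(3) by simp
    then have "infinite (E \<inter> {z<..<y})" using F by (intro big[of "{f\<in>F. z < f}"]) auto
    moreover have "infinite (E \<inter> {x<..<z})" using F z by (intro big[of "{f\<in>F. f < z}"]) auto
    ultimately have "R x z \<and> R z y" using \<open>R x y\<close> z(1) F(1) unfolding R_def by auto
    then show ?thesis by blast
  qed
  moreover have "\<exists>x y. R x y"
  proof -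
    obtain F where F: "F \<subseteq> E" "finite F" "card F = n + 2"
      using infinite_arbitrarily_large[OF inf, of "n + 2"] by blast
    then have ne: "F \<noteq> {}" by auto
    have "F - {Min F, Max F} \<subseteq> E \<inter> {Min F<..<Max F}"
      using F ne by (auto simp: less_le)
    moreover have "card F - card {Min F, Max F} \<le> card (F - {Min F, Max F})"
      by (rule diff_card_le_card_Diff) simp
    then have "n \<le> card (F - {Min F, Max F})"
      using F(3) card_insert_le_m1[of 2 "{Max F}" "Min F"] by simp
    ultimately have "infinite (E \<inter> {Min F<..<Max F})" using F(2) by (intro big[of "F - {Min F, Max F}"]) auto
    moreover from this have "Min F < Max F" 
      by (metis Int_empty_right finite.emptyI greaterThanLessThan_empty not_le)
    moreover have "Min F \<in> F" "Max F \<in> F" using F(2) ne by auto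
    ultimately have "R (Min F) (Max F)" using F(1) unfolding R_def by blast
    then show ?thesis by blast
  qed
  ultimately obtain f :: "rat \<Rightarrow> 'a" where "\<forall>p q. p < q \<longrightarrow> R (f p) (f q)"
    using rat_embedding[of R] by blast
  then have f: "p < q \<Longrightarrow> f p \<in> E \<and> f p < f q" for p q unfolding R_def by blast
  moreover have "f p \<in> E" for p using f[of p "p + 1"] by simp
  ultimately have "range f \<subseteq> E \<and> (\<forall>p q. p < q \<longrightarrow> f p < f q)" by blast
  then show False using sc unfolding scattered_on_def by blast
qed

text \<open>Let \<open>R\<close> be the gap of \<open>W\<close> in which \<open>a\<close> lies. If only finitely many points of \<open>R\<close> were below \<open>a\<close>, consider
the least point \<open>b \<le> a\<close> of \<open>R\<close> outside \<open>D\<close>. It cannot be the least point of \<open>R\<close>, for then it would be an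
endpoint of the order or a neighbour of a point of \<open>W\<close>. So it has a predecessor in \<open>R\<close>, which belongs to
\<open>D\<close> by the choice of \<open>b\<close>; but points outside \<open>D\<close> have no neighbours in \<open>D\<close>.\<close>

lemma faithful_no_least_outside:
  assumes faithful: "faithful (<) D" and W: "finite W" "W \<subseteq> D" and a: "a \<notin> D"
  shows "infinite {x. x \<notin> W \<and> (\<forall>w\<in>W. w < x \<longleftrightarrow> w < a) \<and> x < a}"
proof
  define R where "R = {x. x \<notin> W \<and> (\<forall>w\<in>W. w < x \<longleftrightarrow> w < a)}"
  assume "finite {x. x \<notin> W \<and> (\<forall>w\<in>W. w < x \<longleftrightarrow> w < a) \<and> x < a}"
  then have fin: "finite (R \<inter> {..<a})"
    by (rule rev_finite_subset) (auto simp: R_def)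
  have convex: "y \<in> R" if "x \<in> R" "z \<in> R" "x < y" "y < z" for x y z
  proof -
    have "y \<notin> W"
    proof
      assume "y \<in> W"
      then have "y < z \<longleftrightarrow> y < x" using that(1,2) unfolding R_def by blast
      then show False using that(3,4) by (auto dest: less_asym)
    qed
    moreover have "w < y \<longleftrightarrow> w < a" if "w \<in> W" for w
    proof -
      have "w < x \<longleftrightarrow> w < a" "w < z \<longleftrightarrow> w < a" using \<open>x \<in> R\<close> \<open>z \<in> R\<close> that unfolding R_def by blast+
      then show ?thesis using \<open>x < y\<close> \<open>y < z\<close> less_trans[of w x y] less_trans[of w y z] by blast
    qed
    ultimately show ?thesis unfolding R_def by blast
  qed
  have aR: "a \<in> R" using W a unfolding R_def by blast
  have below: "\<exists>x\<in>R. x < b" if b: "b \<in> R" "b \<notin> D" for b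
  proof -
    have "\<exists>x. x < b \<and> (\<forall>w\<in>W. w < b \<longrightarrow> w < x)"
    proof (cases "{w\<in>W. w < b} = {}")
      case True
      then show ?thesis using faithful b(2) unfolding faithful_def by auto
    next
      case False
      let ?m = "Max {w\<in>W. w < b}"
      have m: "?m \<in> {w\<in>W. w < b}" using W(1) False by (intro Max_in) auto
      then obtain x where x: "?m < x" "x < b"
        using faithful b(2) W(2) unfolding faithful_def by blast
      have "w < x" if "w \<in> W" "w < b" for w
      proof -
        have "w \<le> ?m" using W(1) that by (intro Max_ge) auto
        then show ?thesis using x(1) by (rule le_less_trans)
      qed
      then show ?thesis using x(2) by blast
    qed
    then obtain x where x: "x < b" "\<forall>w\<in>W. w < b \<longrightarrow> w < x" by blast
    have "x \<notin> W" using x by (metis less_irrefl)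
    moreover have "w < x \<longleftrightarrow> w < a" if "w \<in> W" for w
    proof -
      have "w < b \<longleftrightarrow> w < a" using b(1) that unfolding R_def by blast
      then show ?thesis using x that less_trans[of w x b] by blast
    qed
    ultimately show ?thesis using x(1) unfolding R_def by blast
  qed
  define A where "A = (R \<inter> {..a}) - D"
  have "R \<inter> {..a} \<subseteq> insert a (R \<inter> {..<a})" by (auto simp: le_less)
  then have finA: "finite A" using fin unfolding A_def by (meson finite.insertI finite_Diff finite_subset)
  have "a \<in> A" using aR a unfolding A_def by auto
  then have b: "Min A \<in> A" using finA by (intro Min_in) auto
  define b where "b = Min A"
  have bR: "b \<in> R" "b \<le> a" "b \<notin> D" using b unfolding b_def A_def by auto
  have "R \<inter> {..<b} \<subseteq> R \<inter> {..<a}" using bR(2) less_le_trans by auto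
  then have finb: "finite (R \<inter> {..<b})" using fin finite_subset by blast
  have ne: "R \<inter> {..<b} \<noteq> {}" using below[OF bR(1,3)] by auto
  define m where "m = Max (R \<inter> {..<b})"
  have m: "m \<in> R" "m < b" using Max_in[OF finb ne] unfolding m_def by auto
  have "m \<in> D"
  proof (rule ccontr)
    assume "m \<notin> D"
    then have "m \<in> A" using m bR(2) unfolding A_def by auto
    then have "b \<le> m" unfolding b_def using finA by (intro Min_le) auto
    then show False using m(2) by auto
  qed
  then obtain x where x: "m < x" "x < b" using faithful bR(3) m(2) unfolding faithful_def by blast
  then have "x \<in> R \<inter> {..<b}" using convex[OF m(1) bR(1)] by auto
  then have "x \<le> m" unfolding m_def using finb by (intro Max_ge) auto
  then show False using x(1) by auto
qed

text \<open>The points of \<open>D\<close> below \<open>a\<close> have no greatest one, and finitely many points of \<open>W\<close> cannot stop them from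
entering the gap of \<open>a\<close>.\<close>

lemma infinite_limit_below:
  assumes W: "finite W" "W \<subseteq> D"
    and lim: "\<exists>d\<in>D. d < a" "\<forall>d\<in>D. d < a \<longrightarrow> (\<exists>d'\<in>D. d < d' \<and> d' < a)"
  shows "infinite {x\<in>D. x \<notin> W \<and> (\<forall>w\<in>W. w < x \<longleftrightarrow> w < a)}"
proof
  let ?Q = "{x\<in>D. x \<notin> W \<and> (\<forall>w\<in>W. w < x \<longleftrightarrow> w < a)}"
  assume "finite ?Q"
  then have fin: "finite ({x\<in>?Q \<union> W. x < a})" using W(1) by auto
  define M where "M = {x\<in>?Q \<union> W. x < a}"
  have up: "\<exists>d'\<in>D. (\<forall>m\<in>M. m < d') \<and> d' < a"
  proof (cases "M = {}")
    case True
    then show ?thesis using lim(1) by auto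
  next
    case False
    then have m: "Max M \<in> M" using fin unfolding M_def by (intro Max_in) auto
    then have "Max M \<in> D" "Max M < a" using W(2) unfolding M_def by auto
    then obtain d' where d': "d' \<in> D" "Max M < d'" "d' < a" using lim(2) by blast
    have "m < d'" if "m \<in> M" for m
    proof -
      have "m \<le> Max M" using fin that unfolding M_def[symmetric] by (intro Max_ge) auto
      then show ?thesis using d'(2) by (rule le_less_trans)
    qed
    then show ?thesis using d' by blast
  qed
  then obtain d' where d': "d' \<in> D" "\<forall>m\<in>M. m < d'" "d' < a" by blast
  have "d' \<notin> M" using d'(2) by auto
  then have "d' \<notin> W" using d'(3) unfolding M_def by auto
  moreover have "w < d' \<longleftrightarrow> w < a" if "w \<in> W" for w
    using that d'(2,3) less_trans[of w d' a] unfolding M_def by blast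
  ultimately have "d' \<in> M" using d' unfolding M_def by blast
  then show False using \<open>d' \<notin> M\<close> by blast
qed

lemma faithful_infinite_region:
  assumes faithful: "faithful (<) D" and W: "finite W" "W \<subseteq> D" and a: "a \<notin> D"
  shows "infinite {x\<in>D. x \<notin> W \<and> (\<forall>w\<in>W. w < x \<longleftrightarrow> w < a)}"
proof -
  interpret dual: linorder "(\<ge>)" "(>)" by (rule dual_linorder)
  have eq: "{x\<in>D. x \<notin> W \<and> (\<forall>w\<in>W. x < w \<longleftrightarrow> a < w)} = {x\<in>D. x \<notin> W \<and> (\<forall>w\<in>W. w < x \<longleftrightarrow> w < a)}"
  proof (intro Collect_cong conj_cong refl ball_cong)
    fix x w assume "x \<notin> W" "w \<in> W"
    then have "w \<noteq> x" "w \<noteq> a" using W(2) a by auto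
    then show "(x < w \<longleftrightarrow> a < w) \<longleftrightarrow> (w < x \<longleftrightarrow> w < a)" by (metis less_asym neq_iff)
  qed
  show ?thesis
    using faithful a infinite_limit_below[OF W, of a] dual.infinite_limit_below[OF W, of a]
    unfolding eq faithful_def by blast
qed

lemma faithful_infinite_sides:
  assumes faithful: "faithful (<) D" and W: "finite W" "W \<subseteq> D" and a: "a \<notin> D"
  shows "infinite {x. x \<notin> W \<and> (\<forall>w\<in>W. w < x \<longleftrightarrow> w < a) \<and> x < a}"
    and "infinite {x. x \<notin> W \<and> (\<forall>w\<in>W. w < x \<longleftrightarrow> w < a) \<and> a < x}"
proof -
  interpret dual: linorder "(\<ge>)" "(>)" by (rule dual_linorder)
  have eq: "{x. x \<notin> W \<and> (\<forall>w\<in>W. x < w \<longleftrightarrow> a < w) \<and> a < x} =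
      {x. x \<notin> W \<and> (\<forall>w\<in>W. w < x \<longleftrightarrow> w < a) \<and> a < x}"
  proof (intro Collect_cong conj_cong refl ball_cong)
    fix x w assume "x \<notin> W" "w \<in> W"
    then have "w \<noteq> x" "w \<noteq> a" using W(2) a by auto
    then show "(x < w \<longleftrightarrow> a < w) \<longleftrightarrow> (w < x \<longleftrightarrow> w < a)" by (metis less_asym neq_iff)
  qed
  show "infinite {x. x \<notin> W \<and> (\<forall>w\<in>W. w < x \<longleftrightarrow> w < a) \<and> x < a}"
    by (rule faithful_no_least_outside[OF assms])
  show "infinite {x. x \<notin> W \<and> (\<forall>w\<in>W. w < x \<longleftrightarrow> w < a) \<and> a < x}"
    using dual.faithful_no_least_outside[OF _ W a] faithful eq faithful_dual[of "(<)" D] by simp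
qed

text \<open>One gap \<open>R\<close> of the criterion. The finite set \<open>S\<close> is sent onto a run \<open>C\<close> of consecutive points of \<open>D \<inter> R\<close>
with the same number of elements. A finite part \<open>T\<close> of \<open>D \<inter> R\<close> has no points strictly inside the run; its
points below and above the run are sent to points of \<open>R\<close> below and above \<open>S\<close>, of which there are
infinitely many.\<close>

lemma region_back_and_forth:
  assumes sc: "scattered_on (<) D" and S: "finite S" "S \<subseteq> R"
    and DR: "S \<noteq> {} \<Longrightarrow> infinite (D \<inter> R)"
    and sides: "\<And>a. a \<in> S \<Longrightarrow> infinite (R \<inter> {..<a})" "\<And>a. a \<in> S \<Longrightarrow> infinite (R \<inter> {a<..})"
  shows "\<exists>g. g ` S \<subseteq> D \<inter> R \<and> monotone_on S (<) (<) g \<and>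
    (\<forall>T. finite T \<and> T \<subseteq> D \<inter> R \<longrightarrow>
      (\<exists>e. e ` (T \<union> g ` S) \<subseteq> R \<and> monotone_on (T \<union> g ` S) (<) (<) e \<and> (\<forall>x\<in>S. e (g x) = x)))"
proof (cases "S = {}")
  case True
  then show ?thesis by (auto simp: monotone_on_def intro: exI[of _ "\<lambda>x. x"])
next
  case False
  have "scattered_on (<) (D \<inter> R)" using sc by (rule scattered_on_subset) auto
  then obtain C where C: "C \<subseteq> D \<inter> R" "finite C" "card C = card S"
    and convex: "\<And>x y z. x \<in> C \<Longrightarrow> y \<in> C \<Longrightarrow> z \<in> D \<inter> R \<Longrightarrow> x < z \<Longrightarrow> z < y \<Longrightarrow> z \<in> C"
    using scattered_ex_finite_convex[OF DR[OF False], of "card S"] by blast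
  obtain g where g: "g ` S \<subseteq> C" "monotone_on S (<) (<) g"
    using ex_monotone_into[OF S(1), of C] C by auto
  have inj: "inj_on g S"
  proof (rule inj_onI)
    fix x y assume "x \<in> S" "y \<in> S" "g x = g y"
    then show "x = y" using g(2) unfolding monotone_on_def by (metis less_irrefl neq_iff)
  qed
  have img: "g ` S = C"
    using g(1) C(2,3) card_image[OF inj] by (intro card_subset_eq) auto
  define h where "h = inv_into S g"
  have hg: "h (g x) = x" if "x \<in> S" for x using inj that by (simp add: h_def)
  have hC: "h c \<in> S" "g (h c) = c" if "c \<in> C" for c
    using that img by (auto simp: h_def inv_into_into f_inv_into_f)
  have hmono: "h x < h y" if "x \<in> C" "y \<in> C" "x < y" for x y
  proof (rule ccontr)
    assume "\<not> h x < h y"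
    then have "h y = h x \<or> h y < h x" by auto
    then have "y = x \<or> y < x" using hC that g(2) unfolding monotone_on_def by metis
    then show False using that(3) by auto
  qed
  have "\<exists>e. e ` (T \<union> g ` S) \<subseteq> R \<and> monotone_on (T \<union> g ` S) (<) (<) e \<and> (\<forall>x\<in>S. e (g x) = x)"
    if T: "finite T" "T \<subseteq> D \<inter> R" for T
  proof -
    define lo where "lo = {t\<in>T. \<forall>c\<in>C. t < c}"
    define hi where "hi = {t\<in>T. \<forall>c\<in>C. c < t}"
    have cover: "t \<in> lo \<union> hi" if "t \<in> T" "t \<notin> C" for t
    proof (rule ccontr)
      assume "t \<notin> lo \<union> hi"
      then obtain c c' where "c \<in> C" "\<not> t < c" "c' \<in> C" "\<not> c' < t"
        using \<open>t \<in> T\<close> unfolding lo_def hi_def by blast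
      moreover from this have "c < t" "t < c'" using \<open>t \<notin> C\<close> by (metis neq_iff)+
      ultimately show False using convex[of c c' t] \<open>t \<in> T\<close> \<open>t \<notin> C\<close> T(2) by blast
    qed
    have Min: "Min S \<in> S" and Max: "Max S \<in> S" using S(1) False by auto
    obtain el where el: "el ` lo \<subseteq> R \<inter> {..<Min S}" "monotone_on lo (<) (<) el"
      using ex_monotone_into[of lo "R \<inter> {..<Min S}"] sides(1)[OF Min] T(1) unfolding lo_def by auto
    obtain eh where eh: "eh ` hi \<subseteq> R \<inter> {Max S<..}" "monotone_on hi (<) (<) eh"
      using ex_monotone_into[of hi "R \<inter> {Max S<..}"] sides(2)[OF Max] T(1) unfolding hi_def by auto
    define e where "e t = (if t \<in> C then h t else if t \<in> lo then el t else eh t)" for t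
    obtain c0 where c0: "c0 \<in> C" using False img by blast
    have e_lo: "e t = el t" "e t \<in> R" "e t < Min S" if "t \<in> lo" for t
    proof -
      have "t \<notin> C" using that unfolding lo_def by auto
      then show "e t = el t" using that by (simp add: e_def)
      then show "e t \<in> R" "e t < Min S" using that el(1) by auto
    qed
    have e_hi: "e t = eh t" "e t \<in> R" "Max S < e t" if "t \<in> hi" for t
    proof -
      have "t \<notin> C" using that unfolding hi_def by auto
      moreover have "t \<notin> lo" using that c0 unfolding hi_def lo_def by (auto dest: less_asym)
      ultimately show "e t = eh t" by (simp add: e_def)
      then show "e t \<in> R" "Max S < e t" using that eh(1) by auto
    qed
    have e_C: "e t = h t" "Min S \<le> e t" "e t \<le> Max S" if "t \<in> C" for t
      using that hC(1)[OF that] S(1) by (auto simp: e_def)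
    have "e x < e y" if "x \<in> T \<union> C" "y \<in> T \<union> C" "x < y" for x y
    proof -
      have MM: "Min S \<le> Max S" using Min S(1) by (intro Max_ge)
      have order: "\<not> y < x" using that(3) by auto
      consider "x \<in> lo" "y \<in> lo" | "x \<in> lo" "y \<in> C" | "x \<in> lo" "y \<in> hi" | "x \<in> C" "y \<in> C"
        | "x \<in> C" "y \<in> hi" | "x \<in> hi" "y \<in> hi" | "y \<in> lo" "x \<in> C \<union> hi" | "y \<in> C" "x \<in> hi"
        using cover \<open>x \<in> T \<union> C\<close> \<open>y \<in> T \<union> C\<close> by blast
      then show ?thesis
      proof cases
        case 1
        then show ?thesis using el(2) that(3) by (simp add: e_lo(1) monotone_on_def)
      next
        case 2
        then show ?thesis using e_lo(3) e_C(2) less_le_trans by blast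
      next
        case 3
        then show ?thesis using e_lo(3)[of x] e_hi(3)[of y] MM by (meson le_less_trans less_le_trans less_trans)
      next
        case 4
        then show ?thesis using hmono that(3) e_C(1) by simp
      next
        case 5
        then show ?thesis using e_hi(3) e_C(3) le_less_trans by blast
      next
        case 6
        then show ?thesis using eh(2) that(3) by (simp add: e_hi(1) monotone_on_def)
      next
        case 7
        then have "y < c0" "x \<in> C \<or> c0 < x" "\<forall>c\<in>C. y < c" using c0 unfolding lo_def hi_def by auto
        then show ?thesis using that(3) by (metis less_asym less_trans)
      next
        case 8
        then show ?thesis using that(3) unfolding hi_def by (auto dest: less_asym)
      qed
    qed
    then have "monotone_on (T \<union> C) (<) (<) e" unfolding monotone_on_def by blast
    moreover have "e ` (T \<union> C) \<subseteq> R"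
    proof (rule image_subsetI)
      fix t assume "t \<in> T \<union> C"
      then have "t \<in> C \<or> t \<in> lo \<or> t \<in> hi" using cover by blast
      then show "e t \<in> R" using e_lo(2) e_hi(2) e_C(1) hC(1) S(2) by auto
    qed
    moreover have "\<forall>x\<in>S. e (g x) = x" using img e_C(1) hg by auto
    ultimately show ?thesis unfolding img by blast
  qed
  note ext = this
  show ?thesis
  proof (rule exI[of _ g], intro conjI allI impI)
    show "g ` S \<subseteq> D \<inter> R" using g(1) C(1) by blast
    show "monotone_on S (<) (<) g" by (rule g(2))
  qed (rule ext, blast+)
qed

text \<open>Maps that are defined gap by gap can be glued: points in different gaps of \<open>W\<close> are separated by a
point of \<open>W\<close>, and so are their images.\<close>

lemma monotone_on_if_regions:
  assumes W: "\<And>x. x \<in> W \<Longrightarrow> h x = x"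
    and outside: "\<And>x. x \<in> X \<Longrightarrow> x \<notin> W \<Longrightarrow> h x \<notin> W \<and> (\<forall>w\<in>W. w < h x \<longleftrightarrow> w < x)"
    and inside: "\<And>x y. x \<in> X \<Longrightarrow> y \<in> X \<Longrightarrow> x \<notin> W \<Longrightarrow> y \<notin> W \<Longrightarrow> x < y \<Longrightarrow>
      \<forall>w\<in>W. w < x \<longleftrightarrow> w < y \<Longrightarrow> h x < h y"
  shows "monotone_on X (<) (<) h"
  unfolding monotone_on_def
proof (intro ballI impI)
  fix x y assume xy: "x \<in> X" "y \<in> X" "x < y"
  show "h x < h y"
  proof (cases "x \<in> W")
    case True
    then show ?thesis using W outside[OF xy(2)] xy(3) by (cases "y \<in> W") auto
  next
    case x: False
    show ?thesis
    proof (cases "y \<in> W")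
      case True
      have "\<not> y < h x" "h x \<noteq> y" using outside[OF xy(1) x] True xy(3) by (auto dest: less_asym)
      then show ?thesis using W[OF True] by (metis neq_iff)
    next
      case y: False
      show ?thesis
      proof (cases "\<forall>w\<in>W. w < x \<longleftrightarrow> w < y")
        case True
        then show ?thesis using inside xy x y by blast
      next
        case False
        then obtain w where w: "w \<in> W" "\<not> w < x" "w < y"
          using xy(3) less_trans by blast
        then have "\<not> w < h x" "h x \<noteq> w" "w < h y" using outside xy x y by blast+
        then show ?thesis by (metis neq_iff less_trans)
      qed
    qed
  qed
qed

text \<open>The points of \<open>S0\<close> that are already in \<open>D\<close> are counted among the parameters. The others are distributed
over the gaps of the parameters, where a gap is coded by the set of the parameters below it, and
each gap is treated on its own.\<close>

lemma back_and_forth_if_faithful: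
  assumes faithful: "faithful (<) D" and sc: "scattered_on (<) D"
  shows "back_and_forth (<) D"
  unfolding back_and_forth_def
proof (intro allI impI, elim conjE)
  fix W0 S0 :: "'a set" assume W0: "finite W0" "W0 \<subseteq> D" and S0: "finite S0"
  define W where "W = W0 \<union> (S0 \<inter> D)"
  define S where "S = S0 - D"
  have WS: "W0 \<union> S0 = W \<union> S" and W: "finite W" "W \<subseteq> D" and S: "finite S" "S \<inter> D = {}" and "W0 \<subseteq> W"
    using W0 S0 by (auto simp: W_def S_def)
  define lower where "lower x = {w\<in>W. w < x}" for x
  define R where "R U = {x. x \<notin> W \<and> lower x = U}" for U
  have lower_iff: "lower x = lower y \<longleftrightarrow> (\<forall>w\<in>W. w < x \<longleftrightarrow> w < y)" for x y
    unfolding lower_def by auto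
  have R_lower: "x \<in> R (lower y) \<longleftrightarrow> x \<notin> W \<and> (\<forall>w\<in>W. w < x \<longleftrightarrow> w < y)" for x y
    unfolding R_def by (simp add: lower_iff)
  have "\<exists>g. g ` (S \<inter> R U) \<subseteq> D \<inter> R U \<and> monotone_on (S \<inter> R U) (<) (<) g \<and>
    (\<forall>T. finite T \<and> T \<subseteq> D \<inter> R U \<longrightarrow>
      (\<exists>e. e ` (T \<union> g ` (S \<inter> R U)) \<subseteq> R U \<and> monotone_on (T \<union> g ` (S \<inter> R U)) (<) (<) e \<and>
        (\<forall>x\<in>S \<inter> R U. e (g x) = x)))" for U
  proof (rule region_back_and_forth[OF sc])
    have a: "a \<notin> D" "U = lower a" if "a \<in> S \<inter> R U" for a
      using that S unfolding R_def by auto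
    show "infinite (D \<inter> R U)" if "S \<inter> R U \<noteq> {}"
    proof -
      obtain b where b: "b \<in> S \<inter> R U" using \<open>S \<inter> R U \<noteq> {}\<close> by blast
      have "D \<inter> R (lower b) = {x\<in>D. x \<notin> W \<and> (\<forall>w\<in>W. w < x \<longleftrightarrow> w < b)}"
        unfolding set_eq_iff Int_iff R_lower by simp
      then show ?thesis using faithful_infinite_region[OF faithful W a(1)[OF b]] a(2)[OF b] by simp
    qed
    fix b assume b: "b \<in> S \<inter> R U"
    have "R (lower b) \<inter> {..<b} = {x. x \<notin> W \<and> (\<forall>w\<in>W. w < x \<longleftrightarrow> w < b) \<and> x < b}"
      "R (lower b) \<inter> {b<..} = {x. x \<notin> W \<and> (\<forall>w\<in>W. w < x \<longleftrightarrow> w < b) \<and> b < x}"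
      unfolding set_eq_iff Int_iff R_lower by simp_all
    then show "infinite (R U \<inter> {..<b})" "infinite (R U \<inter> {b<..})"
      using faithful_infinite_sides[OF faithful W a(1)[OF b]] a(2)[OF b] by simp_all
  qed (use S in auto)
  then obtain gU where gU: "\<And>U. gU U ` (S \<inter> R U) \<subseteq> D \<inter> R U"
    "\<And>U. monotone_on (S \<inter> R U) (<) (<) (gU U)"
    and ge: "\<And>U T. finite T \<and> T \<subseteq> D \<inter> R U \<Longrightarrow>
      \<exists>e. e ` (T \<union> gU U ` (S \<inter> R U)) \<subseteq> R U \<and> monotone_on (T \<union> gU U ` (S \<inter> R U)) (<) (<) e \<and>
        (\<forall>x\<in>S \<inter> R U. e (gU U x) = x)"
    by metis
  define g where "g x = (if x \<in> W then x else gU (lower x) x)" for x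
  have inR: "x \<in> R (lower x)" if "x \<notin> W" for x using that by (simp add: R_def)
  have gS: "g x \<in> D" "g x \<notin> W" "lower (g x) = lower x" if "x \<in> W \<union> S" "x \<notin> W" for x
  proof -
    have "g x \<in> D \<inter> R (lower x)" using gU(1)[of "lower x"] inR[OF that(2)] that by (auto simp: g_def)
    then show "g x \<in> D" "g x \<notin> W" "lower (g x) = lower x" by (auto simp: R_def)
  qed
  have gD: "g ` (W \<union> S) \<subseteq> D"
    using gS(1) W(2) by (auto simp: g_def)
  have g_mono: "monotone_on (W \<union> S) (<) (<) g"
  proof (rule monotone_on_if_regions[where W = W])
    fix x y assume xy: "x \<in> W \<union> S" "y \<in> W \<union> S" "x \<notin> W" "y \<notin> W" "x < y" "\<forall>w\<in>W. w < x \<longleftrightarrow> w < y"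
    then have "lower x = lower y" by (simp add: lower_iff)
    then show "g x < g y" using gU(2)[of "lower y"] xy inR[of x] inR[of y] by (simp add: g_def monotone_on_def)
  qed (use gS lower_iff in \<open>simp_all add: g_def\<close>)
  have "\<exists>e. monotone_on (T \<union> g ` (W \<union> S)) (<) (<) e \<and> (\<forall>x\<in>W \<union> S. e (g x) = x)"
    if T: "finite T" "T \<subseteq> D" for T
  proof -
    have "\<exists>e. e ` ((T \<inter> R U) \<union> gU U ` (S \<inter> R U)) \<subseteq> R U \<and>
        monotone_on ((T \<inter> R U) \<union> gU U ` (S \<inter> R U)) (<) (<) e \<and> (\<forall>x\<in>S \<inter> R U. e (gU U x) = x)" for U
      using T by (intro ge) auto
    then obtain eU where eU: "\<And>U. eU U ` ((T \<inter> R U) \<union> gU U ` (S \<inter> R U)) \<subseteq> R U"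
      "\<And>U. monotone_on ((T \<inter> R U) \<union> gU U ` (S \<inter> R U)) (<) (<) (eU U)"
      "\<And>U. \<forall>x\<in>S \<inter> R U. eU U (gU U x) = x"
      by metis
    define e where "e x = (if x \<in> W then x else eU (lower x) x)" for x
    have mem: "t \<in> (T \<inter> R (lower t)) \<union> gU (lower t) ` (S \<inter> R (lower t))"
      if "t \<in> T \<union> g ` (W \<union> S)" "t \<notin> W" for t
    proof (cases "t \<in> T")
      case False
      then obtain x where x: "x \<in> W \<union> S" "t = g x" using \<open>t \<in> T \<union> _\<close> by blast
      then have "x \<notin> W" using \<open>t \<notin> W\<close> by (auto simp: g_def)
      then show ?thesis using x gS(3)[of x] inR[of x] by (auto simp: g_def)
    qed (use inR that in blast)
    have eR: "e t \<notin> W" "lower (e t) = lower t" if "t \<in> T \<union> g ` (W \<union> S)" "t \<notin> W" for t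
    proof -
      have "e t \<in> R (lower t)" using eU(1)[of "lower t"] mem[OF that] that(2) by (auto simp: e_def)
      then show "e t \<notin> W" "lower (e t) = lower t" by (auto simp: R_def)
    qed
    have "monotone_on (T \<union> g ` (W \<union> S)) (<) (<) e"
    proof (rule monotone_on_if_regions[where W = W])
      fix x y assume xy: "x \<in> T \<union> g ` (W \<union> S)" "y \<in> T \<union> g ` (W \<union> S)" "x \<notin> W" "y \<notin> W" "x < y"
        "\<forall>w\<in>W. w < x \<longleftrightarrow> w < y"
      then have "lower x = lower y" by (simp add: lower_iff)
      then show "e x < e y"
        using eU(2)[of "lower y"] xy(3-5) mem[OF xy(1,3)] mem[OF xy(2,4)]
        unfolding e_def monotone_on_def by simp
    qed (use eR lower_iff in \<open>simp_all add: e_def\<close>)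
    moreover have "e (g x) = x" if "x \<in> W \<union> S" for x
    proof (cases "x \<in> W")
      case False
      have "e (g x) = eU (lower x) (gU (lower x) x)"
        using gS(2,3)[OF that False] False by (simp add: e_def) (simp add: g_def)
      then show ?thesis using eU(3)[of "lower x"] inR[OF False] that False by auto
    qed (simp add: e_def g_def)
    ultimately show ?thesis by blast
  qed
  then show "\<exists>g. g ` (W0 \<union> S0) \<subseteq> D \<and> (\<forall>x\<in>W0. g x = x) \<and> monotone_on (W0 \<union> S0) (<) (<) g \<and>
        (\<forall>T. finite T \<and> T \<subseteq> D \<longrightarrow>
          (\<exists>e. monotone_on (T \<union> g ` (W0 \<union> S0)) (<) (<) e \<and> (\<forall>x\<in>W0 \<union> S0. e (g x) = x)))"
    unfolding WS using gD g_mono \<open>W0 \<subseteq> W\<close> by (intro exI[of _ g]) (auto simp: g_def)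
qed

end

section \<open>Decidable copies of orders\<close>

lemma strict_linear_dual: "strict_linear lt \<Longrightarrow> strict_linear (\<lambda>x y. lt y x)"
  unfolding strict_linear_def by blast

lemma strict_linearD:
  assumes "strict_linear lt"
  shows "\<not> lt x x" "lt x y \<Longrightarrow> lt y z \<Longrightarrow> lt x z" "x \<noteq> y \<Longrightarrow> lt x y \<or> lt y x"
    "lt x y \<Longrightarrow> \<not> lt y x"
  using assms unfolding strict_linear_def by blast+

lemma strict_linear_eq_iff: "strict_linear lt \<Longrightarrow> x = y \<longleftrightarrow> \<not> lt x y \<and> \<not> lt y x"
  unfolding strict_linear_def by blast

lemma (in linorder) strict_linear_less: "strict_linear (<)"
  unfolding strict_linear_def using less_trans by auto

definition order_iso_on :: "'a set \<Rightarrow> ('a \<Rightarrow> 'a \<Rightarrow> bool) \<Rightarrow> 'b set \<Rightarrow> ('b \<Rightarrow> 'b \<Rightarrow> bool) \<Rightarrow> bool" where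
  "order_iso_on A lt B lt' \<longleftrightarrow> (\<exists>h. bij_betw h A B \<and> (\<forall>x\<in>A. \<forall>y\<in>A. lt x y \<longleftrightarrow> lt' (h x) (h y)))"

lemma order_iso_on_dual:
  "order_iso_on A (\<lambda>x y. lt y x) B (\<lambda>x y. lt' y x) \<longleftrightarrow> order_iso_on A lt B lt'"
  unfolding order_iso_on_def by blast

text \<open>Strict linear orders compare equal points by comparing neither way, so two families that are compared
in the same way also repeat in the same way.\<close>

lemma order_iso_on_parametrized:
  assumes lin: "strict_linear lt" "strict_linear lt'"
    and same: "\<And>p q. p \<in> I \<Longrightarrow> q \<in> I \<Longrightarrow> lt (f p) (f q) \<longleftrightarrow> lt' (g p) (g q)"
  shows "order_iso_on (f ` I) lt (g ` I) lt'"
proof -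
  have eq: "f p = f q \<longleftrightarrow> g p = g q" if "p \<in> I" "q \<in> I" for p q
    using same that by (simp add: strict_linear_eq_iff[OF lin(1)] strict_linear_eq_iff[OF lin(2)])
  define h where "h x = g (inv_into I f x)" for x
  have h: "h (f p) = g p" if "p \<in> I" for p
  proof -
    have "f p \<in> f ` I" using that by blast
    then have inv: "inv_into I f (f p) \<in> I" "f (inv_into I f (f p)) = f p"
      by (rule inv_into_into, rule f_inv_into_f)
    show ?thesis unfolding h_def by (rule eq[THEN iffD1, OF inv(1) that inv(2)])
  qed
  have "inj_on h (f ` I)"
  proof (rule inj_onI)
    fix x y assume "x \<in> f ` I" "y \<in> f ` I" "h x = h y"
    then obtain p q where "p \<in> I" "q \<in> I" "x = f p" "y = f q" "h x = h y" by blast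
    then show "x = y" using h[of p] h[of q] eq[of p q] by simp
  qed
  moreover have "h ` f ` I = g ` I" using h by (auto simp: image_iff)
  moreover have "\<forall>x\<in>f ` I. \<forall>y\<in>f ` I. lt x y \<longleftrightarrow> lt' (h x) (h y)" using h same by auto
  ultimately show ?thesis unfolding order_iso_on_def bij_betw_def by blast
qed

definition sum_order :: "'a set \<Rightarrow> ('a \<Rightarrow> 'a \<Rightarrow> bool) \<Rightarrow> ('a \<Rightarrow> 'a \<Rightarrow> bool) \<Rightarrow> 'a \<Rightarrow> 'a \<Rightarrow> bool" where
  "sum_order P s1 s2 x y \<longleftrightarrow> x \<in> P \<and> y \<notin> P \<or> x \<in> P \<and> y \<in> P \<and> s1 x y \<or> x \<notin> P \<and> y \<notin> P \<and> s2 x y"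

lemma strict_linear_sum_order:
  assumes "strict_linear s1" "strict_linear s2"
  shows "strict_linear (sum_order P s1 s2)"
proof -
  note s1 = strict_linearD[OF assms(1)] and s2 = strict_linearD[OF assms(2)]
  show ?thesis
    unfolding strict_linear_def
  proof (intro conjI allI impI)
    fix x y z
    show "\<not> sum_order P s1 s2 x x" using s1(1) s2(1) by (simp add: sum_order_def)
    show "sum_order P s1 s2 x z" if "sum_order P s1 s2 x y" "sum_order P s1 s2 y z"
      using that s1(2)[of x y z] s2(2)[of x y z] by (auto simp: sum_order_def)
    show "sum_order P s1 s2 x y \<or> sum_order P s1 s2 y x" if "x \<noteq> y"
      using that s1(3)[of x y] s2(3)[of x y] by (auto simp: sum_order_def)
  qed
qed

lemma decidable_rel_sum_order:
  assumes "decidable_set P" "decidable_rel s1" "decidable_rel s2"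
  shows "decidable_rel (sum_order P s1 s2)"
  unfolding decidable_rel_def sum_order_def
  by (intro decidable_disj decidable_conj decidable_not decidable_member[OF assms(1)]
      decidable_related[OF assms(2)] decidable_related[OF assms(3)] computable_nth) auto

lemma decidable_rel_less: "decidable_rel (<)"
  unfolding decidable_rel_def by (intro decidable_less computable_nth) auto

lemma strict_linear_less_nat: "strict_linear ((<) :: nat \<Rightarrow> nat \<Rightarrow> bool)"
  unfolding strict_linear_def by auto

lemma order_iso_on_sum:
  assumes "order_iso_on A1 lt B1 s1" "order_iso_on A2 lt B2 s2"
    and A: "\<And>x y. x \<in> A1 \<Longrightarrow> y \<in> A2 \<Longrightarrow> lt x y \<and> \<not> lt y x"
    and s: "\<And>x y. x \<in> B1 \<Longrightarrow> y \<in> B1 \<Longrightarrow> s x y \<longleftrightarrow> s1 x y"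
      "\<And>x y. x \<in> B2 \<Longrightarrow> y \<in> B2 \<Longrightarrow> s x y \<longleftrightarrow> s2 x y"
      "\<And>x y. x \<in> B1 \<Longrightarrow> y \<in> B2 \<Longrightarrow> s x y \<and> \<not> s y x"
    and B: "B1 \<inter> B2 = {}"
  shows "order_iso_on (A1 \<union> A2) lt (B1 \<union> B2) s"
proof -
  obtain h1 where h1: "bij_betw h1 A1 B1" "\<forall>x\<in>A1. \<forall>y\<in>A1. lt x y \<longleftrightarrow> s1 (h1 x) (h1 y)"
    using assms(1) unfolding order_iso_on_def by blast
  obtain h2 where h2: "bij_betw h2 A2 B2" "\<forall>x\<in>A2. \<forall>y\<in>A2. lt x y \<longleftrightarrow> s2 (h2 x) (h2 y)"
    using assms(2) unfolding order_iso_on_def by blast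
  have disj: "A1 \<inter> A2 = {}" using A by blast
  define h where "h x = (if x \<in> A1 then h1 x else h2 x)" for x
  have "bij_betw h A1 B1" using h1(1) by (subst bij_betw_cong[of A1 h h1]) (auto simp: h_def)
  moreover have "bij_betw h A2 B2"
    using h2(1) disj by (subst bij_betw_cong[of A2 h h2]) (auto simp: h_def)
  ultimately have bij: "bij_betw h (A1 \<union> A2) (B1 \<union> B2)" using B by (rule bij_betw_combine)
  have hA: "h x = h1 x" "h x \<in> B1" if "x \<in> A1" for x
    using that h1(1) by (auto simp: h_def bij_betwE)
  have hB: "h x = h2 x" "h x \<in> B2" if "x \<in> A2" for x
  proof -
    have "x \<notin> A1" using that disj by blast
    then show "h x = h2 x" by (simp add: h_def)
    then show "h x \<in> B2" using that h2(1) by (auto simp: bij_betwE)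
  qed
  have "lt x y \<longleftrightarrow> s (h x) (h y)" if "x \<in> A1 \<union> A2" "y \<in> A1 \<union> A2" for x y
  proof -
    consider "x \<in> A1" "y \<in> A1" | "x \<in> A1" "y \<in> A2" | "x \<in> A2" "y \<in> A1" | "x \<in> A2" "y \<in> A2"
      using \<open>x \<in> A1 \<union> A2\<close> \<open>y \<in> A1 \<union> A2\<close> by blast
    then show ?thesis
    proof cases
      case 1
      have "s (h x) (h y) \<longleftrightarrow> s1 (h x) (h y)" using 1 hA by (intro s(1))
      then show ?thesis using 1 hA(1) h1(2) by simp
    next
      case 2
      then show ?thesis using A s(3) hA(2) hB(2) by blast
    next
      case 3
      then show ?thesis using A s(3) hA(2) hB(2) by blast
    next
      case 4
      have "s (h x) (h y) \<longleftrightarrow> s2 (h x) (h y)" using 4 hB by (intro s(2))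
      then show ?thesis using 4 hB(1) h2(2) by simp
    qed
  qed
  then show ?thesis using bij unfolding order_iso_on_def by blast
qed

text \<open>A supply of numbers that is large enough to carry all orders used below: after removing one infinite
decidable piece, infinitely many such pieces are still left.\<close>

definition thick :: "nat set \<Rightarrow> bool" where
  "thick X \<longleftrightarrow> decidable_set X \<and> (\<exists>K. \<forall>c\<ge>K. infinite (X \<inter> {x. sqrt_remainder x = c}))"

lemma decidable_set_sqrt_remainder:
  shows "decidable_set {x. sqrt_remainder x = c}" "decidable_set {x. c \<le> sqrt_remainder x}"
  unfolding decidable_set_def
  by (simp_all add: decidable_eq decidable_le computable_sqrt_remainder computable_const computable_nth)

lemma thick_UNIV: "thick UNIV"
  unfolding thick_def by (simp add: decidable_set_UNIV infinite_sqrt_remainder)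

lemma thick_sqrt_remainder: "thick {x. 2 \<le> sqrt_remainder x}"
proof -
  have "{x. 2 \<le> sqrt_remainder x} \<inter> {x. sqrt_remainder x = c} = {x. sqrt_remainder x = c}" if "2 \<le> c" for c
    using that by auto
  then show ?thesis
    unfolding thick_def using infinite_sqrt_remainder decidable_set_sqrt_remainder(2) by metis
qed

lemma thick_diff_finite:
  assumes "thick X" "finite F"
  shows "thick (X - F)"
proof -
  obtain K where K: "\<And>c. c \<ge> K \<Longrightarrow> infinite (X \<inter> {x. sqrt_remainder x = c})"
    using assms(1) unfolding thick_def by blast
  have "infinite ((X - F) \<inter> {x. sqrt_remainder x = c})" if "c \<ge> K" for c
  proof -
    have "(X - F) \<inter> {x. sqrt_remainder x = c} = (X \<inter> {x. sqrt_remainder x = c}) - F" by auto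
    then show ?thesis using Diff_infinite_finite[OF assms(2) K[OF that]] by simp
  qed
  then show ?thesis using assms decidable_set_Diff decidable_set_finite unfolding thick_def by blast
qed

lemma thick_split:
  assumes "thick X"
  obtains Y where "Y \<subseteq> X" "decidable_set Y" "infinite Y" "thick (X - Y)"
proof -
  obtain K where K: "\<And>c. c \<ge> K \<Longrightarrow> infinite (X \<inter> {x. sqrt_remainder x = c})" and X: "decidable_set X"
    using assms unfolding thick_def by blast
  let ?Y = "X \<inter> {x. sqrt_remainder x = K}"
  have "(X - ?Y) \<inter> {x. sqrt_remainder x = c} = X \<inter> {x. sqrt_remainder x = c}" if "c \<ge> Suc K" for c
    using that by auto
  then have "\<forall>c\<ge>Suc K. infinite ((X - ?Y) \<inter> {x. sqrt_remainder x = c})" using K by simp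
  moreover have "decidable_set ?Y" "decidable_set (X - ?Y)"
    by (intro decidable_set_Int decidable_set_Diff X decidable_set_sqrt_remainder)+
  ultimately have "thick (X - ?Y)" "decidable_set ?Y" unfolding thick_def by blast+
  then show thesis using that[of ?Y] K[of K] by simp
qed

lemma thick_infinite: "thick X \<Longrightarrow> infinite X"
  unfolding thick_def by auto

text \<open>The strict order \<open>s\<close> is linear on all numbers, and only its restriction to \<open>X\<close> is meant. That the
copy can be put on any thick set is what makes sums of presentable sets manageable.\<close>

definition presentable :: "('a \<Rightarrow> 'a \<Rightarrow> bool) \<Rightarrow> 'a set \<Rightarrow> bool" where
  "presentable lt A \<longleftrightarrow> (\<forall>X. thick X \<longrightarrow>
     (\<exists>s. strict_linear s \<and> decidable_rel s \<and> order_iso_on A lt X s))"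

text \<open>A slim set has decidable copies that leave a thick set over, so that one more summand can be
accommodated. Finite orders, \<open>\<omega>\<close> and \<open>\<omega>*\<close> are slim.\<close>

definition slim :: "('a \<Rightarrow> 'a \<Rightarrow> bool) \<Rightarrow> 'a set \<Rightarrow> bool" where
  "slim lt A \<longleftrightarrow> (\<forall>X. thick X \<longrightarrow>
     (\<exists>Y s. Y \<subseteq> X \<and> decidable_set Y \<and> thick (X - Y) \<and>
        strict_linear s \<and> decidable_rel s \<and> order_iso_on A lt Y s))"

lemma presentable_dual:
  assumes "presentable lt A"
  shows "presentable (\<lambda>x y. lt y x) A"
  unfolding presentable_def
proof (intro allI impI)
  fix X assume "thick X"
  then obtain s where "strict_linear s" "decidable_rel s" "order_iso_on A lt X s"
    using assms unfolding presentable_def by blast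
  then show "\<exists>s. strict_linear s \<and> decidable_rel s \<and> order_iso_on A (\<lambda>x y. lt y x) X s"
    by (intro exI[of _ "\<lambda>x y. s y x"] conjI)
      (rule strict_linear_dual decidable_rel_conv order_iso_on_dual[THEN iffD2], assumption)+
qed

lemma slim_dual:
  assumes "slim lt A"
  shows "slim (\<lambda>x y. lt y x) A"
  unfolding slim_def
proof (intro allI impI)
  fix X assume "thick X"
  then obtain Y s where "Y \<subseteq> X" "decidable_set Y" "thick (X - Y)"
    "strict_linear s" "decidable_rel s" "order_iso_on A lt Y s"
    using assms unfolding slim_def by blast
  then show "\<exists>Y s. Y \<subseteq> X \<and> decidable_set Y \<and> thick (X - Y) \<and>
      strict_linear s \<and> decidable_rel s \<and> order_iso_on A (\<lambda>x y. lt y x) Y s"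
    by (intro exI[of _ Y] exI[of _ "\<lambda>x y. s y x"] conjI)
      (assumption | rule strict_linear_dual decidable_rel_conv order_iso_on_dual[THEN iffD2], assumption)+
qed

lemma presentable_sum:
  assumes "slim lt A1" "presentable lt A2"
    and A: "\<And>x y. x \<in> A1 \<Longrightarrow> y \<in> A2 \<Longrightarrow> lt x y \<and> \<not> lt y x"
  shows "presentable lt (A1 \<union> A2)"
  unfolding presentable_def
proof (intro allI impI)
  fix X assume "thick X"
  then obtain Y s1 where Y: "Y \<subseteq> X" "decidable_set Y" "thick (X - Y)"
    and s1: "strict_linear s1" "decidable_rel s1" "order_iso_on A1 lt Y s1"
    using assms(1) unfolding slim_def by blast
  then obtain s2 where s2: "strict_linear s2" "decidable_rel s2" "order_iso_on A2 lt (X - Y) s2"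
    using assms(2) unfolding presentable_def by blast
  have "order_iso_on (A1 \<union> A2) lt (Y \<union> (X - Y)) (sum_order Y s1 s2)"
    using s1(3) s2(3) A by (rule order_iso_on_sum) (auto simp: sum_order_def)
  moreover have "Y \<union> (X - Y) = X" using Y by blast
  ultimately show "\<exists>s. strict_linear s \<and> decidable_rel s \<and> order_iso_on (A1 \<union> A2) lt X s"
    using strict_linear_sum_order decidable_rel_sum_order Y s1 s2 by metis
qed

lemma presentable_sequence:
  assumes "strict_linear lt" "\<And>i j. lt (c i) (c j) \<longleftrightarrow> i < (j::nat)"
  shows "presentable lt (range c)" "slim lt (range c)"
proof -
  have iso: "order_iso_on (range c) lt X (<)" if "infinite X" for X :: "nat set"
    using order_iso_on_parametrized[OF assms(1) strict_linear_less_nat, of UNIV c "enumerate X"]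
      that assms(2) by (simp add: range_enumerate)
  then show "presentable lt (range c)"
    unfolding presentable_def using thick_infinite strict_linear_less_nat decidable_rel_less by blast
  show "slim lt (range c)"
    unfolding slim_def using thick_split iso strict_linear_less_nat decidable_rel_less by metis
qed

text \<open>The order type is \<open>\<omega>\<cdot>\<omega>*\<close>. The pieces of \<open>X\<close>, numbered by the remainder, are taken in descending order,
each of them in its natural order. Remainders up to \<open>K\<close>, whose pieces may be finite, are merged into one
piece.\<close>

lemma presentable_double_sequence:
  assumes lin: "strict_linear lt"
    and lt: "\<And>i j i' j'. lt (c i j) (c i' j') \<longleftrightarrow> i' < i \<or> i = i' \<and> j < (j' :: nat)"
  shows "presentable lt (\<Union>i::nat. range (c i))"
  unfolding presentable_def
proof (intro allI impI)
  fix X assume X: "thick X"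
  then obtain K where K: "\<And>c. c \<ge> K \<Longrightarrow> infinite (X \<inter> {x. sqrt_remainder x = c})"
    unfolding thick_def by blast
  \<comment> \<open>the maximum of \<open>K\<close> and the remainder\<close>
  define block where "block x = K + (sqrt_remainder x - K)" for x
  define s where "s x y \<longleftrightarrow> block y < block x \<or> block x = block y \<and> x < y" for x y
  have comp: "computable k f \<Longrightarrow> computable k (\<lambda>xs. block (f xs))" for k f
    unfolding block_def
    by (intro computable_add computable_diff computable_sqrt_remainder computable_const)
  have s_lin: "strict_linear s" unfolding strict_linear_def s_def by auto
  have s_dec: "decidable_rel s"
    unfolding decidable_rel_def s_def
    by (intro decidable_disj decidable_conj decidable_less decidable_eq comp computable_nth) auto
  define f where "f i = enumerate {x\<in>X. block x = K + i}" for i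
  have inf: "infinite {x\<in>X. block x = K + i}" for i
  proof -
    have "X \<inter> {x. sqrt_remainder x = K + i} \<subseteq> {x\<in>X. block x = K + i}" by (auto simp: block_def)
    then show ?thesis using K[of "K + i"] finite_subset by auto
  qed
  have block_f: "block (f i j) = K + i" "f i j \<in> X" for i j
    using enumerate_in_set[OF inf[of i], of j] by (auto simp: f_def)
  have f_less: "f i j < f i j' \<longleftrightarrow> j < j'" for i j j'
    using inf[of i] by (simp add: f_def)
  have "order_iso_on ((\<lambda>(i, j). c i j) ` UNIV) lt ((\<lambda>(i, j). f i j) ` UNIV) s"
    by (rule order_iso_on_parametrized[OF lin s_lin]) (auto simp: lt s_def block_f f_less)
  moreover have "(\<lambda>(i, j). c i j) ` UNIV = (\<Union>i. range (c i))" by auto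
  moreover have "(\<lambda>(i, j). f i j) ` UNIV = X"
  proof (intro subset_antisym subsetI)
    fix x assume x: "x \<in> X"
    obtain i where "block x = K + i" by (simp add: block_def)
    then have "x \<in> {x\<in>X. block x = K + i}" using x by simp
    then obtain j where "f i j = x" using enumerate_Ex[OF inf[of i]] unfolding f_def by blast
    then show "x \<in> (\<lambda>(i, j). f i j) ` UNIV" by (auto intro!: image_eqI[of _ _ "(i, j)"])
  qed (auto simp: block_f)
  ultimately show "\<exists>s. strict_linear s \<and> decidable_rel s \<and> order_iso_on (\<Union>i. range (c i)) lt X s"
    using s_lin s_dec by auto
qed

lemma (in linorder) slim_finite:
  assumes A: "finite A"
  shows "slim (<) A"
  unfolding slim_def
proof (intro allI impI)
  fix X assume X: "thick X"
  obtain Y where Y: "finite Y" "card Y = card A" "Y \<subseteq> X"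
    using infinite_arbitrarily_large[OF thick_infinite[OF X]] by blast
  define rank where "rank x = card {a\<in>A. a < x}" for x
  have rank_less: "rank x < rank y" if "x \<in> A" "x < y" for x y
    unfolding rank_def using A that less_trans by (intro psubset_card_mono) auto
  have rank_card: "rank x < card Y" if "x \<in> A" for x
    unfolding rank_def Y(2) using A that by (intro psubset_card_mono) auto
  define h where "h x = enumerate Y (rank x)" for x
  have h_less: "h x < h y" if "x \<in> A" "y \<in> A" "x < y" for x y
    unfolding h_def using rank_less rank_card that Y(1) by (intro finite_enumerate_mono) auto
  have same: "x < y \<longleftrightarrow> h x < h y" if "x \<in> A" "y \<in> A" for x y
    using h_less[of x y] h_less[of y x] that by (cases x y rule: linorder_cases) auto
  have "h ` A \<subseteq> Y"
    using finite_enumerate_in_set[OF Y(1)] rank_card unfolding h_def by auto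
  moreover have "inj_on h A"
  proof (rule inj_onI)
    fix x y assume "x \<in> A" "y \<in> A" "h x = h y"
    then show "x = y" using h_less[of x y] h_less[of y x] by (cases x y rule: linorder_cases) auto
  qed
  ultimately have "h ` A = Y"
    using Y by (intro card_subset_eq) (auto simp: card_image)
  moreover have "order_iso_on ((\<lambda>x. x) ` A) (<) (h ` A) (<)"
    using same by (intro order_iso_on_parametrized strict_linear_less strict_linear_less_nat)
  ultimately have "order_iso_on A (<) Y (<)" by simp
  then show "\<exists>Y s. Y \<subseteq> X \<and> decidable_set Y \<and> thick (X - Y) \<and>
      strict_linear s \<and> decidable_rel s \<and> order_iso_on A (<) Y s"
    using Y X thick_diff_finite decidable_set_finite strict_linear_less_nat decidable_rel_less by blast
qed

text \<open>All that is needed of an order for the two kinds of copies. The last alternative allows an isomorphism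
of \<open>B\<close> with \<open>D\<close> to be extended to a bijection between the whole orders.\<close>

definition realizable :: "('a \<Rightarrow> 'a \<Rightarrow> bool) \<Rightarrow> bool" where
  "realizable lt \<longleftrightarrow> (\<exists>B D s. faithful lt B \<and> order_iso_on B lt D s \<and>
     dense D \<and> decidable_set D \<and> strict_linear s \<and> decidable_rel s \<and> faithful s D \<and>
     (B = UNIV \<and> D = UNIV \<or> infinite (- B) \<and> infinite (- D)))"

lemma realizable_dual:
  assumes "realizable lt"
  shows "realizable (\<lambda>x y. lt y x)"
proof -
  obtain B D s where *: "faithful lt B" "order_iso_on B lt D s" "dense D" "decidable_set D"
    "strict_linear s" "decidable_rel s" "faithful s D"
    "B = UNIV \<and> D = UNIV \<or> infinite (- B) \<and> infinite (- D)"
    using assms unfolding realizable_def by blast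
  show ?thesis unfolding realizable_def
    by (intro exI[of _ B] exI[of _ D] exI[of _ "\<lambda>x y. s y x"] conjI)
      (rule * faithful_dual[THEN iffD2] order_iso_on_dual[THEN iffD2] strict_linear_dual decidable_rel_conv)+
qed

lemma realizable_if_presentable:
  assumes "presentable lt UNIV"
  shows "realizable lt"
proof -
  obtain s where "strict_linear s" "decidable_rel s" "order_iso_on UNIV lt UNIV s"
    using assms thick_UNIV unfolding presentable_def by blast
  then show ?thesis
    unfolding realizable_def
    by (intro exI[of _ UNIV] exI[of _ s]) (simp add: faithful_def dense_UNIV decidable_set_UNIV)
qed

text \<open>The order \<open>s\<close> has type \<open>B1 + \<zeta> + B2\<close>. The numbers with remainder at least 2 carry \<open>B1\<close> and \<open>B2\<close>; those with
remainder 0, in reverse order, followed by those with remainder 1, form the copy of \<open>\<zeta>\<close>. As \<open>B1\<close> is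
nonempty without greatest element and \<open>\<zeta>\<close> is without endpoints, the new points have no neighbours in
\<open>B1 + B2\<close> and separate no adjacent points of it.\<close>

lemma realizable_if_faithful:
  assumes B1: "presentable lt B1" "B1 \<noteq> {}" "\<And>x. x \<in> B1 \<Longrightarrow> \<exists>y\<in>B1. lt x y"
    and B2: "slim lt B2"
    and B12: "\<And>x y. x \<in> B1 \<Longrightarrow> y \<in> B2 \<Longrightarrow> lt x y \<and> \<not> lt y x"
    and faithful: "faithful lt (B1 \<union> B2)" and inf: "infinite (- (B1 \<union> B2))"
  shows "realizable lt"
proof -
  define E where "E = {x. 2 \<le> sqrt_remainder x}"
  define Z0 where "Z0 = {x. sqrt_remainder x = 0}"
  define Z1 where "Z1 = {x. sqrt_remainder x = 1}"
  have infZ: "infinite Z0" "infinite Z1" unfolding Z0_def Z1_def by (rule infinite_sqrt_remainder)+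
  have E: "thick E" "decidable_set E" "dense E"
    unfolding E_def using thick_sqrt_remainder dense_sqrt_remainder thick_def by auto
  obtain Y s2 where Y: "Y \<subseteq> E" "decidable_set Y" "thick (E - Y)"
    and s2: "strict_linear s2" "decidable_rel s2" "order_iso_on B2 lt Y s2"
    using B2 E(1) unfolding slim_def by blast
  obtain s1 where s1: "strict_linear s1" "decidable_rel s1" "order_iso_on B1 lt (E - Y) s1"
    using B1(1) Y(3) unfolding presentable_def by blast
  define s where "s = sum_order (E - Y) s1 (sum_order Z0 (\<lambda>x y. y < x) (sum_order Z1 (<) s2))"
  have disj: "E \<inter> Z0 = {}" "E \<inter> Z1 = {}" "Z0 \<inter> Z1 = {}" and cover: "x \<in> E \<or> x \<in> Z0 \<or> x \<in> Z1" for x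
    by (auto simp: E_def Z0_def Z1_def)
  have s_lin: "strict_linear s"
    unfolding s_def using s1 s2
    by (intro strict_linear_sum_order strict_linear_dual[OF strict_linear_less_nat] strict_linear_less_nat)
  have s_dec: "decidable_rel s"
    unfolding s_def
    by (intro decidable_rel_sum_order decidable_rel_conv[OF decidable_rel_less] decidable_rel_less s1 s2
        decidable_set_Diff E Y) (simp_all add: Z0_def Z1_def decidable_set_sqrt_remainder)
  have "order_iso_on (B1 \<union> B2) lt ((E - Y) \<union> Y) s"
    using s1(3) s2(3) B12 by (rule order_iso_on_sum) (use Y(1) disj in \<open>auto simp: s_def sum_order_def\<close>)
  moreover have "(E - Y) \<union> Y = E" using Y(1) by blast
  ultimately have iso: "order_iso_on (B1 \<union> B2) lt E s" by simp
  obtain h where h: "bij_betw h B1 (E - Y)" "\<forall>x\<in>B1. \<forall>y\<in>B1. lt x y \<longleftrightarrow> s1 (h x) (h y)"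
    using s1(3) unfolding order_iso_on_def by blast
  have up: "\<exists>y\<in>E - Y. s x y" if "x \<in> E - Y" for x
  proof -
    have "x \<in> h ` B1" using that h(1) by (simp add: bij_betw_def)
    then obtain b where b: "b \<in> B1" "h b = x" by blast
    obtain b' where "b' \<in> B1" "lt b b'" using B1(3) b by blast
    then have "h b' \<in> E - Y" "s1 x (h b')" using h b bij_betwE[OF h(1)] by blast+
    then show ?thesis using that by (auto simp: s_def sum_order_def)
  qed
  have ne: "E - Y \<noteq> {}" using Y(3) thick_infinite by fastforce
  obtain z0 where z0: "z0 \<in> Z0" using infZ(1) by fastforce
  obtain z1 where z1: "z1 \<in> Z1" using infZ(2) by fastforce
  have larger: "\<exists>z\<in>Z0. a < z" "\<exists>z\<in>Z1. a < z" for a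
    using infZ unfolding infinite_nat_iff_unbounded by blast+
  have lower: "s x a" if "x \<in> E - Y" "a \<in> Z0 \<union> Z1" for x a
    using that disj by (auto simp: s_def sum_order_def)
  have upper: "s a x" if "x \<in> Y" "a \<in> Z0 \<union> Z1" for x a
    using that disj Y(1) by (auto simp: s_def sum_order_def)
  have Z01: "s x y" if "x \<in> Z0" "y \<in> Z1" for x y using that disj by (auto simp: s_def sum_order_def)
  have Z00: "s x y" if "x \<in> Z0" "y \<in> Z0" "y < x" for x y using that disj by (auto simp: s_def sum_order_def)
  have Z11: "s x y" if "x \<in> Z1" "y \<in> Z1" "x < y" for x y using that disj by (auto simp: s_def sum_order_def)
  note asym = strict_linearD(4)[OF s_lin]
  have "faithful s E"
    unfolding faithful_def
  proof (intro allI impI)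
    fix a assume "a \<notin> E"
    then have a: "a \<in> Z0 \<union> Z1" using cover by blast
    have below: "\<exists>x\<in>Z0 \<union> Z1. s x a" using a larger[of a] Z00 Z01 z0 by blast
    have above: "\<exists>x\<in>Z0 \<union> Z1. s a x" using a larger[of a] Z11 Z01 z1 by blast
    have d_low: "d \<in> E - Y" if "d \<in> E" "s d a" for d using that upper[OF _ a] asym by blast
    have d_up: "d \<in> Y" if "d \<in> E" "s a d" for d using that lower[OF _ a] asym by blast
    have 1: "\<forall>d\<in>E. s d a \<longrightarrow> (\<exists>x. s d x \<and> s x a)" using below d_low lower by blast
    have 2: "\<forall>d\<in>E. s a d \<longrightarrow> (\<exists>x. s a x \<and> s x d)" using above d_up upper by blast
    have 3: "\<forall>d\<in>E. s d a \<longrightarrow> (\<exists>d'\<in>E. s d d' \<and> s d' a)" using d_low up lower[OF _ a] by blast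
    have 4: "\<exists>d\<in>E. s d a" using ne lower[OF _ a] by blast
    show "(\<exists>x. s x a) \<and> (\<exists>x. s a x) \<and> (\<forall>d\<in>E. s d a \<longrightarrow> (\<exists>x. s d x \<and> s x a)) \<and>
      (\<forall>d\<in>E. s a d \<longrightarrow> (\<exists>x. s a x \<and> s x d)) \<and>
      ((\<exists>d\<in>E. s d a) \<and> (\<forall>d\<in>E. s d a \<longrightarrow> (\<exists>d'\<in>E. s d d' \<and> s d' a)) \<or>
       (\<exists>d\<in>E. s a d) \<and> (\<forall>d\<in>E. s a d \<longrightarrow> (\<exists>d'\<in>E. s a d' \<and> s d' d)))"
      using below above 1 2 3 4 by blast
  qed
  moreover have "infinite (- E)"
    using infZ(1) disj(1) finite_subset[of Z0 "- E"] by blast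
  ultimately show ?thesis
    unfolding realizable_def using faithful iso E s_lin s_dec inf by blast
qed

section \<open>Infinite blocks of scattered orders\<close>

definition covers :: "('a \<Rightarrow> 'a \<Rightarrow> bool) \<Rightarrow> 'a \<Rightarrow> 'a \<Rightarrow> bool" where
  "covers lt x y \<longleftrightarrow> lt x y \<and> \<not> (\<exists>z. lt x z \<and> lt z y)"

text \<open>For the reverse order this says that each term is the predecessor of the one before.\<close>

definition successors :: "('a \<Rightarrow> 'a \<Rightarrow> bool) \<Rightarrow> (nat \<Rightarrow> 'a) \<Rightarrow> bool" where
  "successors lt c \<longleftrightarrow> (\<forall>j. covers lt (c j) (c (Suc j)))"

text \<open>The least element of a block of type \<open>\<omega>\<close>; for the reverse order, the greatest element of a block of type
\<open>\<omega>*\<close>.\<close>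

definition omega_block_start :: "('a \<Rightarrow> 'a \<Rightarrow> bool) \<Rightarrow> 'a \<Rightarrow> bool" where
  "omega_block_start lt x \<longleftrightarrow> (\<exists>c. successors lt c \<and> c 0 = x) \<and> \<not> (\<exists>y. covers lt y x)"

definition endless_interval :: "('a \<Rightarrow> 'a \<Rightarrow> bool) \<Rightarrow> 'a set \<Rightarrow> bool" where
  "endless_interval lt I \<longleftrightarrow> I \<noteq> {} \<and> (\<forall>x\<in>I. \<exists>y\<in>I. lt x y) \<and> (\<forall>x\<in>I. \<exists>y\<in>I. lt y x) \<and>
     (\<forall>x\<in>I. \<forall>z\<in>I. \<forall>y. lt x y \<longrightarrow> lt y z \<longrightarrow> y \<in> I)"

text \<open>A finite initial segment whose complement has no least element: the empty set if the order has no
least element, and otherwise the finite block at the lower end. For the reverse order, the upper end.\<close>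

definition finite_end :: "('a \<Rightarrow> 'a \<Rightarrow> bool) \<Rightarrow> 'a set \<Rightarrow> bool" where
  "finite_end lt F \<longleftrightarrow> finite F \<and> (\<forall>x\<in>F. \<forall>y. lt y x \<longrightarrow> y \<in> F) \<and> (\<forall>x. x \<notin> F \<longrightarrow> (\<exists>y. y \<notin> F \<and> lt y x))"

text \<open>The lower end of the order is a block of type \<open>\<omega>\<close>, enumerated by \<open>c\<close>.\<close>

definition omega_end :: "('a \<Rightarrow> 'a \<Rightarrow> bool) \<Rightarrow> (nat \<Rightarrow> 'a) \<Rightarrow> bool" where
  "omega_end lt c \<longleftrightarrow> successors lt c \<and> (\<forall>x j. lt x (c j) \<longrightarrow> x \<in> range c)"

lemma covers_dual: "covers (\<lambda>x y. lt y x) x y \<longleftrightarrow> covers lt y x"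
  unfolding covers_def by blast

lemma endless_interval_dual: "endless_interval (\<lambda>x y. lt y x) I \<longleftrightarrow> endless_interval lt I"
  unfolding endless_interval_def by blast

context linorder
begin

lemma successors_less_iff:
  assumes "successors (<) c"
  shows "c i < c j \<longleftrightarrow> i < j"
proof -
  have "c n < c (Suc n)" for n using assms unfolding successors_def covers_def by blast
  then show ?thesis by (rule lift_Suc_mono_less_iff)
qed

lemma successors_no_gap:
  assumes "successors (<) c" "c 0 \<le> a" "a \<notin> range c"
  shows "c j < a"
proof (induction j)
  case 0
  then show ?case using assms by (auto simp: le_less)
next
  case (Suc j)
  have "a \<noteq> c (Suc j)" using assms(3) by blast
  moreover have "\<not> a < c (Suc j)" using assms(1) Suc unfolding successors_def covers_def by blast
  ultimately show ?case by (metis neq_iff)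
qed

text \<open>A point without predecessor is never reached by passing to successors.\<close>

lemma successors_below_limit:
  assumes "successors (<) c" "c 0 < m" "\<not> (\<exists>y. covers (<) y m)"
  shows "c j < m"
proof (cases "m \<in> range c")
  case True
  then obtain i where i: "m = c i" by blast
  then have "i \<noteq> 0" using assms(2) by (metis less_irrefl)
  then obtain i' where "i = Suc i'" by (cases i) auto
  then show ?thesis using i assms(1,3) unfolding successors_def by blast
next
  case False
  then show ?thesis using assms successors_no_gap[of c m] by (simp add: less_imp_le)
qed

lemma ex_min_finite_intervals:
  assumes "x < z" "finite {x<..<z}"
  shows "\<exists>s. covers (<) x s \<and> s \<le> z"
proof -
  have "{x<..z} \<subseteq> insert z {x<..<z}" by (auto simp: le_less)
  then have fin: "finite {x<..z}" using assms(2) finite_subset by blast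
  have ne: "{x<..z} \<noteq> {}" using assms(1) by auto
  let ?s = "Min {x<..z}"
  have s: "x < ?s" "?s \<le> z" using Min_in[OF fin ne] by auto
  have "\<not> w < ?s" if "x < w" for w
  proof
    assume "w < ?s"
    then have "w \<in> {x<..z}" using that s(2) by auto
    then have "?s \<le> w" using fin by (rule Min_le[rotated])
    then show False using \<open>w < ?s\<close> by auto
  qed
  then show ?thesis using s unfolding covers_def by blast
qed

text \<open>Every point \<open>y\<close> at finite distance above \<open>x\<close> has infinitely many such points above it, and up to one
of them there are only finitely many points; the least of these is the successor of \<open>y\<close>.\<close>

lemma successors_if_infinite_near:
  assumes "infinite {z. x < z \<and> finite {x<..<z}}"
  shows "\<exists>c. successors (<) c \<and> c 0 = x"
proof -
  define Z where "Z = {z. x < z \<and> finite {x<..<z}}"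
  have inf: "infinite Z" using assms unfolding Z_def .
  have step: "\<exists>s. (s = x \<or> s \<in> Z) \<and> covers (<) y s" if y: "y = x \<or> y \<in> Z" for y
  proof -
    have fin_y: "finite {x<..<y}" and xy: "x \<le> y" using y unfolding Z_def by auto
    have "\<exists>z\<in>Z. y < z"
    proof (rule ccontr)
      assume "\<not> ?thesis"
      then have "Z \<subseteq> insert y {x<..<y}" unfolding Z_def by (auto simp: not_less le_less)
      then show False using inf fin_y finite_subset by blast
    qed
    then obtain z where z: "z \<in> Z" "y < z" by blast
    have "{y<..<z} \<subseteq> {x<..<z}" using xy by auto
    then have "finite {y<..<z}" using z(1) finite_subset unfolding Z_def by blast
    then obtain s where s: "covers (<) y s" "s \<le> z" using ex_min_finite_intervals z(2) by blast
    have "x < s" using s(1) xy unfolding covers_def by (metis le_less_trans)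
    moreover have "{x<..<s} \<subseteq> {x<..<z}" using s(2) by auto
    then have "finite {x<..<s}" using z(1) finite_subset unfolding Z_def by blast
    ultimately show ?thesis using s(1) unfolding Z_def by blast
  qed
  have "\<exists>c. \<forall>n. (c n = x \<or> c n \<in> Z) \<and> (n = 0 \<longrightarrow> c n = x) \<and> covers (<) (c n) (c (Suc n))"
    using dependent_nat_choice[of "\<lambda>n y. (y = x \<or> y \<in> Z) \<and> (n = 0 \<longrightarrow> y = x)" "\<lambda>n y s. covers (<) y s"]
      step by auto
  then show ?thesis unfolding successors_def by blast
qed

lemma covers_in_endless_interval:
  assumes I: "endless_interval (<) I" and x: "x \<in> I"
  shows "covers (<) x y \<Longrightarrow> y \<in> I" and "covers (<) y x \<Longrightarrow> y \<in> I"
proof -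
  obtain z z' where z: "z \<in> I" "x < z" "z' \<in> I" "z' < x" using I x unfolding endless_interval_def by blast
  have convex: "w \<in> I" if "u \<in> I" "v \<in> I" "u < w" "w < v" for u v w
    using I that unfolding endless_interval_def by blast
  show "y \<in> I" if "covers (<) x y"
  proof -
    have "y = z \<or> y < z" "x < y" using that z(2) unfolding covers_def by (metis neq_iff)+
    then show ?thesis using convex[OF x z(1)] z(1) by blast
  qed
  show "y \<in> I" if "covers (<) y x"
  proof -
    have "y = z' \<or> z' < y" "y < x" using that z(4) unfolding covers_def by (metis neq_iff)+
    then show ?thesis using convex[OF z(3) x] z(3) by blast
  qed
qed

lemma successors_in_endless_interval:
  assumes "endless_interval (<) I" "successors (<) c" "c 0 \<in> I"
  shows "c j \<in> I"
  using assms covers_in_endless_interval(1)[OF assms(1)]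
  by (induction j) (auto simp: successors_def)

text \<open>Without infinite blocks each point has only finitely many points at finite distance. Then an infinite
interval contains a point at infinite distance from both of its ends, so the relation of being at
infinite distance is dense, and the rationals embed.\<close>

lemma ex_infinite_block:
  assumes I: "endless_interval (<) I" and sc: "scattered_on (<) I"
  shows "\<exists>c. c 0 \<in> I \<and> (successors (<) c \<or> successors (>) c)"
proof (rule ccontr)
  assume none: "\<not> ?thesis"
  interpret dual: linorder "(\<ge>)" "(>)" by (rule dual_linorder)
  have convex: "w \<in> I" if "u \<in> I" "v \<in> I" "u < w" "w < v" for u v w
    using I that unfolding endless_interval_def by blast
  have near_up: "finite {z. x < z \<and> finite {x<..<z}}" if "x \<in> I" for x
    using successors_if_infinite_near[of x] none that by blast
  have near_down: "finite {z. z < x \<and> finite {z<..<x}}" if "x \<in> I" for x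
  proof -
    have "ord.greaterThanLessThan (>) x z = {z<..<x}" for z
      by (auto simp: dual.greaterThanLessThan_iff)
    then show ?thesis using dual.successors_if_infinite_near[of x] none that by auto
  qed
  define R where "R x y \<longleftrightarrow> x \<in> I \<and> y \<in> I \<and> x < y \<and> infinite {x<..<y}" for x y
  have "R x z" if "R x y" "R y z" for x y z
  proof -
    have "{x<..<y} \<subseteq> {x<..<z}" using that unfolding R_def by auto
    then have "infinite {x<..<z}" using that finite_subset unfolding R_def by blast
    then show ?thesis using that less_trans[of x y z] unfolding R_def by blast
  qed
  moreover have "\<exists>z. R x z \<and> R z y" if "R x y" for x y
  proof (rule ccontr)
    assume "\<not> ?thesis"
    then have "{x<..<y} \<subseteq> {z. x < z \<and> finite {x<..<z}} \<union> {z. z < y \<and> finite {z<..<y}}"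
      using that convex[of x y] unfolding R_def by auto
    then show False
      using that near_up[of x] near_down[of y] finite_subset unfolding R_def by blast
  qed
  moreover have "\<exists>x y. R x y"
  proof -
    obtain x where x: "x \<in> I" using I unfolding endless_interval_def by blast
    have "\<exists>y\<in>I. x < y \<and> infinite {x<..<y}"
    proof (rule ccontr)
      assume "\<not> ?thesis"
      then have sub: "{y\<in>I. x < y} \<subseteq> {z. x < z \<and> finite {x<..<z}}" by blast
      then have fin: "finite {y\<in>I. x < y}" using near_up[OF x] finite_subset by blast
      have ne: "{y\<in>I. x < y} \<noteq> {}" using I x unfolding endless_interval_def by blast
      have M: "Max {y\<in>I. x < y} \<in> {y\<in>I. x < y}" using Max_in[OF fin ne] .
      then obtain y where y: "y \<in> I" "Max {y\<in>I. x < y} < y" using I unfolding endless_interval_def by blast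
      then have "y \<in> {y\<in>I. x < y}" using M less_trans by blast
      then have "y \<le> Max {y\<in>I. x < y}" by (rule Max_ge[OF fin])
      then show False using y(2) by (simp add: leD)
    qed
    then show ?thesis using x unfolding R_def by blast
  qed
  ultimately obtain f :: "rat \<Rightarrow> 'a" where "\<forall>p q. p < q \<longrightarrow> R (f p) (f q)"
    using rat_embedding[of R] by blast
  then have f: "p < q \<Longrightarrow> f p \<in> I \<and> f p < f q" for p q unfolding R_def by blast
  moreover have "f p \<in> I" for p using f[of p "p + 1"] by simp
  ultimately have "range f \<subseteq> I \<and> (\<forall>p q. p < q \<longrightarrow> f p < f q)" by blast
  then show False using sc unfolding scattered_on_def by blast
qed

text \<open>Going down from a point with infinitely many successors, one meets a point without predecessor, or
never stops.\<close>

lemma omega_block_or_zeta: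
  assumes I: "endless_interval (<) I" and c: "successors (<) c" "c 0 \<in> I"
  shows "(\<exists>x\<in>I. omega_block_start (<) x) \<or>
    (\<exists>c d. successors (<) c \<and> successors (>) d \<and> c 0 = d 0 \<and> c 0 \<in> I)"
proof (cases "\<exists>x\<in>I. omega_block_start (<) x")
  case False
  define U where "U = {x\<in>I. \<exists>c. successors (<) c \<and> c 0 = x}"
  have step: "\<exists>y\<in>U. covers (<) y x" if "x \<in> U" for x
  proof -
    obtain b where b: "successors (<) b" "b 0 = x" and x: "x \<in> I" using \<open>x \<in> U\<close> unfolding U_def by blast
    then obtain y where y: "covers (<) y x" using False unfolding omega_block_start_def by blast
    have "y \<in> I" using covers_in_endless_interval(2)[OF I x y] .
    moreover have "covers (<) (case_nat y b j) (case_nat y b (Suc j))" for j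
      using y b unfolding successors_def by (cases j) auto
    then have "successors (<) (case_nat y b)" unfolding successors_def by blast
    then have "\<exists>c. successors (<) c \<and> c 0 = y" by (intro exI[of _ "case_nat y b"]) simp
    ultimately show ?thesis using y unfolding U_def by blast
  qed
  have "c 0 \<in> U" using c unfolding U_def by blast
  then have "\<exists>d. \<forall>n. (d n \<in> U \<and> (n = 0 \<longrightarrow> d n = c 0)) \<and> covers (<) (d (Suc n)) (d n)"
    using dependent_nat_choice[of "\<lambda>n y. y \<in> U \<and> (n = 0 \<longrightarrow> y = c 0)" "\<lambda>n y s. covers (<) s y"]
      step by auto
  then obtain d where d: "\<And>n. covers (<) (d (Suc n)) (d n)" "d 0 = c 0" by blast
  then have "successors (>) d" unfolding successors_def by (simp add: covers_dual[of "(<)"])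
  then show ?thesis using c d(2) by metis
qed simp

lemma successor_blocks_cases:
  assumes I: "endless_interval (<) I" and sc: "scattered_on (<) I"
  obtains (zeta) c d where "successors (<) c" "successors (>) d" "c 0 = d 0" "c 0 \<in> I"
  | (omega) x where "x \<in> I" "omega_block_start (<) x"
  | (omega_rev) x where "x \<in> I" "omega_block_start (>) x"
proof -
  interpret dual: linorder "(\<ge>)" "(>)" by (rule dual_linorder)
  have I': "endless_interval (>) I" using I endless_interval_dual[of "(<)" I] by simp
  obtain c where c: "c 0 \<in> I" "successors (<) c \<or> successors (>) c" using ex_infinite_block[OF I sc] by blast
  from c(2) show thesis
  proof
    assume "successors (<) c"
    from omega_block_or_zeta[OF I this c(1)] show thesis using zeta omega by blast
  next
    assume "successors (>) c"
    from dual.omega_block_or_zeta[OF I' this c(1)] show thesis using zeta omega_rev by auto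
  qed
qed

lemma endless_interval_below:
  assumes I: "endless_interval (<) I" and k: "k \<in> I" "\<not> (\<exists>y. covers (<) y k)"
  shows "endless_interval (<) {x\<in>I. x < k}"
  unfolding endless_interval_def
proof (intro conjI ballI allI impI)
  show "{x\<in>I. x < k} \<noteq> {}" using I k(1) unfolding endless_interval_def by blast
  fix x assume x: "x \<in> {x\<in>I. x < k}"
  then obtain y where "x < y" "y < k" using k(2) unfolding covers_def by blast
  then show "\<exists>y\<in>{x\<in>I. x < k}. x < y" using I k(1) x unfolding endless_interval_def by blast
  obtain y where "y \<in> I" "y < x" using I x unfolding endless_interval_def by blast
  then show "\<exists>y\<in>{x\<in>I. x < k}. y < x" using x less_trans[of y x k] by blast
next
  fix x y z assume "x \<in> {x\<in>I. x < k}" "z \<in> {x\<in>I. x < k}" "x < y" "y < z"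
  then show "y \<in> {x\<in>I. x < k}" using I less_trans[of y z k] unfolding endless_interval_def by blast
qed

text \<open>Suppose that there is no block of type \<open>\<zeta>\<close>. If there are blocks of type \<open>\<omega>\<close> and below each of them there
is another one, they form a descending sequence. Otherwise the part \<open>J\<close> below a lowest one, or everything
if there is none, is again without endpoints and contains no block of type \<open>\<omega>\<close>. Each part of \<open>J\<close> without
endpoints then contains a block of type \<open>\<omega>*\<close>; the part above such a block is without endpoints, and so an
ascending sequence arises.\<close>

lemma endless_interval_blocks:
  assumes I: "endless_interval (<) I" and sc: "scattered_on (<) I"
  obtains (zeta) c d where "successors (<) c" "successors (>) d" "c 0 = d 0" "c 0 \<in> I"
  | (descending) k where "\<And>i::nat. k i \<in> I \<and> omega_block_start (<) (k i) \<and> k (Suc i) < k i"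
  | (ascending) k where "\<And>i::nat. k i \<in> I \<and> omega_block_start (>) (k i) \<and> k i < k (Suc i)"
proof -
  interpret dual: linorder "(\<ge>)" "(>)" by (rule dual_linorder)
  show thesis
  proof (cases "\<exists>c d. successors (<) c \<and> successors (>) d \<and> c 0 = d 0 \<and> c 0 \<in> I")
    case True
    then show thesis using zeta by blast
  next
    case no_zeta: False
    define K where "K = {k\<in>I. omega_block_start (<) k}"
    show thesis
    proof (cases "K \<noteq> {} \<and> (\<forall>k\<in>K. \<exists>k'\<in>K. k' < k)")
      case True
      then have "\<exists>k. \<forall>n::nat. k n \<in> K \<and> k (Suc n) < k n"
        using dependent_nat_choice[of "\<lambda>n y. y \<in> K" "\<lambda>n y s. s < y"] by blast
      then show thesis using descending unfolding K_def by blast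
    next
      case no_descent: False
      \<comment> \<open>below a lowest block of type \<omega>, no such block is left\<close>
      obtain J where J: "endless_interval (<) J" "J \<subseteq> I" "J \<inter> K = {}"
      proof (cases "K = {}")
        case True
        then show thesis using that[of I] I by simp
      next
        case False
        then obtain k where k: "k \<in> K" "\<forall>k'\<in>K. \<not> k' < k" using no_descent by blast
        then have "endless_interval (<) {x\<in>I. x < k}"
          using endless_interval_below[OF I, of k] unfolding K_def omega_block_start_def by blast
        then show thesis using that[of "{x\<in>I. x < k}"] k(2) by blast
      qed
      define M where "M = {m\<in>J. omega_block_start (>) m}"
      have ex: "\<exists>m\<in>J'. omega_block_start (>) m" if J': "endless_interval (<) J'" "J' \<subseteq> J" for J'
      proof -
        have "scattered_on (<) J'" using sc that(2) J(2) by (meson scattered_on_subset subset_trans)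
        from J'(1) this show ?thesis
        proof (cases rule: successor_blocks_cases)
          case (zeta c d)
          then show ?thesis using no_zeta J(2) J'(2) by blast
        next
          case (omega x)
          then show ?thesis using J(2,3) J'(2) unfolding K_def by blast
        qed blast
      qed
      have "\<exists>m'\<in>M. m < m'" if m: "m \<in> M" for m
      proof -
        have "endless_interval (>) J" using J(1) endless_interval_dual[of "(<)" J] by simp
        then have "endless_interval (>) {x\<in>J. m < x}"
          using dual.endless_interval_below[of J m] m unfolding M_def omega_block_start_def by blast
        then have "endless_interval (<) {x\<in>J. m < x}" using endless_interval_dual[of "(<)"] by simp
        then show ?thesis using ex[of "{x\<in>J. m < x}"] unfolding M_def by blast
      qed
      moreover have "\<exists>m. m \<in> M" using ex[OF J(1)] unfolding M_def by blast
      ultimately have "\<exists>k. \<forall>n::nat. k n \<in> M \<and> k n < k (Suc n)"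
        using dependent_nat_choice[of "\<lambda>n y. y \<in> M" "\<lambda>n y s. y < s"] by blast
      then show thesis using ascending J(2) unfolding M_def by blast
    qed
  qed
qed

end

section \<open>Faithful suborders with a decidable copy\<close>

lemma realizable_below_dual: "realizable (\<lambda>x y. lt y x) \<Longrightarrow> realizable lt"
  using realizable_dual[of "\<lambda>x y. lt y x"] by simp

context linorder
begin

text \<open>If no finite initial segment has a complement without least element, then the least elements of the
complements can be added one after the other, which produces the block of type \<open>\<omega>\<close>.\<close>

lemma finite_end_or_omega_end: "(\<exists>F. finite_end (<) F) \<or> (\<exists>c. omega_end (<) c)"
proof (cases "\<exists>F. finite_end (<) F")
  case False
  define initial where "initial F \<longleftrightarrow> finite F \<and> (\<forall>x\<in>F. \<forall>y. y < x \<longrightarrow> y \<in> F)" for F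
  \<comment> \<open>the least element of the complement of \<open>F\<close>\<close>
  define least where "least F = (SOME x. x \<notin> F \<and> (\<forall>y. y \<notin> F \<longrightarrow> x \<le> y))" for F
  have least: "least F \<notin> F" "y \<notin> F \<Longrightarrow> least F \<le> y" if "initial F" for F y
  proof -
    have "\<exists>x. x \<notin> F \<and> (\<forall>y. y \<notin> F \<longrightarrow> x \<le> y)"
    proof -
      have "\<not> (\<forall>x. x \<notin> F \<longrightarrow> (\<exists>y. y \<notin> F \<and> y < x))"
        using False that unfolding finite_end_def initial_def by blast
      then obtain x where "x \<notin> F" "\<forall>y. y \<notin> F \<longrightarrow> \<not> y < x" by blast
      then show ?thesis by (intro exI[of _ x]) (simp add: not_less)
    qed
    from someI_ex[OF this] show "least F \<notin> F" "y \<notin> F \<Longrightarrow> least F \<le> y"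
      unfolding least_def by blast+
  qed
  define G where "G = rec_nat {} (\<lambda>n F. insert (least F) F)"
  define c where "c n = least (G n)" for n
  have G_Suc: "G (Suc n) = insert (c n) (G n)" and G_0: "G 0 = {}" for n by (simp_all add: G_def c_def)
  have initial: "initial (G n)" for n
  proof (induction n)
    case 0
    then show ?case by (simp add: G_0 initial_def)
  next
    case (Suc n)
    have "y \<in> G n" if "y < c n" for y
      using least(2)[OF Suc, of y] that by (cases "y \<in> G n") (auto simp: c_def dest: leD)
    then show ?case using Suc unfolding G_Suc initial_def by blast
  qed
  have c: "c n \<notin> G n" "y \<notin> G n \<Longrightarrow> c n \<le> y" for n y
    unfolding c_def using least[OF initial] by blast+
  have "covers (<) (c n) (c (Suc n))" for n
    unfolding covers_def
  proof (intro conjI notI)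
    have "c (Suc n) \<noteq> c n" "c (Suc n) \<notin> G n" using c(1)[of "Suc n"] unfolding G_Suc by auto
    then show "c n < c (Suc n)" using c(2)[of "c (Suc n)" n] by (auto simp: le_less)
    assume "\<exists>z. c n < z \<and> z < c (Suc n)"
    then obtain z where z: "c n < z" "z < c (Suc n)" by blast
    have "z \<notin> G n" using initial[of n] z(1) c(1)[of n] unfolding initial_def by blast
    then have "z \<notin> G (Suc n)" using z(1) unfolding G_Suc by auto
    then have "c (Suc n) \<le> z" by (rule c(2))
    then show False using z(2) by auto
  qed
  moreover have "G n \<subseteq> range c" for n by (induction n) (auto simp: G_0 G_Suc)
  moreover have "x \<in> G j" if "x < c j" for x j using c(2)[of x j] that by (cases "x \<in> G j") (auto dest: leD)
  ultimately have "omega_end (<) c" unfolding omega_end_def successors_def by blast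
  then show ?thesis by blast
qed simp

lemma presentable_successors:
  assumes "successors (<) c"
  shows "presentable (<) (range c)" "slim (<) (range c)"
  using presentable_sequence[OF strict_linear_less, of c] successors_less_iff[OF assms] by auto

lemma presentable_sum_less:
  assumes "slim (<) A1" "presentable (<) A2" "\<And>x y. x \<in> A1 \<Longrightarrow> y \<in> A2 \<Longrightarrow> x < y"
  shows "presentable (<) (A1 \<union> A2)"
  using assms by (intro presentable_sum) (auto dest: less_asym)

lemma realizable_if_faithful_less:
  assumes "presentable (<) B1" "B1 \<noteq> {}" "\<And>x. x \<in> B1 \<Longrightarrow> \<exists>y\<in>B1. x < y" "slim (<) B2"
    "\<And>x y. x \<in> B1 \<Longrightarrow> y \<in> B2 \<Longrightarrow> x < y" "faithful (<) (B1 \<union> B2)" "infinite (- (B1 \<union> B2))"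
  shows "realizable (<)"
  using assms by (intro realizable_if_faithful[of "(<)" B1 B2]) (auto dest: less_asym)

lemma successors_ex_greater: "successors (<) c \<Longrightarrow> x \<in> range c \<Longrightarrow> \<exists>y\<in>range c. x < y"
  unfolding successors_def covers_def by blast

lemma successors_no_new_neighbour:
  assumes "successors (<) c" "c j < a" "a \<notin> range c"
  shows "\<exists>x. c j < x \<and> x < a"
proof -
  have "covers (<) (c j) (c (Suc j))" using assms(1) unfolding successors_def by blast
  moreover have "a \<noteq> c (Suc j)" using assms(3) by blast
  ultimately have "c j < c (Suc j)" "c (Suc j) < a"
    using assms(2) unfolding covers_def by (metis neq_iff)+
  then show ?thesis by blast
qed

text \<open>Everything outside \<open>B = range c \<union> G\<close> lies between the two parts, and the part below has no greatest
element.\<close>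

lemma faithful_omega_end:
  assumes c: "omega_end (<) c" and lower: "\<And>x y. x \<in> range c \<Longrightarrow> y \<notin> range c \<Longrightarrow> x < y"
    and up: "\<And>a. a \<notin> range c \<union> G \<Longrightarrow> \<exists>x. a < x"
    "\<And>a d. a \<notin> range c \<union> G \<Longrightarrow> d \<in> G \<Longrightarrow> a < d \<Longrightarrow> \<exists>x. a < x \<and> x < d"
    and G: "\<And>a d. a \<notin> range c \<union> G \<Longrightarrow> d \<in> G \<Longrightarrow> a < d"
  shows "faithful (<) (range c \<union> G)"
  unfolding faithful_def
proof (intro allI impI)
  fix a assume a: "a \<notin> range c \<union> G"
  have c': "successors (<) c" using c unfolding omega_end_def by blast
  have less: "x < a" if "x \<in> range c" for x using lower that a by blast
  have 1: "\<exists>x. x < a" using less[of "c 0"] by blast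
  have G': "\<not> d < a" if "d \<in> G" for d using G[OF a that] by auto
  have 2: "\<forall>d\<in>range c \<union> G. d < a \<longrightarrow> (\<exists>d'\<in>range c. d < d' \<and> d' < a)"
    using less G' successors_ex_greater[OF c'] by blast
  have 3: "\<forall>d\<in>range c \<union> G. a < d \<longrightarrow> (\<exists>x. a < x \<and> x < d)"
  proof (intro ballI impI)
    fix d assume d: "d \<in> range c \<union> G" "a < d"
    have "d \<notin> range c" using less[of d] less_asym[OF d(2)] by blast
    then show "\<exists>x. a < x \<and> x < d" using up(2)[OF a _ d(2)] d(1) by blast
  qed
  show "(\<exists>x. x < a) \<and> (\<exists>x. a < x) \<and>
    (\<forall>d\<in>range c \<union> G. d < a \<longrightarrow> (\<exists>x. d < x \<and> x < a)) \<and> (\<forall>d\<in>range c \<union> G. a < d \<longrightarrow> (\<exists>x. a < x \<and> x < d)) \<and>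
    ((\<exists>d\<in>range c \<union> G. d < a) \<and> (\<forall>d\<in>range c \<union> G. d < a \<longrightarrow> (\<exists>d'\<in>range c \<union> G. d < d' \<and> d' < a)) \<or>
     (\<exists>d\<in>range c \<union> G. a < d) \<and> (\<forall>d\<in>range c \<union> G. a < d \<longrightarrow> (\<exists>d'\<in>range c \<union> G. a < d' \<and> d' < d)))"
  proof (intro conjI disjI1 1 up(1)[OF a] 3)
    show "\<exists>d\<in>range c \<union> G. d < a" using less[of "c 0"] by blast
    show "\<forall>d\<in>range c \<union> G. d < a \<longrightarrow> (\<exists>d'\<in>range c \<union> G. d < d' \<and> d' < a)" using 2 by blast
    show "\<forall>d\<in>range c \<union> G. d < a \<longrightarrow> (\<exists>x. d < x \<and> x < a)" using 2 by blast
  qed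
qed

lemma omega_end_less:
  assumes "omega_end (<) c" "x \<in> range c" "y \<notin> range c"
  shows "x < y"
proof (rule ccontr)
  assume "\<not> x < y"
  then have "y < x" using assms(2,3) by (metis neq_iff)
  then show False using assms unfolding omega_end_def by blast
qed

lemma finite_end_less:
  assumes "finite_end (<) F" "x \<in> F" "y \<notin> F"
  shows "x < y"
proof (rule ccontr)
  assume "\<not> x < y"
  then have "y < x" using assms(2,3) by (metis neq_iff)
  then show False using assms unfolding finite_end_def by blast
qed

text \<open>This keeps the lower end of the order disjoint from the upper end: a common point would have finitely
many points on one side where the other end has infinitely many.\<close>

lemma finite_below_omega_end:
  assumes "omega_end (<) c" "x \<in> range c"
  shows "finite {y. y \<le> x}"
proof -
  have c: "successors (<) c" using assms(1) unfolding omega_end_def by blast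
  obtain j where j: "x = c j" using assms(2) by blast
  have "{y. y \<le> x} \<subseteq> c ` {..j}"
  proof
    fix y assume "y \<in> {y. y \<le> x}"
    then have y: "y \<le> c j" using j by simp
    then have "y \<in> range c" using assms(1) by (auto simp: le_less omega_end_def)
    then obtain i where i: "y = c i" by blast
    then have "\<not> j < i" using y successors_less_iff[OF c, of j i] by auto
    then show "y \<in> c ` {..j}" using i by auto
  qed
  then show ?thesis using finite_subset by blast
qed

lemma infinite_successors: "successors (<) c \<Longrightarrow> infinite (range c)"
  using successors_less_iff[of c] by (intro range_inj_infinite injI) (metis less_irrefl nat_neq_iff)

text \<open>The points between the two ends have no greatest one, so they are infinite in number, or there are none
and the order itself is of type \<open>\<omega> + G\<close>.\<close>

lemma realizable_omega_and_finite_end: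
  assumes c: "omega_end (<) c" and G: "finite_end (>) G"
  shows "realizable (<)"
proof -
  interpret dual: linorder "(\<ge>)" "(>)" by (rule dual_linorder)
  have succ: "successors (<) c" using c unfolding omega_end_def by blast
  have "finite G" using G unfolding finite_end_def by blast
  have G_less: "x < y" if "x \<notin> G" "y \<in> G" for x y using dual.finite_end_less[OF G] that by blast
  have disj: "x \<notin> range c" if "x \<in> G" for x
  proof
    assume "x \<in> range c"
    have "range c - {y. y \<le> x} \<subseteq> G"
    proof
      fix y assume "y \<in> range c - {y. y \<le> x}"
      then have "x < y" by (simp add: not_le)
      then show "y \<in> G" using G that unfolding finite_end_def by blast
    qed
    then have "finite (range c - {y. y \<le> x})" using \<open>finite G\<close> finite_subset by blast
    moreover have "finite {y. y \<le> x}" using finite_below_omega_end[OF c] \<open>x \<in> range c\<close> by blast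
    ultimately show False using infinite_successors[OF succ] by (metis Diff_infinite_finite)
  qed
  have below: "x < y" if "x \<in> range c" "y \<notin> range c" for x y using omega_end_less[OF c that] .
  have slimG: "slim (<) G" using slim_finite \<open>finite G\<close> by blast
  show ?thesis
  proof (cases "range c \<union> G = UNIV")
    case True
    have "presentable (>) (G \<union> range c)"
      using dual.presentable_sum_less[OF slim_dual[OF slimG] presentable_dual[OF presentable_successors(1)[OF succ]]]
        below disj by blast
    then have "presentable (>) UNIV" using True by (simp add: Un_commute)
    then have "presentable (<) UNIV" using presentable_dual[of "(>)"] by simp
    then show ?thesis by (rule realizable_if_presentable)
  next
    case False
    have up: "\<exists>y. y \<notin> range c \<union> G \<and> a < y" if "a \<notin> range c \<union> G" for a
    proof -
      obtain y where "y \<notin> G" "a < y" using G \<open>a \<notin> range c \<union> G\<close> unfolding finite_end_def by blast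
      then show ?thesis using that below[of y a] less_asym[of a y] by blast
    qed
    have "infinite (- (range c \<union> G))"
    proof (rule infinite_growing)
      show "- (range c \<union> G) \<noteq> {}" using False by blast
      show "\<exists>y\<in>- (range c \<union> G). x < y" if "x \<in> - (range c \<union> G)" for x using up[of x] that by blast
    qed
    moreover have "faithful (<) (range c \<union> G)"
    proof (rule faithful_omega_end[OF c below])
      fix a assume a: "a \<notin> range c \<union> G"
      then show "\<exists>x. a < x" using up by blast
      show "a < d" if "d \<in> G" for d using G_less a that by blast
      show "\<exists>x. a < x \<and> x < d" if "d \<in> G" for d using up[OF a] G_less that by blast
    qed
    ultimately show ?thesis
      using presentable_successors(1)[OF succ] successors_ex_greater[OF succ] slimG below disj
      by (intro realizable_if_faithful_less[of "range c" G]) auto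
  qed
qed

text \<open>Here the points between the two ends may be finite in number and not zero. Then they are included,
and the order itself, of type \<open>\<omega> + k + \<omega>*\<close> for a finite \<open>k\<close>, has a decidable copy.\<close>

lemma realizable_omega_ends:
  assumes c: "omega_end (<) c" and d: "omega_end (>) d"
  shows "realizable (<)"
proof -
  interpret dual: linorder "(\<ge>)" "(>)" by (rule dual_linorder)
  have succ: "successors (<) c" using c unfolding omega_end_def by blast
  have succ_d: "successors (>) d" using d unfolding omega_end_def by blast
  have disj: "x \<notin> range c" if "x \<in> range d" for x
  proof
    assume x: "x \<in> range c"
    have "x \<in> range d" by (rule that)
    then have "range d - {y. x \<le> y} \<subseteq> {y. y \<le> x}" by auto
    then have "finite (range d - {y. x \<le> y})" using finite_below_omega_end[OF c x] finite_subset by blast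
    moreover have "finite {y. x \<le> y}" using dual.finite_below_omega_end[OF d that] by simp
    ultimately show False using dual.infinite_successors[OF succ_d] by (metis Diff_infinite_finite)
  qed
  have below: "x < y" if "x \<in> range c" "y \<notin> range c" for x y using omega_end_less[OF c that] .
  have above: "x < y" if "x \<notin> range d" "y \<in> range d" for x y using dual.omega_end_less[OF d that(2,1)] .
  have slim_d: "slim (<) (range d)" and pres_d: "presentable (<) (range d)"
    using slim_dual[OF dual.presentable_successors(2)[OF succ_d]]
      presentable_dual[OF dual.presentable_successors(1)[OF succ_d]] by simp_all
  show ?thesis
  proof (cases "finite (- (range c \<union> range d))")
    case True
    have mid: "presentable (<) (- (range c \<union> range d) \<union> range d)"
      using slim_finite[OF True] pres_d above by (intro presentable_sum_less) auto
    have "presentable (<) (range c \<union> (- (range c \<union> range d) \<union> range d))"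
      using below disj by (intro presentable_sum_less[OF presentable_successors(2)[OF succ] mid]) auto
    moreover have "range c \<union> (- (range c \<union> range d) \<union> range d) = UNIV" by blast
    ultimately show ?thesis using realizable_if_presentable by simp
  next
    case False
    have "faithful (<) (range c \<union> range d)"
    proof (rule faithful_omega_end[OF c below])
      fix a assume a: "a \<notin> range c \<union> range d"
      then show "\<exists>x. a < x" using above[of a "d 0"] by blast
      show "a < e" if "e \<in> range d" for e using above a that by blast
      show "\<exists>x. a < x \<and> x < e" if e: "e \<in> range d" "a < e" for e
        using dual.successors_no_new_neighbour[OF succ_d, where a = a] a e by blast
    qed
    then show ?thesis
      using presentable_successors(1)[OF succ] successors_ex_greater[OF succ] slim_d below disj False
      by (intro realizable_if_faithful_less[of "range c" "range d"]) auto
  qed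
qed

lemma finite_ends_between:
  assumes inf: "infinite (UNIV :: 'a set)" and F: "finite_end (<) F" and G: "finite_end (>) G"
  shows "endless_interval (<) (- (F \<union> G))"
    and "\<And>x y. x \<in> F \<Longrightarrow> y \<notin> F \<Longrightarrow> x < y" and "\<And>x y. x \<notin> G \<Longrightarrow> y \<in> G \<Longrightarrow> x < y"
    and "F \<inter> G = {}"
proof -
  interpret dual: linorder "(\<ge>)" "(>)" by (rule dual_linorder)
  show F_less: "x < y" if "x \<in> F" "y \<notin> F" for x y using finite_end_less[OF F that] .
  show G_less: "x < y" if "x \<notin> G" "y \<in> G" for x y using dual.finite_end_less[OF G] that by blast
  have fin: "finite (F \<union> G)" using F G unfolding finite_end_def by blast
  then have ne: "- (F \<union> G) \<noteq> {}" using inf by (metis Compl_empty_eq double_compl)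
  then obtain m where m: "m \<notin> F" "m \<notin> G" by blast
  show "F \<inter> G = {}" using F_less[of _ m] G_less[of m] m by (auto dest: less_asym)
  show "endless_interval (<) (- (F \<union> G))"
    unfolding endless_interval_def
  proof (intro conjI ne ballI allI impI)
    fix x assume x: "x \<in> - (F \<union> G)"
    obtain y where "y \<notin> F" "y < x" using F x unfolding finite_end_def by blast
    then show "\<exists>y\<in>- (F \<union> G). y < x" using x G_less[of x y] less_asym[of y x] by blast
    obtain y where "y \<notin> G" "x < y" using G x unfolding finite_end_def by blast
    then show "\<exists>y\<in>- (F \<union> G). x < y" using x F_less[of y x] less_asym[of x y] by blast
  next
    fix x y z assume "x \<in> - (F \<union> G)" "z \<in> - (F \<union> G)" "x < y" "y < z"
    then show "y \<in> - (F \<union> G)" using F_less[of y x] G_less[of z y] less_asym[of x y] less_asym[of y z] by blast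
  qed
qed

lemma faithful_between_finite_ends:
  assumes inf: "infinite (UNIV :: 'a set)" and F: "finite_end (<) F" and G: "finite_end (>) G"
    and C: "C \<subseteq> - (F \<union> G)"
    and nbr: "\<And>a d. a \<notin> F \<union> C \<union> G \<Longrightarrow> d \<in> C \<Longrightarrow> d < a \<Longrightarrow> \<exists>x. d < x \<and> x < a"
      "\<And>a d. a \<notin> F \<union> C \<union> G \<Longrightarrow> d \<in> C \<Longrightarrow> a < d \<Longrightarrow> \<exists>x. a < x \<and> x < d"
    and limit: "\<And>a. a \<notin> F \<union> C \<union> G \<Longrightarrow>
      (\<exists>d\<in>C. d < a) \<and> (\<forall>d\<in>C. d < a \<longrightarrow> (\<exists>d'\<in>C. d < d' \<and> d' < a)) \<or>
      (\<exists>d\<in>C. a < d) \<and> (\<forall>d\<in>C. a < d \<longrightarrow> (\<exists>d'\<in>C. a < d' \<and> d' < d))"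
  shows "faithful (<) (F \<union> C \<union> G)"
  unfolding faithful_def
proof (intro allI impI)
  note between = finite_ends_between[OF inf F G]
  fix a assume a: "a \<notin> F \<union> C \<union> G"
  obtain x y where xy: "x \<notin> F \<union> G" "x < a" "y \<notin> F \<union> G" "a < y"
    using between(1) a unfolding endless_interval_def by blast
  have notG: "\<not> d < a" if "d \<in> G" for d using between(3)[of a d] that a less_asym[of a d] by blast
  have notF: "\<not> a < d" if "d \<in> F" for d using between(2)[of d a] that a less_asym[of d a] by blast
  have 1: "\<forall>d\<in>F \<union> C \<union> G. d < a \<longrightarrow> (\<exists>x. d < x \<and> x < a)"
    using nbr(1)[OF a] between(2)[of _ x] xy notG by blast
  have 2: "\<forall>d\<in>F \<union> C \<union> G. a < d \<longrightarrow> (\<exists>x. a < x \<and> x < d)"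
    using nbr(2)[OF a] between(3)[of y] xy notF by blast
  have FC: "d < d'" if "d \<in> F" "d' \<in> C" for d d' using between(2) that C by blast
  have CG: "d' < d" if "d \<in> G" "d' \<in> C" for d d' using between(3) that C by blast
  have 3: "(\<exists>d\<in>F \<union> C \<union> G. d < a) \<and> (\<forall>d\<in>F \<union> C \<union> G. d < a \<longrightarrow> (\<exists>d'\<in>F \<union> C \<union> G. d < d' \<and> d' < a))"
    if "\<exists>d\<in>C. d < a" "\<forall>d\<in>C. d < a \<longrightarrow> (\<exists>d'\<in>C. d < d' \<and> d' < a)"
    using that FC notG by blast
  have 4: "(\<exists>d\<in>F \<union> C \<union> G. a < d) \<and> (\<forall>d\<in>F \<union> C \<union> G. a < d \<longrightarrow> (\<exists>d'\<in>F \<union> C \<union> G. a < d' \<and> d' < d))"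
    if "\<exists>d\<in>C. a < d" "\<forall>d\<in>C. a < d \<longrightarrow> (\<exists>d'\<in>C. a < d' \<and> d' < d)"
    using that CG notF by blast
  show "(\<exists>x. x < a) \<and> (\<exists>x. a < x) \<and>
    (\<forall>d\<in>F \<union> C \<union> G. d < a \<longrightarrow> (\<exists>x. d < x \<and> x < a)) \<and> (\<forall>d\<in>F \<union> C \<union> G. a < d \<longrightarrow> (\<exists>x. a < x \<and> x < d)) \<and>
    ((\<exists>d\<in>F \<union> C \<union> G. d < a) \<and> (\<forall>d\<in>F \<union> C \<union> G. d < a \<longrightarrow> (\<exists>d'\<in>F \<union> C \<union> G. d < d' \<and> d' < a)) \<or>
     (\<exists>d\<in>F \<union> C \<union> G. a < d) \<and> (\<forall>d\<in>F \<union> C \<union> G. a < d \<longrightarrow> (\<exists>d'\<in>F \<union> C \<union> G. a < d' \<and> d' < d)))"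
  proof (intro conjI exI[of "\<lambda>x. x < a", OF xy(2)] exI[of "\<lambda>x. a < x", OF xy(4)] 1 2)
    from limit[OF a] show "(\<exists>d\<in>F \<union> C \<union> G. d < a) \<and> (\<forall>d\<in>F \<union> C \<union> G. d < a \<longrightarrow> (\<exists>d'\<in>F \<union> C \<union> G. d < d' \<and> d' < a)) \<or>
     (\<exists>d\<in>F \<union> C \<union> G. a < d) \<and> (\<forall>d\<in>F \<union> C \<union> G. a < d \<longrightarrow> (\<exists>d'\<in>F \<union> C \<union> G. a < d' \<and> d' < d))"
    proof (elim disjE conjE)
      assume "\<exists>d\<in>C. d < a" "\<forall>d\<in>C. d < a \<longrightarrow> (\<exists>d'\<in>C. d < d' \<and> d' < a)"
      then show ?thesis by (intro disjI1 3)
    next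
      assume "\<exists>d\<in>C. a < d" "\<forall>d\<in>C. a < d \<longrightarrow> (\<exists>d'\<in>C. a < d' \<and> d' < d)"
      then show ?thesis by (intro disjI2 4)
    qed
  qed
qed

lemma realizable_between_finite_ends:
  assumes inf: "infinite (UNIV :: 'a set)" and F: "finite_end (<) F" and G: "finite_end (>) G"
    and C: "C \<subseteq> - (F \<union> G)" "C \<noteq> {}" "\<And>x. x \<in> C \<Longrightarrow> \<exists>y\<in>C. x < y"
    and pres: "presentable (<) C" and faithful: "faithful (<) (F \<union> C \<union> G)"
    and compl: "F \<union> C \<union> G = UNIV \<or> infinite (- (F \<union> C \<union> G))"
  shows "realizable (<)"
proof -
  interpret dual: linorder "(\<ge>)" "(>)" by (rule dual_linorder)
  note between = finite_ends_between[OF inf F G]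
  have slim: "slim (<) F" "slim (<) G" using F G slim_finite unfolding finite_end_def by blast+
  have FC: "x < y" if "x \<in> F" "y \<in> C" for x y using between(2) that C by blast
  have CG: "x < y" if "x \<in> F \<union> C" "y \<in> G" for x y using between(3,4) that C by blast
  have pres_FC: "presentable (<) (F \<union> C)" using slim(1) pres FC by (rule presentable_sum_less)
  show ?thesis
  proof (cases "F \<union> C \<union> G = UNIV")
    case True
    have "presentable (>) (G \<union> (F \<union> C))"
      using dual.presentable_sum_less[OF slim_dual[OF slim(2)] presentable_dual[OF pres_FC]] CG by blast
    then have "presentable (>) UNIV" using True by (simp add: Un_ac)
    then have "presentable (<) UNIV" using presentable_dual[of "(>)"] by simp
    then show ?thesis by (rule realizable_if_presentable)
  next
    case False
    have "\<exists>y\<in>F \<union> C. x < y" if "x \<in> F \<union> C" for x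
      using that FC C(2,3) by blast
    then show ?thesis
      using pres_FC slim(2) CG faithful compl False C(2)
      by (intro realizable_if_faithful_less[of "F \<union> C" G]) auto
  qed
qed

text \<open>A point outside the block \<open>C\<close> is above all of it or below all of it, and \<open>C\<close> is without endpoints. If
there is a point above \<open>C\<close>, all points above it that do not belong to \<open>G\<close> are outside \<open>C\<close>, and these have
no greatest one; likewise below. So the complement is empty or infinite.\<close>

lemma realizable_zeta:
  assumes inf: "infinite (UNIV :: 'a set)" and F: "finite_end (<) F" and G: "finite_end (>) G"
    and c: "successors (<) c" and d: "successors (>) d" and cd: "c 0 = d 0" "c 0 \<notin> F \<union> G"
  shows "realizable (<)"
proof -
  interpret dual: linorder "(\<ge>)" "(>)" by (rule dual_linorder)
  note between = finite_ends_between[OF inf F G]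
  let ?I = "- (F \<union> G)"
  have I: "endless_interval (<) ?I" by (rule between(1))
  then have I': "endless_interval (>) ?I" by (simp only: endless_interval_dual[of "(<)" ?I])
  have cI: "c j \<in> ?I" for j using successors_in_endless_interval[OF I c] cd(2) by blast
  have dI: "d j \<in> ?I" for j using dual.successors_in_endless_interval[OF I' d] cd by (metis ComplI)
  \<comment> \<open>the two halves of the block share \<open>c 0 = d 0\<close>, which is counted with the upper one\<close>
  define d' where "d' j = d (Suc j)" for j
  have d': "successors (>) d'" using d unfolding successors_def d'_def by blast
  define C where "C = range d' \<union> range c"
  have d_insert: "range d = insert (c 0) (range d')"
  proof (intro subset_antisym subsetI)
    fix x assume "x \<in> range d"
    then obtain j where "x = d j" by blast
    then show "x \<in> insert (c 0) (range d')" by (cases j) (simp_all add: d'_def cd(1))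
  next
    fix x assume "x \<in> insert (c 0) (range d')"
    then show "x \<in> range d" unfolding d'_def cd(1) by blast
  qed
  have C_eq: "C = range d \<union> range c" unfolding C_def d_insert by blast
  have dc: "d' i < c j" for i j
  proof -
    have "d' i < d 0" using dual.successors_less_iff[OF d, where i = 0 and j = "Suc i"] by (simp add: d'_def)
    also have "d 0 \<le> c j"
      using successors_less_iff[OF c, of 0 j] cd(1) by (cases j) (auto simp: less_imp_le)
    finally show ?thesis .
  qed
  have CI: "C \<subseteq> ?I" using cI dI by (auto simp: C_eq)
  have up: "\<exists>y\<in>C. x < y" if "x \<in> C" for x
    using that successors_ex_greater[OF c] dc unfolding C_def by blast
  have down: "\<exists>y\<in>C. y < x" if "x \<in> C" for x
    using that dual.successors_ex_greater[OF d'] dc unfolding C_def by blast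
  have side: "(\<forall>x\<in>C. x < a) \<or> (\<forall>x\<in>C. a < x)" if "a \<notin> C" for a
  proof -
    have a: "a \<notin> range c" "a \<notin> range d" using that unfolding C_eq by blast+
    show ?thesis
    proof (cases "c 0 < a")
      case True
      have "c j < a" for j using successors_no_gap[OF c _ a(1)] True by (simp add: less_imp_le)
      moreover have "d' j < a" for j using dc[of j 0] True by (rule less_trans)
      ultimately show ?thesis unfolding C_def by blast
    next
      case False
      then have less: "a < d 0" using a(1) cd(1) by (metis neq_iff rangeI)
      have "a < d j" for j using dual.successors_no_gap[OF d _ a(2)] less by (simp add: less_imp_le)
      moreover have "a < c j" for j
      proof -
        have "a < d' 0" using \<open>\<And>j. a < d j\<close> by (simp add: d'_def)
        then show ?thesis using dc by (rule less_trans)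
      qed
      ultimately show ?thesis unfolding C_eq by blast
    qed
  qed
  have limit: "(\<exists>e\<in>C. e < a) \<and> (\<forall>e\<in>C. e < a \<longrightarrow> (\<exists>e'\<in>C. e < e' \<and> e' < a)) \<or>
      (\<exists>e\<in>C. a < e) \<and> (\<forall>e\<in>C. a < e \<longrightarrow> (\<exists>e'\<in>C. a < e' \<and> e' < e))"
    if "a \<notin> C" for a
  proof -
    have ne: "c 0 \<in> C" by (simp add: C_def)
    from side[OF that] show ?thesis
    proof
      assume "\<forall>x\<in>C. x < a"
      then show ?thesis using ne up by (intro disjI1) blast
    next
      assume "\<forall>x\<in>C. a < x"
      then show ?thesis using ne down by (intro disjI2) blast
    qed
  qed
  have nbr: "\<exists>x. e < x \<and> x < a" if "a \<notin> C" "e \<in> C" "e < a" for a e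
    using side[OF that(1)] up[OF that(2)] that less_asym[OF that(3)] by blast
  have nbr': "\<exists>x. a < x \<and> x < e" if "a \<notin> C" "e \<in> C" "a < e" for a e
    using side[OF that(1)] down[OF that(2)] that less_asym[OF that(3)] by blast
  have faithful: "faithful (<) (F \<union> C \<union> G)"
  proof (rule faithful_between_finite_ends[OF inf F G CI])
    fix a assume "a \<notin> F \<union> C \<union> G"
    then have a: "a \<notin> C" by blast
    show "\<exists>x. e < x \<and> x < a" if "e \<in> C" "e < a" for e using nbr[OF a that] .
    show "\<exists>x. a < x \<and> x < e" if "e \<in> C" "a < e" for e using nbr'[OF a that] .
    show "(\<exists>e\<in>C. e < a) \<and> (\<forall>e\<in>C. e < a \<longrightarrow> (\<exists>e'\<in>C. e < e' \<and> e' < a)) \<or>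
      (\<exists>e\<in>C. a < e) \<and> (\<forall>e\<in>C. a < e \<longrightarrow> (\<exists>e'\<in>C. a < e' \<and> e' < e))" using limit[OF a] .
  qed
  have compl: "F \<union> C \<union> G = UNIV \<or> infinite (- (F \<union> C \<union> G))"
  proof (cases "F \<union> C \<union> G = UNIV")
    case False
    let ?R = "- (F \<union> C \<union> G)"
    obtain a where a: "a \<in> ?R" using False by blast
    then have "a \<notin> C" by blast
    from side[OF this] have "infinite ?R"
    proof
      assume above: "\<forall>x\<in>C. x < a"
      have "infinite {y\<in>?I. a \<le> y}"
      proof (rule infinite_growing)
        show "{y\<in>?I. a \<le> y} \<noteq> {}" using a by blast
        fix x assume x: "x \<in> {y\<in>?I. a \<le> y}"
        then obtain y where "y \<in> ?I" "x < y" using I unfolding endless_interval_def by blast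
        then show "\<exists>y\<in>{y\<in>?I. a \<le> y}. x < y" using x by (auto intro: order_trans less_imp_le)
      qed
      moreover have "{y\<in>?I. a \<le> y} \<subseteq> ?R" using above leD by blast
      ultimately show ?thesis using finite_subset by blast
    next
      assume below: "\<forall>x\<in>C. a < x"
      have "infinite {y\<in>?I. y \<le> a}"
      proof (rule dual.infinite_growing)
        show "{y\<in>?I. y \<le> a} \<noteq> {}" using a by blast
        fix x assume x: "x \<in> {y\<in>?I. y \<le> a}"
        then obtain y where "y \<in> ?I" "y < x" using I unfolding endless_interval_def by blast
        then show "\<exists>y\<in>{y\<in>?I. y \<le> a}. y < x" using x by (auto intro: order_trans less_imp_le)
      qed
      moreover have "{y\<in>?I. y \<le> a} \<subseteq> ?R" using below leD by blast
      ultimately show ?thesis using finite_subset by blast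
    qed
    then show ?thesis by blast
  qed simp
  have slim_d': "slim (<) (range d')"
    using slim_dual[OF dual.presentable_successors(2)[OF d']] by simp
  have "presentable (<) C"
    unfolding C_def using dc by (intro presentable_sum_less[OF slim_d' presentable_successors(1)[OF c]]) auto
  moreover have "C \<noteq> {}" by (simp add: C_def)
  ultimately show ?thesis
    using realizable_between_finite_ends[OF inf F G CI _ up _ faithful compl] by blast
qed

text \<open>Only every second block of the sequence is used, so that the complement is infinite. A point outside
the chosen blocks is below all of them, or it is above the initial point of one and then above the whole
of that block; in the first case the points of \<open>C\<close> above it have no least one, and in the second case the
points of \<open>C\<close> below it have no greatest one.\<close>

lemma realizable_descending_blocks:
  assumes inf: "infinite (UNIV :: 'a set)" and F: "finite_end (<) F" and G: "finite_end (>) G"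
    and k: "\<And>i::nat. k i \<in> - (F \<union> G) \<and> omega_block_start (<) (k i) \<and> k (Suc i) < k i"
  shows "realizable (<)"
proof -
  interpret dual: linorder "(\<ge>)" "(>)" by (rule dual_linorder)
  note between = finite_ends_between[OF inf F G]
  let ?I = "- (F \<union> G)"
  have I: "endless_interval (<) ?I" by (rule between(1))
  have k_less: "k i < k j \<longleftrightarrow> j < i" for i j
    using dual.lift_Suc_mono_less_iff[of k i j] k by blast
  have k_limit: "\<not> (\<exists>y. covers (<) y (k i))" for i using k unfolding omega_block_start_def by blast
  have "\<forall>i. \<exists>c. successors (<) c \<and> c 0 = k (2 * i)" using k unfolding omega_block_start_def by blast
  then obtain c where c: "\<And>i. successors (<) (c i)" "\<And>i. c i 0 = k (2 * i)" by metis
  have c_ge: "k (2 * i) \<le> c i j" for i j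
    using successors_less_iff[OF c(1)[of i], of 0 j] c(2)[of i] by (cases j) (auto simp: less_imp_le)
  have c_less_k: "c i j < k m" if "m < 2 * i" for i j m
    using successors_below_limit[OF c(1)[of i] _ k_limit] that by (simp add: c(2) k_less)
  have less_block: "c i j < c i' j'" if "i' < i" for i i' j j'
  proof -
    have "c i j < k (2 * i')" using that by (intro c_less_k) simp
    then show ?thesis using c_ge by (rule less_le_trans)
  qed
  have order: "c i j < c i' j' \<longleftrightarrow> i' < i \<or> i = i' \<and> j < j'" for i j i' j'
  proof -
    consider "i' < i" | "i = i'" | "i < i'" using nat_neq_iff by blast
    then show ?thesis
    proof cases
      case 1
      then show ?thesis using less_block[OF 1] by simp
    next
      case 2
      then show ?thesis using successors_less_iff[OF c(1)[of i]] by simp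
    next
      case 3
      then have "\<not> c i j < c i' j'" using less_block[OF 3, of j' j] by (simp add: less_imp_not_less)
      then show ?thesis using 3 by simp
    qed
  qed
  define C where "C = (\<Union>i. range (c i))"
  have CI: "C \<subseteq> ?I"
  proof -
    have "c i j \<in> ?I" for i j
      using successors_in_endless_interval[OF I c(1)[of i]] k by (simp add: c(2))
    then show ?thesis unfolding C_def by blast
  qed
  have up: "\<exists>y\<in>C. x < y" if "x \<in> C" for x
    using that successors_ex_greater[OF c(1)] unfolding C_def by blast
  have nbr: "\<exists>x. e < x \<and> x < a" if "a \<notin> C" "e \<in> C" "e < a" for a e
  proof -
    obtain i j where "e = c i j" using \<open>e \<in> C\<close> unfolding C_def by blast
    then show ?thesis using successors_no_new_neighbour[OF c(1)[of i], of j a] that unfolding C_def by blast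
  qed
  have nbr': "\<exists>x. a < x \<and> x < e" if a: "a \<notin> C" and e: "e \<in> C" "a < e" for a e
  proof (rule ccontr)
    assume "\<not> ?thesis"
    then have cov: "covers (<) a e" using e(2) unfolding covers_def by blast
    obtain i j where ij: "e = c i j" using e(1) unfolding C_def by blast
    show False
    proof (cases j)
      case 0
      then show ?thesis using cov k_limit[of "2 * i"] ij c(2) by auto
    next
      case (Suc j')
      have "covers (<) (c i j') e" using c(1)[of i] unfolding ij Suc successors_def by blast
      then have "\<not> a < c i j'" "\<not> c i j' < a" using cov unfolding covers_def by blast+
      then have "a = c i j'" by (metis neq_iff)
      then show False using a unfolding C_def by blast
    qed
  qed
  have limit: "(\<exists>e\<in>C. e < a) \<and> (\<forall>e\<in>C. e < a \<longrightarrow> (\<exists>e'\<in>C. e < e' \<and> e' < a)) \<or>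
      (\<exists>e\<in>C. a < e) \<and> (\<forall>e\<in>C. a < e \<longrightarrow> (\<exists>e'\<in>C. a < e' \<and> e' < e))"
    if a: "a \<notin> C" for a
  proof (cases "\<exists>e\<in>C. e < a")
    case True
    have "\<exists>e'\<in>C. e < e' \<and> e' < a" if e: "e \<in> C" "e < a" for e
    proof -
      obtain i j where ij: "e = c i j" using e(1) unfolding C_def by blast
      have "c i 0 \<le> a" using e(2) c_ge[of i j] c(2)[of i] unfolding ij by (metis le_less_trans less_imp_le)
      then have "c i (Suc j) < a" using successors_no_gap[OF c(1)[of i]] a unfolding C_def by blast
      moreover have "e < c i (Suc j)" using successors_less_iff[OF c(1)[of i]] unfolding ij by simp
      ultimately show ?thesis unfolding C_def by blast
    qed
    then show ?thesis using True by blast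
  next
    case False
    have above: "a < e" if "e \<in> C" for e using False that a by (metis neq_iff)
    have "\<exists>e'\<in>C. e' < e" if e: "e \<in> C" for e
    proof -
      obtain i j where ij: "e = c i j" using e unfolding C_def by blast
      have "c (Suc i) 0 < e" unfolding ij order by simp
      then show ?thesis unfolding C_def by blast
    qed
    moreover have "c 0 0 \<in> C" unfolding C_def by blast
    ultimately show ?thesis using above by (intro disjI2) blast
  qed
  have faithful: "faithful (<) (F \<union> C \<union> G)"
  proof (rule faithful_between_finite_ends[OF inf F G CI])
    fix a assume "a \<notin> F \<union> C \<union> G"
    then have a: "a \<notin> C" by blast
    show "\<exists>x. e < x \<and> x < a" if "e \<in> C" "e < a" for e using nbr[OF a that] .
    show "\<exists>x. a < x \<and> x < e" if "e \<in> C" "a < e" for e using nbr'[OF a that] .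
    show "(\<exists>e\<in>C. e < a) \<and> (\<forall>e\<in>C. e < a \<longrightarrow> (\<exists>e'\<in>C. e < e' \<and> e' < a)) \<or>
      (\<exists>e\<in>C. a < e) \<and> (\<forall>e\<in>C. a < e \<longrightarrow> (\<exists>e'\<in>C. a < e' \<and> e' < e))" using limit[OF a] .
  qed
  have "k (2 * i + 1) \<notin> C" for i
  proof
    assume "k (2 * i + 1) \<in> C"
    then obtain i' j' where eq: "k (2 * i + 1) = c i' j'" unfolding C_def by blast
    show False
    proof (cases "2 * i + 1 < 2 * i'")
      case True
      then have "c i' j' < k (2 * i + 1)" by (rule c_less_k)
      then show False using eq by auto
    next
      case False
      then have "k (2 * i + 1) < k (2 * i')" by (simp add: k_less) presburger
      then have "k (2 * i + 1) < c i' j'" using c_ge by (rule less_le_trans)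
      then show False using eq by auto
    qed
  qed
  then have "range (\<lambda>i. k (2 * i + 1)) \<subseteq> - (F \<union> C \<union> G)" using k by blast
  moreover have "inj (\<lambda>i. k (2 * i + 1))"
  proof (rule injI)
    fix i j assume eq: "k (2 * i + 1) = k (2 * j + 1)"
    have "\<not> i < j" "\<not> j < i" using k_less[of "2 * i + 1" "2 * j + 1"] k_less[of "2 * j + 1" "2 * i + 1"] eq
      by auto
    then show "i = j" by simp
  qed
  ultimately have compl: "infinite (- (F \<union> C \<union> G))"
    using range_inj_infinite finite_subset by blast
  have "presentable (<) C"
    unfolding C_def by (rule presentable_double_sequence[OF strict_linear_less order])
  moreover have "C \<noteq> {}" by (auto simp: C_def)
  ultimately show ?thesis
    using realizable_between_finite_ends[OF inf F G CI _ up _ faithful] compl by blast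
qed

text \<open>The two ends of the order are finite pieces or infinite blocks. Reversing the order reduces the mixed
cases to each other, and ascending sequences of blocks to descending ones.\<close>

theorem realizable_if_scattered:
  assumes inf: "infinite (UNIV :: 'a set)" and sc: "scattered_on (<) (UNIV :: 'a set)"
  shows "realizable (<)"
proof -
  interpret dual: linorder "(\<ge>)" "(>)" by (rule dual_linorder)
  consider (omega2) c d where "omega_end (<) c" "omega_end (>) d"
    | (omega_finite) c G where "omega_end (<) c" "finite_end (>) G"
    | (finite_omega) F d where "finite_end (<) F" "omega_end (>) d"
    | (finite2) F G where "finite_end (<) F" "finite_end (>) G"
    using finite_end_or_omega_end dual.finite_end_or_omega_end by blast
  then show ?thesis
  proof cases
    case omega2
    then show ?thesis by (rule realizable_omega_ends)
  next
    case omega_finite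
    then show ?thesis by (rule realizable_omega_and_finite_end)
  next
    case finite_omega
    then have "realizable (>)" by (intro dual.realizable_omega_and_finite_end) auto
    then show ?thesis by (rule realizable_below_dual)
  next
    case finite2
    have I: "endless_interval (<) (- (F \<union> G))" by (rule finite_ends_between(1)[OF inf finite2])
    moreover have "scattered_on (<) (- (F \<union> G))" using sc scattered_on_subset by blast
    ultimately show ?thesis
    proof (cases rule: endless_interval_blocks)
      case (zeta c d)
      then show ?thesis using realizable_zeta[OF inf finite2] by blast
    next
      case (descending k)
      then show ?thesis by (rule realizable_descending_blocks[OF inf finite2])
    next
      case (ascending k)
      then have "realizable (>)"
        using dual.realizable_descending_blocks[OF inf, of G F k] finite2 by (simp add: Un_commute)
      then show ?thesis by (rule realizable_below_dual)
    qed
  qed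
qed

end

section \<open>Generically and coarsely c.e. copies\<close>

lemma strict_linear_imp_linorder:
  assumes "strict_linear lt"
  shows "class.linorder (\<lambda>x y. x = y \<or> lt x y) lt"
  using strict_linearD[OF assms] by unfold_locales metis+

text \<open>The criterion was derived inside the type class of linear orders, with the order as a parameter; it
is instantiated here with an arbitrary order on the numbers.\<close>

lemma Sigma_elementary_2_if_faithful:
  assumes lin: "strict_linear lt" and "faithful lt D" "scattered_on lt D"
  shows "Sigma_elementary 2 (induced (omega_struct (weak_rel lt)) D) (omega_struct (weak_rel lt))"
proof -
  interpret linorder "\<lambda>x y. x = y \<or> lt x y" lt by (rule strict_linear_imp_linorder[OF lin])
  show ?thesis
    by (rule Sigma_elementary_2_if_back_and_forth[OF lin back_and_forth_if_faithful[OF assms(2,3)]])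
qed

lemma faithful_image:
  assumes f: "bij f" and lt: "\<And>x y. lt' (f x) (f y) \<longleftrightarrow> lt x y" and B: "faithful lt B"
  shows "faithful lt' (f ` B)"
proof -
  have all: "(\<forall>y. P y) \<longleftrightarrow> (\<forall>x. P (f x))" and ex: "(\<exists>y. P y) \<longleftrightarrow> (\<exists>x. P (f x))" for P
    using f by (metis bij_pointE)+
  have mem: "f x \<in> f ` B \<longleftrightarrow> x \<in> B" for x
    using f by (simp add: bij_is_inj inj_image_mem_iff)
  show ?thesis
    using B unfolding faithful_def all[of "\<lambda>a. a \<notin> f ` B \<longrightarrow> _ a"] mem bex_simps ball_simps lt
      ex[of "\<lambda>x. lt' x _"] ex[of "\<lambda>x. lt' _ x"] ex[of "\<lambda>x. lt' _ x \<and> lt' x _"] by simp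
qed

lemma scattered_on_image:
  assumes iso: "order_iso_on B lt D s" and sc: "scattered_on lt B" and lin: "strict_linear s"
  shows "scattered_on s D"
  unfolding scattered_on_def
proof
  assume "\<exists>f :: rat \<Rightarrow> 'b. range f \<subseteq> D \<and> (\<forall>p q. p < q \<longrightarrow> s (f p) (f q))"
  then obtain f :: "rat \<Rightarrow> 'b" where f: "range f \<subseteq> D" "\<And>p q. p < q \<Longrightarrow> s (f p) (f q)" by blast
  obtain h where h: "bij_betw h B D" "\<And>x y. x \<in> B \<Longrightarrow> y \<in> B \<Longrightarrow> lt x y \<longleftrightarrow> s (h x) (h y)"
    using iso unfolding order_iso_on_def by blast
  define g where "g p = inv_into B h (f p)" for p
  have D: "f p \<in> h ` B" for p using f(1) h(1) by (auto simp: bij_betw_def)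
  have g: "g p \<in> B" "h (g p) = f p" for p
    unfolding g_def by (rule inv_into_into[OF D], rule f_inv_into_f[OF D])
  have "lt (g p) (g q)" if "p < q" for p q using f(2)[OF that] by (simp add: h(2) g)
  then show False using sc g(1) unfolding scattered_on_def by blast
qed

lemma induced_omega_struct_cong:
  assumes "\<And>x y. x \<in> D \<Longrightarrow> y \<in> D \<Longrightarrow> lt x y \<longleftrightarrow> lt' x y"
  shows "induced (omega_struct (weak_rel lt)) D = induced (omega_struct (weak_rel lt')) D"
  using assms by (auto simp: induced_def omega_struct_def weak_rel_def)

lemma decidable_rel_weak:
  assumes "decidable_rel s" "decidable_set D"
  shows "ce_rel (Restr (weak_rel s) D)"
proof -
  have "decidable_rel (\<lambda>x y. (x = y \<or> s x y) \<and> x \<in> D \<and> y \<in> D)"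
    unfolding decidable_rel_def
    by (intro decidable_conj decidable_disj decidable_eq decidable_related[OF assms(1)]
        decidable_member[OF assms(2)] computable_nth) auto
  from ce_rel_decidable[OF this] show ?thesis
    by (rule back_subst[of ce_rel]) (auto simp: weak_rel_def)
qed

lemma ex_bij_extending:
  fixes h :: "nat \<Rightarrow> nat"
  assumes h: "bij_betw h B D" and compl: "B = UNIV \<and> D = UNIV \<or> infinite (- B) \<and> infinite (- D)"
  obtains f where "bij f" "\<And>x. x \<in> B \<Longrightarrow> f x = h x"
proof -
  have "\<exists>g. bij_betw g (- B) (- D)"
    using compl
  proof
    assume "infinite (- B) \<and> infinite (- D)"
    then have "bij_betw (enumerate (- D) \<circ> inv_into UNIV (enumerate (- B))) (- B) (- D)"
      by (intro bij_betw_trans[OF bij_betw_inv_into] bij_enumerate) auto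
    then show ?thesis by blast
  qed (auto simp: bij_betw_def)
  then obtain g where g: "bij_betw g (- B) (- D)" by blast
  define f where "f x = (if x \<in> B then h x else g x)" for x
  have "bij_betw f B D" using h by (subst bij_betw_cong[of B f h]) (auto simp: f_def)
  moreover have "bij_betw f (- B) (- D)" using g by (subst bij_betw_cong[of "- B" f g]) (auto simp: f_def)
  ultimately have "bij_betw f (B \<union> - B) (D \<union> - D)" by (rule bij_betw_combine) simp
  then have "bij f" by simp
  then show thesis by (rule that) (simp add: f_def)
qed

theorem theorem3p7:
  fixes L :: "nat rel"
  assumes "linear_order_on UNIV L"
    and "scattered L"
  shows "(\<exists>M. copy_of M L \<and> Sigma_generically_ce 2 M) \<and>
         (\<exists>M. copy_of M L \<and> Sigma_coarsely_ce 2 M)"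
proof -
  define lt where "lt x y \<longleftrightarrow> (x, y) \<in> L \<and> x \<noteq> y" for x y
  have refl: "(x, x) \<in> L" and antisym: "(x, y) \<in> L \<Longrightarrow> (y, x) \<in> L \<Longrightarrow> x = y"
    and trans: "(x, y) \<in> L \<Longrightarrow> (y, z) \<in> L \<Longrightarrow> (x, z) \<in> L" and total: "x = y \<or> (x, y) \<in> L \<or> (y, x) \<in> L" for x y z
    using assms(1)
    unfolding linear_order_on_def partial_order_on_def preorder_on_def refl_on_def antisym_def trans_def total_on_def
    by blast+
  have lin: "strict_linear lt"
    unfolding strict_linear_def lt_def using antisym trans total by blast
  have L_weak: "L = weak_rel lt" unfolding weak_rel_def lt_def using refl by auto
  have sc: "scattered_on lt UNIV"
    unfolding scattered_on_def
  proof
    assume "\<exists>f :: rat \<Rightarrow> nat. range f \<subseteq> UNIV \<and> (\<forall>p q. p < q \<longrightarrow> lt (f p) (f q))"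
    then obtain f :: "rat \<Rightarrow> nat" where f: "\<And>p q. p < q \<Longrightarrow> lt (f p) (f q)" by blast
    have "p \<le> q \<longleftrightarrow> (f p, f q) \<in> L" for p q
    proof (cases p q rule: linorder_cases)
      case less
      then show ?thesis using f[OF less] by (simp add: lt_def)
    next
      case equal
      then show ?thesis by (simp add: refl)
    next
      case greater
      then have "(f p, f q) \<notin> L" using f[OF greater] antisym unfolding lt_def by blast
      then show ?thesis using greater by simp
    qed
    then show False using assms(2) unfolding scattered_def by blast
  qed
  interpret L: linorder "\<lambda>x y. x = y \<or> lt x y" lt by (rule strict_linear_imp_linorder[OF lin])
  have "realizable lt" by (rule L.realizable_if_scattered[OF infinite_UNIV_nat sc])
  then obtain B D s where B: "faithful lt B" and iso: "order_iso_on B lt D s"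
    and D: "dense D" "decidable_set D" and s: "strict_linear s" "decidable_rel s" "faithful s D"
    and compl: "B = UNIV \<and> D = UNIV \<or> infinite (- B) \<and> infinite (- D)"
    unfolding realizable_def by blast
  obtain h where h: "bij_betw h B D" "\<And>x y. x \<in> B \<Longrightarrow> y \<in> B \<Longrightarrow> lt x y \<longleftrightarrow> s (h x) (h y)"
    using iso unfolding order_iso_on_def by blast
  obtain f where f: "bij f" "\<And>x. x \<in> B \<Longrightarrow> f x = h x" using ex_bij_extending[OF h(1) compl] by blast
  define lt' where "lt' x y \<longleftrightarrow> lt (inv f x) (inv f y)" for x y
  have lt'_f: "lt' (f x) (f y) \<longleftrightarrow> lt x y" for x y using f(1) by (simp add: lt'_def bij_is_inj)
  have lin': "strict_linear lt'"
    unfolding strict_linear_def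
  proof (intro conjI allI impI)
    note lt = strict_linearD[OF lin]
    fix x y z
    show "\<not> lt' x x" unfolding lt'_def by (rule lt(1))
    show "lt' x z" if "lt' x y" "lt' y z" using that unfolding lt'_def by (rule lt(2))
    show "lt' x y \<or> lt' y x" if "x \<noteq> y"
    proof -
      have "inv f x \<noteq> inv f y" using that f(1) by (metis bij_inv_eq_iff)
      then show ?thesis unfolding lt'_def by (rule lt(3))
    qed
  qed
  have fB: "f ` B = D"
    using h(1) f(2) by (simp add: bij_betw_def)
  have faithful': "faithful lt' D" using faithful_image[OF f(1), of lt' lt B] lt'_f B fB by simp
  have same: "lt' x y \<longleftrightarrow> s x y" if "x \<in> D" "y \<in> D" for x y
  proof -
    obtain a b where ab: "a \<in> B" "b \<in> B" "x = f a" "y = f b"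
      using \<open>x \<in> D\<close> \<open>y \<in> D\<close> unfolding fB[symmetric] by blast
    have "lt' x y \<longleftrightarrow> lt a b" unfolding ab by (rule lt'_f)
    also have "\<dots> \<longleftrightarrow> s x y" using h(2)[OF ab(1,2)] f(2)[OF ab(1)] f(2)[OF ab(2)] unfolding ab by simp
    finally show ?thesis .
  qed
  have sc_s: "scattered_on s D"
    by (rule scattered_on_image[OF iso _ s(1)]) (rule scattered_on_subset[OF sc], simp)
  have sc': "scattered_on lt' D"
    using sc_s same unfolding scattered_on_def by (metis range_subsetD)
  define M where "M = weak_rel lt'"
  define E where "E = induced (omega_struct M) D"
  have E_s: "E = induced (omega_struct (weak_rel s)) D"
    unfolding E_def M_def by (rule induced_omega_struct_cong[OF same])
  have elem_M: "Sigma_elementary 2 E (omega_struct M)"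
    unfolding E_def M_def by (rule Sigma_elementary_2_if_faithful[OF lin' faithful' sc'])
  have elem_s: "Sigma_elementary 2 E (omega_struct (weak_rel s))"
    unfolding E_s by (rule Sigma_elementary_2_if_faithful[OF s(1,3) sc_s])
  have copy: "copy_of M L"
    unfolding copy_of_def M_def L_weak weak_rel_def
    using f(1) lt'_f by (intro exI[of _ f]) (auto simp: bij_is_inj inj_eq)
  have ce_D: "ce_set D" by (rule ce_set_decidable[OF D(2)])
  have "ce_struct E"
    unfolding ce_struct_def E_s using ce_D decidable_rel_weak[OF s(2) D(2)]
    by (simp add: induced_def omega_struct_def)
  then have "Sigma_generically_ce 2 M"
    unfolding Sigma_generically_ce_def using D(1) ce_D elem_M unfolding E_def by blast
  moreover have "ce_struct (omega_struct (weak_rel s))"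
    unfolding ce_struct_def
    using ce_set_decidable[OF decidable_set_UNIV] decidable_rel_weak[OF s(2) decidable_set_UNIV]
    by (simp add: omega_struct_def)
  then have "Sigma_coarsely_ce 2 M"
    unfolding Sigma_coarsely_ce_def using D(1) elem_M elem_s
    by (intro exI[of _ D] exI[of _ "weak_rel s"] exI[of _ E]) (simp add: E_def induced_def)
  ultimately show ?thesis using copy by blast
qed

end
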